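(* Let $P = F_1\oplus L_1 + F_2\oplus L_2+\cdots + F_k\oplus L_k$ be a poset on $[n]=\{1,\dots,n\}$, where each $F_i$ is a rooted forest and each $L_i$ is a ladder. Then the eigenvalues of the promotion transition matrix $M^P$ are linear in $x_1,\dots,x_n$, i.e. the characteristic polynomial $\det(\lambda I-M^P)$ factors as a product of factors $\lambda-\sum_{k} c_kx_k$ with constant coefficients $c_k$. Moreover, the eigenvalues, with multiplicities, can be explicitly computed as follows. Let $(a_1,b_1),\dots,(a_r,b_r)$ be a list of all levels $Q=\{a,b\}$ of size two of the ladders $L_1,\dots,L_k$ (each such level listed once, with an arbitrarily chosen order of its two elements). Let $P_0$ be the rooted forest obtained from $P$ by adding the relations $a_t\prec b_t$ for all $t=1,\dots,r$ (so each ladder $L_i$ is replaced by a chain on the same elements), and for $1\le t\le r$ let $P_t=P_{t-1}\setminus\{(a_t,b_t)\}$, so that $P_r=P$. Let $E_0$ be the multiset consisting, for each upset $S$ of $P_0$, of the linear form $x_S=\sum_{i\in S}x_i$ with multiplicity $d_S$, where $d_S$ is the derangement number of $S$ in the lattice (ordered by inclusion) of upsets of $P_0$. For $t=1,\dots,r$ let $E_t$ be the multiset obtained from $E_{t-1}$ by replacing each linear form $\ell=\sum_k c_kx_k$ in $E_{t-1}$ (counted with multiplicity) by the following two forms, where $a=a_t$, $b=b_t$ and all order relations are those of $P_{t-1}$: - if $c_a,c_b$ are both nonzero or both zero: $\ \ell\ $ and $\ \displaystyle\sum_{k\not\preceq b}c_kx_k-\sum_{k\prec a}c_kx_k$; -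 if $c_a=0$ and $c_b\neq0$: $\ \ell\ $ and $\ \ell-c_bx_b+c_bx_a$. (These are the only cases that occur.) Then $E_r$ is the multiset of eigenvalues of $M^P$.
   Context: All posets are finite. The direct sum $P+Q$ is the disjoint union of $P$ and $Q$ with no relations between them. The ordinal sum $P\oplus Q$ is the disjoint union with the relations of $P$, of $Q$, and $x\prec y$ for all $x\in P$, $y\in Q$. In expressions such as $F_1\oplus L_1+F_2\oplus L_2$ the operation $\oplus$ is performed before $+$. A rooted tree is a connected poset in which each element is covered by at most one element; a rooted forest is a disjoint union (direct sum) of rooted trees. A ladder is a poset $Q_1\oplus\cdots\oplus Q_m$ where each $Q_j$ (a level) is an antichain of size 1 or 2. The forests $F_i$ and ladders $L_i$ may be empty. A linear extension of a poset $P$ with $n$ elements is a word $\pi=\pi_1\cdots\pi_n$ listing each element of $P$ once, such that $\pi_i\prec\pi_j$ implies $i<j$; $\mathcal L(P)$ is the set of linear extensions. For $1\le i\le n-1$, $\tau_i\pi$ is obtained from $\pi$ by interchanging $\pi_i$ and $\pi_{i+1}$ if these are incomparable in $P$, and $\tau_i\pi=\pi$ otherwise. For $1\le i\le n$ the extended promotion operator is $\partial_i=\tau_{n-1}\cdots\tau_{i+1}\tau_i$ ($\tau_i$ is applied first; $\partial_n$ is the identity). The promotion transition matrix $M^P$ has rows and columns indexed by $\mathcal L(P)$, and its $(\pi,\pi')$ entry is $\sum x_{\pi_i}$, the sum over all $i$ with $\partial_i\pi=\pi'$. Here $x_1,\dots,x_n$ are regarded as indeterminates (parameters). If $P=Q'\oplus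 a\oplus b\oplus Q''+P_2$ (with $Q',Q'',P_2$ possibly empty), then $P\setminus\{(a,b)\}$ denotes the poset $Q'\oplus(\{a\}+\{b\})\oplus Q''+P_2$ obtained by dropping only the relation $a\prec b$. An upset $S$ of a poset is a subset such that $x\in S$ and $y\succeq x$ imply $y\in S$. In a finite poset with minimum $\hat0$ and maximum $\hat1$, the derangement number of an element $x$ is $d_x=\sum_{y\succeq x}\mu(x,y)f([y,\hat1])$, where $\mu$ is the Möbius function and $f([y,\hat1])$ is the number of maximal chains of the interval $[y,\hat1]$. *)

theory Defs
  imports
    "HOL-Library.Poly_Mapping"
    "HOL-Library.Multiset"
    "HOL-Library.Disjoint_Sets"
    "Jordan_Normal_Form.Char_Poly"
begin

text \<open>
  A finite poset is represented by its reflexive order relation \<open>r :: 'a rel\<close>, the ground set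
  being \<open>Field r\<close>; thus \<open>(x, y) \<in> r\<close> means \<open>x \<preceq> y\<close>. The empty poset is \<open>{}\<close>, the antichain on a
  set \<open>A\<close> is \<open>Id_on A\<close>, and the direct sum of posets with disjoint ground sets is the union of
  the relations.
\<close>

definition finite_poset :: "'a rel \<Rightarrow> bool" where
  "finite_poset r \<longleftrightarrow> finite (Field r) \<and> Partial_order r"

definition ordinal_sum :: "'a rel \<Rightarrow> 'a rel \<Rightarrow> 'a rel"  (infixr \<open>\<oplus>\<^sub>o\<close> 65) where
  "r \<oplus>\<^sub>o s = r \<union> s \<union> Field r \<times> Field s"

definition covered_by :: "'a rel \<Rightarrow> 'a \<Rightarrow> 'a \<Rightarrow> bool" where
  "covered_by r x y \<longleftrightarrow>
     (x, y) \<in> r \<and> x \<noteq> y \<and> (\<forall>z. (x, z) \<in> r \<and> (z, y) \<in> r \<longrightarrow> z = x \<or> z = y)"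

definition connected_poset :: "'a rel \<Rightarrow> bool" where
  "connected_poset r \<longleftrightarrow>
     Field r \<noteq> {} \<and> (\<forall>x\<in>Field r. \<forall>y\<in>Field r. (x, y) \<in> (r \<union> r\<inverse>)\<^sup>*)"

definition rooted_tree :: "'a rel \<Rightarrow> bool" where
  "rooted_tree r \<longleftrightarrow> finite_poset r \<and> connected_poset r \<and>
     (\<forall>x y z. covered_by r x y \<and> covered_by r x z \<longrightarrow> y = z)"

definition rooted_forest :: "'a rel \<Rightarrow> bool" where
  "rooted_forest r \<longleftrightarrow> (\<exists>T. finite T \<and> (\<forall>t\<in>T. rooted_tree t) \<and>
     disjoint_family_on Field T \<and> r = \<Union>T)"

text \<open>A ladder is given by the list of its levels, from bottom to top.\<close>

definition ladder_levels :: "'a set list \<Rightarrow> bool" where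
  "ladder_levels Qs \<longleftrightarrow> (\<forall>Q\<in>set Qs. card Q = 1 \<or> card Q = 2) \<and>
     disjoint_family_on (\<lambda>j. Qs ! j) {..<length Qs}"

definition ladder :: "'a set list \<Rightarrow> 'a rel" where
  "ladder Qs = foldr (\<oplus>\<^sub>o) (map Id_on Qs) {}"

definition linear_extensions :: "'a rel \<Rightarrow> 'a list set" where
  "linear_extensions r = {w. distinct w \<and> set w = Field r \<and>
     (\<forall>i<length w. \<forall>j<length w. (w ! i, w ! j) \<in> r \<and> w ! i \<noteq> w ! j \<longrightarrow> i < j)}"

text \<open>
  Positions in a word \<open>\<pi>\<^sub>1\<cdots>\<pi>\<^sub>n\<close> are counted from 1, so that \<open>\<pi>\<^sub>i\<close> is \<open>w ! (i - 1)\<close>; \<open>tau\<close> is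
  only applied with \<open>1 \<le> i < length w\<close>. In \<open>promotion\<close>, \<open>fold\<close> applies \<open>tau r i\<close> first.
\<close>

definition tau :: "'a rel \<Rightarrow> nat \<Rightarrow> 'a list \<Rightarrow> 'a list" where
  "tau r i w = (let u = w ! (i - 1); v = w ! i in
     if (u, v) \<notin> r \<and> (v, u) \<notin> r then w[i - 1 := v, i := u] else w)"

definition promotion :: "'a rel \<Rightarrow> nat \<Rightarrow> 'a list \<Rightarrow> 'a list" where
  "promotion r i w = fold (tau r) [i..<length w] w"

text \<open>
  The polynomial ring over the integers in indeterminates indexed by \<open>nat\<close>. A linear form
  \<open>\<Sum>k. c\<^sub>k x\<^sub>k\<close> is represented by its coefficient function \<open>c\<close>.
\<close>

type_synonym int_mpoly = "(nat \<Rightarrow>\<^sub>0 nat) \<Rightarrow>\<^sub>0 int"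

definition indet :: "nat \<Rightarrow> int_mpoly" where
  "indet k = Poly_Mapping.single (Poly_Mapping.single k 1) 1"

type_synonym linear_form = "nat \<Rightarrow> int"

definition form_poly :: "nat \<Rightarrow> linear_form \<Rightarrow> int_mpoly" where
  "form_poly n c = (\<Sum>k\<in>{1..n}. of_int (c k) * indet k)"

text \<open>
  Rows and columns follow an enumeration \<open>ws\<close> of the linear extensions; the characteristic
  polynomial does not depend on it.
\<close>

definition promotion_matrix :: "nat rel \<Rightarrow> nat list list \<Rightarrow> int_mpoly mat" where
  "promotion_matrix r ws = mat (length ws) (length ws) (\<lambda>(p, q).
     \<Sum>i | i \<in> {1..length (ws ! p)} \<and> promotion r i (ws ! p) = ws ! q. indet (ws ! p ! (i - 1)))"

definition eigenvalue_forms :: "nat \<Rightarrow> int_mpoly mat \<Rightarrow> linear_form multiset \<Rightarrow> bool" where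
  "eigenvalue_forms n M E \<longleftrightarrow> char_poly M = (\<Prod>c\<in>#E. [:- form_poly n c, 1:])"

definition upsets :: "'a rel \<Rightarrow> 'a set set" where
  "upsets r = {S. S \<subseteq> Field r \<and> (\<forall>x\<in>S. \<forall>y. (x, y) \<in> r \<longrightarrow> y \<in> S)}"

definition upset_lattice :: "'a rel \<Rightarrow> 'a set rel" where
  "upset_lattice r = {(S, T). S \<in> upsets r \<and> T \<in> upsets r \<and> S \<subseteq> T}"

function moebius :: "'a rel \<Rightarrow> 'a \<Rightarrow> 'a \<Rightarrow> int" where
  "moebius r x y =
     (if x = y then 1
      else if finite_poset r \<and> (x, y) \<in> r
        then - (\<Sum>z | (x, z) \<in> r \<and> (z, y) \<in> r \<and> z \<noteq> y. moebius r x z)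
      else 0)"
  by pat_completeness auto
termination
proof (relation "measure (\<lambda>(r, x, y). card {z. (x, z) \<in> r \<and> (z, y) \<in> r})", goal_cases)
  case 1
  then show ?case by simp
next
  case (2 r x y z)
  then have fin: "finite (Field r)" and po: "Partial_order r"
    and xy: "(x, y) \<in> r" and z: "(x, z) \<in> r" "(z, y) \<in> r" "z \<noteq> y"
    by (auto simp: finite_poset_def)
  have tr: "trans r" and an: "antisym r" and re: "Refl r"
    using po by (auto simp: partial_order_on_def preorder_on_def)
  have "y \<in> Field r" using xy by (auto intro: FieldI2)
  then have "(y, y) \<in> r" using re by (auto simp: refl_on_def)
  moreover have "(y, z) \<notin> r" using an z by (auto dest: antisymD)
  ultimately have "{w. (x, w) \<in> r \<and> (w, z) \<in> r} \<subset> {w. (x, w) \<in> r \<and> (w, y) \<in> r}"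
    using tr z xy by (auto dest: transD)
  moreover have "finite {w. (x, w) \<in> r \<and> (w, y) \<in> r}"
    by (rule finite_subset[OF _ fin]) (auto intro: FieldI2)
  ultimately show ?case by (simp add: psubset_card_mono)
qed

declare moebius.simps [simp del]

definition poset_top :: "'a rel \<Rightarrow> 'a" where
  "poset_top r = (THE t. t \<in> Field r \<and> (\<forall>x\<in>Field r. (x, t) \<in> r))"

definition num_maximal_chains :: "'a rel \<Rightarrow> 'a \<Rightarrow> 'a \<Rightarrow> nat" where
  "num_maximal_chains r y t =
     card {C. pred_on.maxchain {z. (y, z) \<in> r \<and> (z, t) \<in> r} (\<lambda>u v. (u, v) \<in> r) C}"

definition derangement_number :: "'a rel \<Rightarrow> 'a \<Rightarrow> int" where
  "derangement_number r x =
     (\<Sum>y | (x, y) \<in> r. moebius r x y * int (num_maximal_chains r y (poset_top r)))"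

text \<open>
  \<open>ab\<close> lists, with an arbitrary order inside each level, the levels of size two of the ladders
  with level lists \<open>L 1, \<dots>, L k\<close>.
\<close>

definition two_level_list :: "nat \<Rightarrow> (nat \<Rightarrow> 'a set list) \<Rightarrow> ('a \<times> 'a) list \<Rightarrow> bool" where
  "two_level_list k L ab \<longleftrightarrow> distinct (map (\<lambda>(a, b). {a, b}) ab) \<and>
     set (map (\<lambda>(a, b). {a, b}) ab) = {Q. card Q = 2 \<and> (\<exists>i\<in>{1..k}. Q \<in> set (L i))}"

text \<open>
  In \<open>poset_seq\<close> and \<open>form_seq\<close> the pair \<open>ab ! t\<close> (counted from 0) is the one treated in passing
  from index \<open>t\<close> to index \<open>Suc t\<close>.
\<close>

primrec poset_seq :: "'a rel \<Rightarrow> ('a \<times> 'a) list \<Rightarrow> nat \<Rightarrow> 'a rel" where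
  "poset_seq r ab 0 = (r \<union> set ab)\<^sup>+"
| "poset_seq r ab (Suc t) = poset_seq r ab t - {ab ! t}"

text \<open>
  The two forms replacing \<open>c\<close>. The last branch (\<open>c a \<noteq> 0\<close>, \<open>c b = 0\<close>) is not meant to occur;
  the value given there is a dummy.
\<close>

definition replace_form :: "nat rel \<Rightarrow> nat \<Rightarrow> nat \<Rightarrow> linear_form \<Rightarrow> linear_form multiset" where
  "replace_form r a b c =
     (if c a \<noteq> 0 \<and> c b \<noteq> 0 \<or> c a = 0 \<and> c b = 0 then
        {# c, \<lambda>k. (if (k, b) \<notin> r then c k else 0) - (if (k, a) \<in> r \<and> k \<noteq> a then c k else 0) #}
      else if c a = 0 \<and> c b \<noteq> 0 then
        {# c, \<lambda>k. c k - (if k = b then c b else 0) + (if k = a then c b else 0) #}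
      else {#})"

definition upset_form :: "nat set \<Rightarrow> linear_form" where
  "upset_form S = (\<lambda>i. if i \<in> S then 1 else 0)"

text \<open>
  \<open>nat\<close> sends negative integers to 0; it serves here as the inverse of \<open>int\<close> on the derangement
  numbers of the lattice of upsets of a rooted forest, which are nonnegative.
\<close>

primrec form_seq :: "nat rel \<Rightarrow> (nat \<times> nat) list \<Rightarrow> nat \<Rightarrow> linear_form multiset" where
  "form_seq r ab 0 = (\<Sum>S\<in>upsets (poset_seq r ab 0).
     replicate_mset (nat (derangement_number (upset_lattice (poset_seq r ab 0)) S)) (upset_form S))"
| "form_seq r ab (Suc t) = (\<Sum>c\<in>#form_seq r ab t.
     replace_form (poset_seq r ab t) (fst (ab ! t)) (snd (ab ! t)) c)"

end

theory Submission
  imports Defs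
begin

text \<open>
  Let \<open>G\<^sub>x\<close> promote the letter \<open>x\<close>, so that \<open>M\<^sup>P\<close> is the sum of the \<open>x\<^sub>x G\<^sub>x\<close>. The trace of a product of
  such operators is the number of linear extensions it fixes, and in characteristic zero the traces
  of all powers determine the characteristic polynomial. It therefore suffices to show, for every
  word \<open>v\<close>, that the number of fixed points of \<open>G\<^sub>v\<close> is the sum of \<open>\<Prod>\<^sub>x\<^sub>\<in>\<^sub>v c\<^sub>x\<close> over the claimed forms \<open>c\<close>.

  For a rooted forest, iterating \<open>G\<^sub>v\<close> fixes the order of the upset \<open>S\<close> generated by \<open>v\<close>, and a fixed
  point has \<open>S\<close> at its end; so the fixed points correspond to the linear extensions of the
  complement of \<open>S\<close>, which are counted by derangement numbers through Moebius inversion.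

  When a relation \<open>a \<prec> b\<close> is dropped, a linear extension of the new poset is one of the old poset
  with or without \<open>a\<close> and \<open>b\<close> exchanged. Promotion acts on such pairs as a two-state machine whose
  state is reset by \<open>a\<close> and \<open>b\<close> and flipped by the elements below them, and every form splits
  into two according to this machine.
\<close>

section \<open>Power traces and the characteristic polynomial\<close>

text \<open>The count is needed for every word, not merely summed over the words of each length,
  because the induction on dropped relations changes the word: a fixed point at \<open>v\<close> in
  the new poset comes from a fixed point in the old one at the word that the machine emits, and the
  induction hypothesis is applied to the emitted words of both initial states. A form
  \<open>c\<close> survives this translation if \<open>c a = c b\<close>, so that it cannot tell
  which twin was emitted, or if \<open>c\<close> vanishes on everything up to \<open>a\<close>, so
  that it kills every run that leaves its state. This is more than the case distinction of the
  theorem asks for, and it is the invariant carried along the list of pairs. The two alternatives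
  produce the two rules for the second form: twisting by a sign of the machine (1 for keeping the
  state, -1 for a flip, 0 for a reset), or exchanging the coefficients of \<open>a\<close> and
  \<open>b\<close>. Nonnegativity of derangement numbers is a genuine obligation: multiplicities
  pass through \<open>nat\<close>, which would silently cut a negative value to 0. The linear
  algebra stays inside an integral domain; the claimed eigenvalues enter only as the diagonal of a
  comparison matrix.\<close>

definition mat_trace :: "'a::comm_monoid_add mat \<Rightarrow> 'a" where
  "mat_trace A = (\<Sum>i<dim_row A. A $$ (i, i))"

lemma mat_trace_add:
  "\<lbrakk>A \<in> carrier_mat n n; B \<in> carrier_mat n n\<rbrakk> \<Longrightarrow> mat_trace (A + B) = mat_trace A + mat_trace B"
  by (simp add: mat_trace_def sum.distrib)

lemma mat_trace_minus:
  fixes A B :: "'a::ab_group_add mat"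
  shows "\<lbrakk>A \<in> carrier_mat n n; B \<in> carrier_mat n n\<rbrakk> \<Longrightarrow> mat_trace (A - B) = mat_trace A - mat_trace B"
  by (simp add: mat_trace_def sum_subtractf)

lemma mat_trace_smult:
  fixes A :: "'a::semiring_0 mat"
  shows "A \<in> carrier_mat n n \<Longrightarrow> mat_trace (c \<cdot>\<^sub>m A) = c * mat_trace A"
  by (simp add: mat_trace_def sum_distrib_left)

text \<open>Jacobi's formula for \<open>X - A\<close>: the derivative is the sum of the
  characteristic polynomials of the principal minors, and these are the diagonal cofactors, whose
  signs are all 1.\<close>

lemma pderiv_char_poly_trace:
  fixes A :: "'a::idom mat"
  assumes A: "A \<in> carrier_mat n n"
  shows "pderiv (char_poly A) = mat_trace (adj_mat (char_poly_matrix A))"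
proof -
  have "char_poly_matrix (mat_delete A i i) = mat_delete (char_poly_matrix A) i i" if "i < n" for i
    using A that by (intro eq_matI) (auto simp: char_poly_matrix_def mat_delete_def)
  then have "(\<Sum>i<n. char_poly (mat_delete A i i)) = (\<Sum>i<n. cofactor (char_poly_matrix A) i i)"
    by (intro sum.cong) (auto simp: char_poly_def cofactor_def)
  then show ?thesis
    using A by (simp add: pderiv_char_poly[OF A] mat_trace_def adj_mat_def char_poly_matrix_def)
qed

lemma pow_mat_commute:
  fixes A :: "'a::semiring_1 mat"
  assumes A: "A \<in> carrier_mat n n"
  shows "A * A ^\<^sub>m k = A ^\<^sub>m k * A"
proof (induction k)
  case 0
  then show ?case using A by simp
next
  case (Suc k)
  have "A * A ^\<^sub>m Suc k = (A * A ^\<^sub>m k) * A"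
    using assoc_mult_mat[OF A pow_carrier_mat[OF A] A] by simp
  then show ?case by (simp add: Suc.IH)
qed

text \<open>In closed form this is \<Sum> over j < k of X^(k-1-j) A^j, the polynomial part of X^k
  times the inverse of \<open>X - A\<close>. The Horner recursion avoids the subtraction in the
  exponent.\<close>

primrec resolvent_sum :: "'a::comm_ring_1 mat \<Rightarrow> nat \<Rightarrow> 'a poly mat" where
  "resolvent_sum A 0 = 0\<^sub>m (dim_row A) (dim_row A)"
| "resolvent_sum A (Suc k) = [:0, 1:] \<cdot>\<^sub>m resolvent_sum A k + map_mat (\<lambda>a. [:a:]) (A ^\<^sub>m k)"

lemma resolvent_sum_carrier [simp]:
  "A \<in> carrier_mat n n \<Longrightarrow> resolvent_sum A k \<in> carrier_mat n n"
  by (induction k) auto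

interpretation const_poly_hom: comm_ring_hom "\<lambda>a::'a::comm_ring_1. [:a:]"
  by unfold_locales auto

text \<open>A telescoping geometric sum; it telescopes because \<open>A\<close> commutes with its
  powers.\<close>

lemma char_poly_matrix_resolvent_sum:
  fixes A :: "'a::comm_ring_1 mat"
  assumes A: "A \<in> carrier_mat n n"
  shows "char_poly_matrix A * resolvent_sum A k
    = [:0, 1:] ^ k \<cdot>\<^sub>m 1\<^sub>m n - map_mat (\<lambda>a. [:a:]) (A ^\<^sub>m k)"
proof (induction k)
  case 0
  have "[:0, 1:] ^ 0 \<cdot>\<^sub>m 1\<^sub>m n - map_mat (\<lambda>a. [:a:]) (A ^\<^sub>m 0) = (0\<^sub>m n n :: 'a poly mat)"
    using A by (intro eq_matI) auto
  then show ?case using A right_mult_zero_mat[OF char_poly_matrix_closed[OF A]] by simp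
next
  case (Suc k)
  let ?X = "[:0, 1:] :: 'a poly" and ?c = "map_mat (\<lambda>a::'a. [:a:])"
  let ?C = "char_poly_matrix A" and ?B = "?c (A ^\<^sub>m k)"
  have C: "?C \<in> carrier_mat n n" and B: "?B \<in> carrier_mat n n" and cA: "?c A \<in> carrier_mat n n"
    using A by auto
  have Ceq: "?C = ?X \<cdot>\<^sub>m 1\<^sub>m n - ?c A"
    using A by (intro eq_matI) (auto simp: char_poly_matrix_def)
  have "?C * ?B = ?X \<cdot>\<^sub>m ?B - ?c A * ?B"
    unfolding Ceq using B cA
    by (subst minus_mult_distrib_mat[of _ n n]) auto
  also have "?c A * ?B = ?c (A ^\<^sub>m Suc k)"
    using A pow_mat_commute[OF A, of k] by (simp add: const_poly_hom.mat_hom_mult[of _ n n _ n, symmetric])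
  finally have CB: "?C * ?B = ?X \<cdot>\<^sub>m ?B - ?c (A ^\<^sub>m Suc k)" .
  have "?C * resolvent_sum A (Suc k) = ?X \<cdot>\<^sub>m (?C * resolvent_sum A k) + ?C * ?B"
    using A C B by (simp add: mult_add_distrib_mat[OF C _ B] mult_smult_distrib[OF C resolvent_sum_carrier[OF A]])
  also have "\<dots> = ?X ^ Suc k \<cdot>\<^sub>m 1\<^sub>m n - ?c (A ^\<^sub>m Suc k)"
    unfolding Suc.IH CB using A
    by (intro eq_matI) (auto simp: algebra_simps)
  finally show ?case .
qed

text \<open>A constant factor cannot raise the degree of an entry, so the sum of the degrees of all
  entries of \<open>B\<close> serves as a crude bound. What matters is that it does not depend on
  \<open>C\<close>, which will run through all powers of a matrix.\<close>

lemma degree_mult_const_mat: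
  fixes B :: "'a::comm_ring_1 poly mat"
  assumes B: "B \<in> carrier_mat n n"
  shows "\<exists>d. \<forall>C \<in> carrier_mat n n. degree (mat_trace (B * map_mat (\<lambda>a. [:a:]) C)) \<le> d"
proof (intro exI ballI)
  let ?d = "\<Sum>i<n. \<Sum>j<n. degree (B $$ (i, j))"
  fix C :: "'a mat" assume C: "C \<in> carrier_mat n n"
  have "degree (\<Sum>j<n. B $$ (i, j) * [:C $$ (j, i):]) \<le> ?d" if "i < n" for i
  proof (rule degree_sum_le)
    fix j assume "j \<in> {..<n}"
    have "degree (B $$ (i, j) * [:C $$ (j, i):]) \<le> degree (B $$ (i, j))"
      using degree_mult_le[of "B $$ (i, j)" "[:C $$ (j, i):]"] by simp
    also have "\<dots> \<le> (\<Sum>j<n. degree (B $$ (i, j)))"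
      using \<open>j \<in> {..<n}\<close> by (intro member_le_sum) auto
    also have "\<dots> \<le> ?d"
      using that by (intro member_le_sum[where f = "\<lambda>i. \<Sum>j<n. degree (B $$ (i, j))"]) auto
    finally show "degree (B $$ (i, j) * [:C $$ (j, i):]) \<le> ?d" .
  qed auto
  then have "degree (\<Sum>i<n. \<Sum>j<n. B $$ (i, j) * [:C $$ (j, i):]) \<le> ?d"
    by (rule degree_sum_le[OF finite_lessThan]) simp
  then show "degree (mat_trace (B * map_mat (\<lambda>a. [:a:]) C)) \<le> ?d"
    using B C by (simp add: mat_trace_def scalar_prod_def atLeast0LessThan del: mult_pCons_right)
qed

text \<open>The remainder \<open>r k\<close> is the trace of the adjugate of \<open>X - A\<close>
  times the constant matrix \<open>A ^\<^sub>m k\<close>; hence one \<open>d\<close> bounds its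
  degree for all \<open>k\<close>.\<close>

lemma char_poly_power_traces:
  fixes A :: "'a::idom mat"
  assumes A: "A \<in> carrier_mat n n"
  shows "\<exists>d r. (\<forall>k. degree (r k) \<le> d) \<and>
    (\<forall>k. char_poly A * mat_trace (resolvent_sum A k) = [:0, 1:] ^ k * pderiv (char_poly A) - r k)"
proof -
  let ?X = "[:0, 1:] :: 'a poly" and ?c = "map_mat (\<lambda>a::'a. [:a:])"
  let ?C = "char_poly_matrix A" and ?J = "adj_mat (char_poly_matrix A)"
  have C: "?C \<in> carrier_mat n n" using A by simp
  note J = adj_mat[OF C]
  obtain d where d: "\<And>C. C \<in> carrier_mat n n \<Longrightarrow> degree (mat_trace (?J * ?c C)) \<le> d"
    using degree_mult_const_mat[OF J(1)] by blast
  have "char_poly A * mat_trace (resolvent_sum A k)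
      = ?X ^ k * pderiv (char_poly A) - mat_trace (?J * ?c (A ^\<^sub>m k))" for k
  proof -
    let ?R = "resolvent_sum A k"
    have R: "?R \<in> carrier_mat n n" using A by simp
    have cA: "?c (A ^\<^sub>m k) \<in> carrier_mat n n" using A by simp
    have "char_poly A * mat_trace ?R = mat_trace (det ?C \<cdot>\<^sub>m ?R)"
      using mat_trace_smult[OF R] by (simp add: char_poly_def)
    also have "det ?C \<cdot>\<^sub>m ?R = ?J * (?C * ?R)"
      using R assoc_mult_mat[OF J(1) C R] J(3) by (simp add: mult_smult_assoc_mat[of _ n n])
    also have "?C * ?R = ?X ^ k \<cdot>\<^sub>m 1\<^sub>m n - ?c (A ^\<^sub>m k)"
      by (rule char_poly_matrix_resolvent_sum[OF A])
    also have "?J * (?X ^ k \<cdot>\<^sub>m 1\<^sub>m n - ?c (A ^\<^sub>m k)) = ?X ^ k \<cdot>\<^sub>m ?J - ?J * ?c (A ^\<^sub>m k)"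
      using J(1) cA by (simp add: mult_minus_distrib_mat[OF J(1) _ cA] mult_smult_distrib[OF J(1) one_carrier_mat])
    also have "mat_trace (?X ^ k \<cdot>\<^sub>m ?J - ?J * ?c (A ^\<^sub>m k))
        = ?X ^ k * mat_trace ?J - mat_trace (?J * ?c (A ^\<^sub>m k))"
      using J(1) cA by (subst mat_trace_minus[of _ n]) (auto simp: mat_trace_smult[of _ n])
    finally show ?thesis by (simp add: pderiv_char_poly_trace[OF A])
  qed
  then show ?thesis using d A by (intro exI[of _ d] exI[of _ "\<lambda>k. mat_trace (?J * ?c (A ^\<^sub>m k))"]) auto
qed

text \<open>If \<open>s = p - q\<close> were nonzero, it would have smaller degree than
  \<open>p\<close> and satisfy s p' = p s'. Comparing top coefficients gives deg p = deg s in
  characteristic zero, a contradiction.\<close>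

lemma monic_eq_if_log_derivatives_eq:
  fixes p q :: "'a::{idom,ring_char_0} poly"
  assumes deg: "degree p = degree q" and monic: "lead_coeff p = 1" "lead_coeff q = 1"
    and eq: "q * pderiv p = p * pderiv q"
  shows "p = q"
proof (rule ccontr)
  assume "p \<noteq> q"
  define s where "s = p - q"
  have s: "s \<noteq> 0" using \<open>p \<noteq> q\<close> by (simp add: s_def)
  have p0: "p \<noteq> 0" using monic by auto
  have "degree p \<noteq> 0"
  proof
    assume "degree p = 0"
    then have "p = [:lead_coeff p:]" "q = [:lead_coeff q:]"
      using deg by (metis degree_0_id)+
    then show False using monic \<open>p \<noteq> q\<close> by simp
  qed
  moreover have "degree s \<le> degree p" using deg by (simp add: s_def degree_diff_le)
  moreover have "coeff s (degree p) = 0" using deg monic by (simp add: s_def)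
  ultimately have sdeg: "degree s < degree p"
    using s by (metis le_neq_implies_less leading_coeff_0_iff)
  have eq': "s * pderiv p = p * pderiv s"
    using eq by (simp add: s_def algebra_simps pderiv_diff)
  have "coeff (s * pderiv p) (degree s + (degree p - 1)) = lead_coeff s * of_nat (degree p)"
    using monic \<open>degree p \<noteq> 0\<close> coeff_mult_degree_sum[of s "pderiv p"]
    by (simp add: degree_pderiv coeff_pderiv)
  moreover have "coeff (p * pderiv s) (degree s + (degree p - 1)) = lead_coeff s * of_nat (degree s)"
  proof (cases "degree s = 0")
    case True
    then show ?thesis using pderiv_eq_0_iff[of s] by simp
  next
    case False
    then have "degree s + (degree p - 1) = degree p + degree (pderiv s)"
      using \<open>degree p \<noteq> 0\<close> by (simp add: degree_pderiv)
    then show ?thesis using monic False coeff_mult_degree_sum[of p "pderiv s"]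
      by (simp add: degree_pderiv coeff_pderiv)
  qed
  ultimately have "of_nat (degree p) = (of_nat (degree s) :: 'a)"
    using eq' s by simp
  then show False using sdeg by simp
qed

text \<open>
  Multiplying \<open>X - A\<close> by \<open>\<Sum>\<^sub>j X\<^sup>k\<^sup>-\<^sup>1\<^sup>-\<^sup>j A\<^sup>j\<close> and by the adjugate shows that
  \<open>\<chi>'/\<chi>\<close> agrees with the generating function of the power traces up to a term
  whose degree is bounded independently of \<open>k\<close>; this replaces Newton's identities.
\<close>

theorem char_poly_eq_if_power_traces_eq:
  fixes A B :: "'a::{idom,ring_char_0} mat"
  assumes A: "A \<in> carrier_mat n n" and B: "B \<in> carrier_mat n n"
    and tr: "\<And>k. mat_trace (A ^\<^sub>m k) = mat_trace (B ^\<^sub>m k)"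
  shows "char_poly A = char_poly B"
proof -
  let ?X = "[:0, 1:] :: 'a poly" and ?p = "char_poly A" and ?q = "char_poly B"
  have tr_const: "mat_trace (map_mat (\<lambda>a. [:a:]) C) = [:mat_trace C:]" if "C \<in> carrier_mat n n" for C :: "'a mat"
    using that by (simp add: mat_trace_def const_poly_hom.hom_sum)
  have trR: "mat_trace (resolvent_sum A k) = mat_trace (resolvent_sum B k)" for k
  proof (induction k)
    case 0
    then show ?case using A B by simp
  next
    case (Suc k)
    then show ?case using A B
      by (simp add: mat_trace_add[of _ n] mat_trace_smult[of _ n] tr_const tr)
  qed
  obtain d r where d: "\<And>k. degree (r k) \<le> d"
    and r: "\<And>k. ?p * mat_trace (resolvent_sum A k) = ?X ^ k * pderiv ?p - r k"
    using char_poly_power_traces[OF A] by blast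
  obtain e t where e: "\<And>k. degree (t k) \<le> e"
    and t: "\<And>k. ?q * mat_trace (resolvent_sum B k) = ?X ^ k * pderiv ?q - t k"
    using char_poly_power_traces[OF B] by blast
  note degs = degree_monic_char_poly[OF A] degree_monic_char_poly[OF B]
  \<comment> \<open>One more than a bound on the degree of what remains after collecting the terms
    with X^K; a nonzero multiple of X^K is then too large to equal it.\<close>
  define K where "K = Suc (n + d + e)"
  have "?q * (?X ^ K * pderiv ?p - r K) = ?p * (?X ^ K * pderiv ?q - t K)"
    unfolding r[symmetric] t[symmetric] trR by (rule mult.left_commute)
  then have *: "?X ^ K * (?q * pderiv ?p - ?p * pderiv ?q) = ?q * r K - ?p * t K"
    by (simp add: algebra_simps)
  have "degree (?q * r K - ?p * t K) \<le> n + d + e"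
    using degree_mult_le[of ?q "r K"] degree_mult_le[of ?p "t K"] d[of K] e[of K] degs
    by (intro degree_diff_le) auto
  then have "degree (?X ^ K * (?q * pderiv ?p - ?p * pderiv ?q)) < K"
    unfolding * by (simp add: K_def)
  moreover have "K \<le> degree (?X ^ K * s)" if "s \<noteq> 0" for s
    using that by (simp add: degree_mult_eq degree_power_eq)
  ultimately have "\<not> ?q * pderiv ?p - ?p * pderiv ?q \<noteq> 0"
    using linorder_not_le by blast
  then have "?q * pderiv ?p = ?p * pderiv ?q"
    by (simp only: not_not right_minus_eq)
  moreover have "degree ?p = degree ?q" "lead_coeff ?p = 1" "lead_coeff ?q = 1"
    using degs by simp_all
  ultimately show ?thesis
    by (rule monic_eq_if_log_derivatives_eq[rotated 3])
qed

text \<open>Comparison with the diagonal matrix having the elements of \<open>E\<close> on its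
  diagonal. The hypothesis at \<open>k = 0\<close> says that \<open>E\<close> has \<open>n\<close>
  elements, so this matrix has the right size.\<close>

lemma char_poly_prod_mset:
  fixes A :: "'a::{idom,ring_char_0} mat"
  assumes A: "A \<in> carrier_mat n n"
    and tr: "\<And>k. mat_trace (A ^\<^sub>m k) = (\<Sum>e\<in>#E. e ^ k)"
  shows "char_poly A = (\<Prod>e\<in>#E. [:- e, 1:])"
proof -
  obtain es where es: "mset es = E" using ex_mset by blast
  have "of_nat n = mat_trace (A ^\<^sub>m 0)" using A by (simp add: mat_trace_def)
  also have "\<dots> = of_nat (size E)" unfolding tr by simp
  finally have n: "n = length es" using es by auto
  define D where "D = mat n n (\<lambda>(i, j). if i = j then es ! i else 0)"
  have D: "D \<in> carrier_mat n n" by (simp add: D_def)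
  have pow: "D ^\<^sub>m k = mat n n (\<lambda>(i, j). if i = j then es ! i ^ k else 0)" for k
  proof (induction k)
    case 0
    then show ?case using D by (intro eq_matI) auto
  next
    case (Suc k)
    then show ?case using D
      by (intro eq_matI) (auto simp: D_def scalar_prod_def if_distrib[of "\<lambda>x. x * _"] sum.delta cong: if_cong)
  qed
  have "mat_trace (D ^\<^sub>m k) = (\<Sum>e\<in>#E. e ^ k)" for k
    by (simp add: pow mat_trace_def es[symmetric] n sum_mset_sum_list sum_list_sum_nth atLeast0LessThan flip: mset_map)
  then have "char_poly A = char_poly D"
    by (intro char_poly_eq_if_power_traces_eq[OF A D]) (simp add: tr)
  also have "\<dots> = (\<Prod>e\<leftarrow>diag_mat D. [:- e, 1:])"
    by (intro char_poly_upper_triangular[OF D]) (auto simp: D_def upper_triangular_def)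
  also have "diag_mat D = es"
    by (auto simp: diag_mat_def D_def n intro: nth_equalityI)
  finally show ?thesis
    by (simp add: es[symmetric] prod_mset_prod_list flip: mset_map)
qed

section \<open>Promotion of words\<close>

text \<open>The set of letters is a parameter because linear extensions of complements of upsets
  have to be counted. The form with \<open>sorted_wrt\<close> passes through cons, append and filter
  without index arithmetic.\<close>

definition lin_exts_on :: "'a rel \<Rightarrow> 'a set \<Rightarrow> 'a list set" where
  "lin_exts_on r A = {w. distinct w \<and> set w = A \<and> sorted_wrt (\<lambda>x y. (y, x) \<notin> r) w}"

lemma linear_extensions_eq: "linear_extensions r = lin_exts_on r (Field r)"
proof -
  have "(\<forall>i<length w. \<forall>j<length w. (w ! i, w ! j) \<in> r \<and> w ! i \<noteq> w ! j \<longrightarrow> i < j)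
    \<longleftrightarrow> (\<forall>i j. i < j \<longrightarrow> j < length w \<longrightarrow> (w ! j, w ! i) \<notin> r)" (is "?L = ?R") if "distinct w" for w
  proof
    assume L: ?L
    show ?R
    proof (intro allI impI notI)
      fix i j assume "i < j" "j < length w" "(w ! j, w ! i) \<in> r"
      moreover from this have "w ! j \<noteq> w ! i" using that by (simp add: nth_eq_iff_index_eq)
      ultimately show False using L by (meson less_asym less_trans)
    qed
  next
    assume R: ?R
    show ?L
    proof (intro allI impI, elim conjE)
      fix i j assume "i < length w" "(w ! i, w ! j) \<in> r" "w ! i \<noteq> w ! j"
      with R have "\<not> j < i" "i \<noteq> j" by auto
      then show "i < j" by simp
    qed
  qed
  then show ?thesis
    unfolding linear_extensions_def lin_exts_on_def sorted_wrt_iff_nth_less by blast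
qed

text \<open>The sweep of the operators \<open>tau\<close> over a suffix: \<open>x\<close> is carried
  to the right until it meets a comparable letter, which is then carried in its place.\<close>

fun push :: "'a rel \<Rightarrow> 'a \<Rightarrow> 'a list \<Rightarrow> 'a list" where
  "push r x [] = [x]"
| "push r x (y # ys) = (if (x, y) \<in> r \<or> (y, x) \<in> r then x # push r y ys else y # push r x ys)"

text \<open>Promotion is addressed by letter instead of position, since the weight in the matrix
  depends on the letter. This gives one operator per letter, the same for all rows.\<close>

fun promote :: "'a rel \<Rightarrow> 'a \<Rightarrow> 'a list \<Rightarrow> 'a list" where
  "promote r x [] = []"
| "promote r x (y # ys) = (if x = y then push r x ys else y # promote r x ys)"

lemma fold_tau_eq_push:
  "fold (tau r) [Suc (length u)..<length (u @ x # v)] (u @ x # v) = u @ push r x v"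
proof (induction v arbitrary: u x)
  case Nil
  then show ?case by simp
next
  case (Cons y ys)
  \<comment> \<open>Only the length of the prefix matters, so the equation is stated for arbitrary
    \<open>z\<close> and \<open>z'\<close>: after one step either of the two letters may be the one
    left behind.\<close>
  have "[Suc (length u)..<length (u @ x # y # ys)]
      = Suc (length u) # [Suc (length (u @ [z]))..<length ((u @ [z]) @ z' # ys)]" for z z'
    by (simp add: upt_conv_Cons del: upt_Suc)
  moreover have "tau r (Suc (length u)) (u @ x # y # ys)
      = (if (x, y) \<in> r \<or> (y, x) \<in> r then (u @ [x]) @ y # ys else (u @ [y]) @ x # ys)"
    by (auto simp: tau_def nth_append list_update_append)
  ultimately show ?case
    using Cons.IH[of "u @ [x]" y] Cons.IH[of "u @ [y]" x] by auto
qed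

lemma promote_append_Cons: "x \<notin> set u \<Longrightarrow> promote r x (u @ x # v) = u @ push r x v"
  by (induction u) auto

lemma promotion_eq_promote:
  assumes "distinct w" "i < length w"
  shows "promotion r (Suc i) w = promote r (w ! i) w"
proof -
  obtain u v where w: "w = u @ w ! i # v" "length u = i"
    using assms(2) by (metis id_take_nth_drop length_take min.absorb4)
  then have "w ! i \<notin> set u"
    using assms(1) by (metis distinct_append disjoint_iff list.set_intros(1))
  then have "promote r (w ! i) w = u @ push r (w ! i) v"
    using promote_append_Cons w(1) by metis
  moreover have "promotion r (Suc i) w = u @ push r (w ! i) v"
    using fold_tau_eq_push[of r u "w ! i" v] w by (metis promotion_def)
  ultimately show ?thesis by simp
qed

lemma set_push [simp]: "set (push r x v) = insert x (set v)"
  by (induction v arbitrary: x) auto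

lemma distinct_push [simp]: "distinct (push r x v) \<longleftrightarrow> distinct (x # v)"
  by (induction v arbitrary: x) auto

lemma sorted_wrt_push:
  "sorted_wrt (\<lambda>x y. (y, x) \<notin> r) (x # v) \<Longrightarrow> sorted_wrt (\<lambda>x y. (y, x) \<notin> r) (push r x v)"
  by (induction v arbitrary: x) auto

lemma set_promote [simp]: "set (promote r x w) = set w"
  by (induction w) auto

lemma distinct_promote [simp]: "distinct (promote r x w) \<longleftrightarrow> distinct w"
  by (induction w) auto

lemma sorted_wrt_promote:
  "sorted_wrt (\<lambda>x y. (y, x) \<notin> r) w \<Longrightarrow> sorted_wrt (\<lambda>x y. (y, x) \<notin> r) (promote r x w)"
  by (induction w) (auto intro: sorted_wrt_push)

lemma promote_lin_exts_on: "w \<in> lin_exts_on r A \<Longrightarrow> promote r x w \<in> lin_exts_on r A"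
  by (simp add: lin_exts_on_def sorted_wrt_promote)

lemma fold_promote_lin_exts_on: "w \<in> lin_exts_on r A \<Longrightarrow> fold (promote r) v w \<in> lin_exts_on r A"
  by (induction v arbitrary: w) (auto intro: promote_lin_exts_on)

lemma finite_lin_exts_on [simp]: "finite A \<Longrightarrow> finite (lin_exts_on r A)"
  by (rule finite_subset[OF _ finite_lists_length_eq[of A "card A"]])
    (auto simp: lin_exts_on_def distinct_card)

section \<open>Words of operators and traces of powers\<close>

abbreviation words_over :: "'a set \<Rightarrow> nat \<Rightarrow> 'a list set" where
  "words_over X k \<equiv> {v. set v \<subseteq> X \<and> length v = k}"

lemma sum_words_over_Suc:
  "(\<Sum>v\<in>words_over X (Suc k). g v) = (\<Sum>x\<in>X. \<Sum>v\<in>words_over X k. g (x # v))"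
proof -
  have "(\<Sum>v\<in>words_over X (Suc k). g v) = (\<Sum>(v, x)\<in>words_over X k \<times> X. g (x # v))"
    by (simp add: lists_length_Suc_eq sum.reindex inj_on_def split_beta)
  also have "\<dots> = (\<Sum>v\<in>words_over X k. \<Sum>x\<in>X. g (x # v))"
    by (rule sum.cartesian_product[symmetric])
  finally show ?thesis by (simp only: sum.swap[of _ X])
qed

lemma power_sum_words_over:
  fixes g :: "'a \<Rightarrow> 'b::comm_semiring_1"
  shows "(\<Sum>x\<in>X. g x) ^ k = (\<Sum>v\<in>words_over X k. prod_list (map g v))"
proof (induction k)
  case 0
  have "words_over X 0 = {[]}" by auto
  then show ?case by simp
next
  case (Suc k)
  then show ?case by (simp add: sum_words_over_Suc sum_product)
qed

text \<open>Rows are indexed by the sources of the maps, so the letters of a word act from left to right.\<close>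

lemma power_weighted_maps_matrix:
  fixes f :: "'x \<Rightarrow> 'w \<Rightarrow> 'w" and g :: "'x \<Rightarrow> 'b::comm_semiring_1"
  assumes X: "finite X" and ws: "distinct ws"
    and closed: "\<And>x w. \<lbrakk>x \<in> X; w \<in> set ws\<rbrakk> \<Longrightarrow> f x w \<in> set ws"
    and M: "M = mat (length ws) (length ws)
      (\<lambda>(p, q). \<Sum>x\<in>X. if f x (ws ! p) = ws ! q then g x else 0)"
    and pq: "p < length ws" "q < length ws"
  shows "(M ^\<^sub>m k) $$ (p, q) =
    (\<Sum>v\<in>words_over X k. if fold f v (ws ! p) = ws ! q then prod_list (map g v) else 0)"
  using pq
proof (induction k arbitrary: p)
  case 0
  have "words_over X 0 = {[]}" by auto
  then show ?case using 0 ws by (auto simp: M nth_eq_iff_index_eq)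
next
  case (Suc k)
  have Mc: "M \<in> carrier_mat (length ws) (length ws)" by (simp add: M)
  define F where "F w = (\<Sum>v\<in>words_over X k. if fold f v w = ws ! q then prod_list (map g v) else 0)" for w
  have "(M ^\<^sub>m Suc k) $$ (p, q) = (M * M ^\<^sub>m k) $$ (p, q)"
    using pow_mat_commute[OF Mc, of k] by simp
  also have "\<dots> = (\<Sum>s<length ws. M $$ (p, s) * (M ^\<^sub>m k) $$ (s, q))"
    using Mc pow_carrier_mat[OF Mc, of k] Suc.prems by (simp add: scalar_prod_def atLeast0LessThan)
  also have "\<dots> = (\<Sum>s<length ws. \<Sum>x\<in>X. if f x (ws ! p) = ws ! s then g x * F (ws ! s) else 0)"
    using Suc.IH Suc.prems(1) \<open>q < length ws\<close>
    by (intro sum.cong) (auto simp: M F_def sum_distrib_right intro!: sum.cong)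
  also have "\<dots> = (\<Sum>x\<in>X. \<Sum>s<length ws. if f x (ws ! p) = ws ! s then g x * F (ws ! s) else 0)"
    by (rule sum.swap)
  also have "\<dots> = (\<Sum>x\<in>X. g x * F (f x (ws ! p)))"
  proof (rule sum.cong)
    fix x assume "x \<in> X"
    then obtain t where t: "t < length ws" "f x (ws ! p) = ws ! t"
      using closed[of x "ws ! p"] Suc.prems by (metis in_set_conv_nth nth_mem)
    have "(\<Sum>s<length ws. if f x (ws ! p) = ws ! s then g x * F (ws ! s) else 0)
        = (\<Sum>s<length ws. if s = t then g x * F (ws ! s) else 0)"
      using t ws by (intro sum.cong) (auto simp: nth_eq_iff_index_eq)
    then show "(\<Sum>s<length ws. if f x (ws ! p) = ws ! s then g x * F (ws ! s) else 0)
        = g x * F (f x (ws ! p))"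
      using t by simp
  qed simp
  also have "\<dots> = (\<Sum>v\<in>words_over X (Suc k). if fold f v (ws ! p) = ws ! q then prod_list (map g v) else 0)"
    by (simp add: sum_words_over_Suc F_def sum_distrib_left if_distrib cong: if_cong)
  finally show ?case .
qed

lemma trace_power_weighted_maps_matrix:
  fixes f :: "'x \<Rightarrow> 'w \<Rightarrow> 'w" and g :: "'x \<Rightarrow> 'b::comm_semiring_1"
  assumes X: "finite X" and ws: "distinct ws"
    and closed: "\<And>x w. \<lbrakk>x \<in> X; w \<in> set ws\<rbrakk> \<Longrightarrow> f x w \<in> set ws"
    and M: "M = mat (length ws) (length ws)
      (\<lambda>(p, q). \<Sum>x\<in>X. if f x (ws ! p) = ws ! q then g x else 0)"
  shows "mat_trace (M ^\<^sub>m k) =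
    (\<Sum>v\<in>words_over X k. of_nat (card {w \<in> set ws. fold f v w = w}) * prod_list (map g v))"
proof -
  have Mc: "M \<in> carrier_mat (length ws) (length ws)" by (simp add: M)
  have "mat_trace (M ^\<^sub>m k) = (\<Sum>p<length ws. \<Sum>v\<in>words_over X k.
      if fold f v (ws ! p) = ws ! p then prod_list (map g v) else 0)"
    unfolding mat_trace_def using pow_carrier_mat[OF Mc, of k] power_weighted_maps_matrix[OF X ws closed M]
    by (intro sum.cong) auto
  also have "\<dots> = (\<Sum>v\<in>words_over X k. \<Sum>p<length ws.
      if fold f v (ws ! p) = ws ! p then prod_list (map g v) else 0)"
    by (rule sum.swap)
  also have "(\<lambda>v. \<Sum>p<length ws. if fold f v (ws ! p) = ws ! p then prod_list (map g v) else 0)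
      = (\<lambda>v. \<Sum>w\<in>set ws. if fold f v w = w then prod_list (map g v) else 0)"
    using sum.reindex_bij_betw[OF bij_betw_nth[OF ws refl refl]] by fastforce
  finally show ?thesis
    by (simp add: sum.If_cases Int_def)
qed

text \<open>A linear extension is a bijection between positions and letters, so each row's sum over
  positions becomes a sum over the ground set, with an index set common to all rows.\<close>

lemma promotion_matrix_eq:
  assumes ws: "set ws = linear_extensions r" and "finite (Field r)"
  shows "promotion_matrix r ws = mat (length ws) (length ws)
    (\<lambda>(p, q). \<Sum>x\<in>Field r. if promote r x (ws ! p) = ws ! q then indet x else 0)"
  unfolding promotion_matrix_def
proof (rule cong_mat)
  fix p q assume p: "p < length ws"
  define w where "w = ws ! p"
  have w: "distinct w" "set w = Field r"
    using nth_mem[OF p] ws by (auto simp: w_def linear_extensions_def)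
  have "(\<Sum>i | i \<in> {1..length w} \<and> promotion r i w = ws ! q. indet (w ! (i - 1)))
      = (\<Sum>i\<in>{1..length w}. if promotion r i w = ws ! q then indet (w ! (i - 1)) else 0)"
    by (simp add: sum.If_cases Int_def conj_commute)
  also have "\<dots> = (\<Sum>i<length w. if promotion r (Suc i) w = ws ! q then indet (w ! i) else 0)"
    by (rule sum.reindex_bij_witness[of _ Suc "\<lambda>i. i - 1"]) auto
  also have "\<dots> = (\<Sum>i<length w. if promote r (w ! i) w = ws ! q then indet (w ! i) else 0)"
    using w by (intro sum.cong) (auto simp: promotion_eq_promote)
  also have "\<dots> = (\<Sum>x\<in>Field r. if promote r x w = ws ! q then indet x else 0)"
    using sum.reindex_bij_betw[OF bij_betw_nth[OF w(1) refl w(2)[symmetric]],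
      of "\<lambda>x. if promote r x w = ws ! q then indet x else 0"] by simp
  finally show "(case (p, q) of (p, q) \<Rightarrow>
      \<Sum>i | i \<in> {1..length (ws ! p)} \<and> promotion r i (ws ! p) = ws ! q. indet (ws ! p ! (i - 1)))
    = (case (p, q) of (p, q) \<Rightarrow> \<Sum>x\<in>Field r. if promote r x (ws ! p) = ws ! q then indet x else 0)"
    by (simp add: w_def)
qed simp_all

definition fixed_points :: "'a rel \<Rightarrow> 'a list \<Rightarrow> 'a list set" where
  "fixed_points r v = {w \<in> lin_exts_on r (Field r). fold (promote r) v w = w}"

text \<open>Each form is extended multiplicatively to words. The sum is what the trace of the
  operator of \<open>v\<close> would be if the promotion operators were simultaneously triangular
  with the forms of \<open>E\<close> on the diagonal.\<close>

definition character_sum :: "('a \<Rightarrow> int) multiset \<Rightarrow> 'a list \<Rightarrow> int" where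
  "character_sum E v = (\<Sum>c\<in>#E. prod_list (map c v))"

lemma prod_list_mult:
  fixes f g :: "'a \<Rightarrow> 'b::comm_monoid_mult"
  shows "prod_list (map (\<lambda>x. f x * g x) xs) = prod_list (map f xs) * prod_list (map g xs)"
  by (induction xs) (auto simp: ac_simps)

lemma sum_sum_mset: "(\<Sum>v\<in>V. \<Sum>c\<in>#E. g c v) = (\<Sum>c\<in>#E. \<Sum>v\<in>V. g c v)"
  by (induction E) (simp_all add: sum.distrib)

lemma of_int_prod_list: "of_int (prod_list (map c v)) = prod_list (map (\<lambda>x. of_int (c x)) v)"
  by (induction v) auto

lemma of_int_sum_mset: "of_int (\<Sum>c\<in>#E. f c) = (\<Sum>c\<in>#E. of_int (f c))"
  by (induction E) simp_all

lemma form_poly_power: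
  "form_poly n c ^ k = (\<Sum>v\<in>words_over {1..n} k. prod_list (map (\<lambda>x. of_int (c x) * indet x) v))"
  unfolding form_poly_def by (rule power_sum_words_over)

text \<open>The k-th power trace of the matrix and the k-th power sum of the forms expand over the
  same words of length k. The coefficients agree word by word, which settles all power traces at
  once.\<close>

theorem eigenvalue_forms_if_fixed_points:
  assumes r: "Field r = {1..n}" and ws: "distinct ws" "set ws = linear_extensions r"
    and fix_pts: "\<And>v. set v \<subseteq> {1..n} \<Longrightarrow> int (card (fixed_points r v)) = character_sum E v"
  shows "eigenvalue_forms n (promotion_matrix r ws) E"
proof -
  define M where "M = promotion_matrix r ws"
  have M: "M = mat (length ws) (length ws)
      (\<lambda>(p, q). \<Sum>x\<in>{1..n}. if promote r x (ws ! p) = ws ! q then indet x else 0)"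
    using promotion_matrix_eq[OF ws(2)] unfolding M_def r by blast
  have closed: "promote r x w \<in> set ws" if "w \<in> set ws" for x w
    using promote_lin_exts_on that unfolding ws linear_extensions_eq .
  have "mat_trace (M ^\<^sub>m k) = (\<Sum>e\<in>#image_mset (form_poly n) E. e ^ k)" for k
  proof -
    have "mat_trace (M ^\<^sub>m k) = (\<Sum>v\<in>words_over {1..n} k.
        of_nat (card {w \<in> set ws. fold (promote r) v w = w}) * prod_list (map indet v))"
      by (rule trace_power_weighted_maps_matrix[OF _ ws(1) closed M]) simp_all
    also have "\<dots> = (\<Sum>v\<in>words_over {1..n} k. \<Sum>c\<in>#E.
        prod_list (map (\<lambda>x. of_int (c x) * indet x) v))"
    proof (rule sum.cong)
      fix v assume "v \<in> words_over {1..n} k"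
      then have "int (card {w \<in> set ws. fold (promote r) v w = w}) = character_sum E v"
        using fix_pts[of v] by (simp add: fixed_points_def ws(2) linear_extensions_eq)
      then have "of_nat (card {w \<in> set ws. fold (promote r) v w = w}) = (of_int (character_sum E v) :: int_mpoly)"
        by (simp only: flip: of_int_of_nat_eq[where 'a = int_mpoly])
      then show "of_nat (card {w \<in> set ws. fold (promote r) v w = w}) * prod_list (map indet v)
          = (\<Sum>c\<in>#E. prod_list (map (\<lambda>x. of_int (c x) * indet x) v))"
        by (simp only: character_sum_def of_int_sum_mset sum_mset_distrib_right prod_list_mult of_int_prod_list)
    qed simp
    also have "\<dots> = (\<Sum>c\<in>#E. \<Sum>v\<in>words_over {1..n} k. prod_list (map (\<lambda>x. of_int (c x) * indet x) v))"
      by (rule sum_sum_mset)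
    also have "\<dots> = (\<Sum>c\<in>#E. form_poly n c ^ k)"
      by (subst form_poly_power) (rule refl)
    also have "\<dots> = (\<Sum>e\<in>#image_mset (form_poly n) E. e ^ k)"
      by (simp only: image_mset.compositionality comp_def)
    finally show ?thesis .
  qed
  then have "char_poly M = (\<Prod>e\<in>#image_mset (form_poly n) E. [:- e, 1:])"
    by (intro char_poly_prod_mset[of _ "length ws"]) (simp add: M)
  then show ?thesis
    by (simp add: eigenvalue_forms_def M_def image_mset.compositionality comp_def)
qed

section \<open>Fixed points in a rooted forest\<close>

text \<open>
  \<open>shift A\<close> performs the promotion of the least element of \<open>A\<close>, when \<open>A\<close> is the chain of all
  elements above it: each element of \<open>A\<close> moves to the place of the next one. Unlike \<open>promote\<close> it
  commutes with deleting all letters outside of an upset.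
\<close>

fun shift_from :: "'a set \<Rightarrow> 'a \<Rightarrow> 'a list \<Rightarrow> 'a list" where
  "shift_from A x [] = [x]"
| "shift_from A x (y # ys) = (if y \<in> A then x # shift_from A y ys else y # shift_from A x ys)"

fun shift :: "'a set \<Rightarrow> 'a list \<Rightarrow> 'a list" where
  "shift A [] = []"
| "shift A (y # ys) = (if y \<in> A then shift_from A y ys else y # shift A ys)"

lemma shift_from_append_disjoint: "set u \<inter> A = {} \<Longrightarrow> shift_from A x (u @ v) = u @ shift_from A x v"
  by (induction u) auto

lemma shift_append_Cons: "\<lbrakk>set u \<inter> A = {}; y \<in> A\<rbrakk> \<Longrightarrow> shift A (u @ y # v) = u @ shift_from A y v"
  by (induction u) auto

text \<open>While the carried letter is outside \<open>U\<close>, everything it leaves behind is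
  deleted by the filter. The first carried letter inside \<open>U\<close> is the one at which
  \<open>shift\<close> starts on the filtered word; from there on, all further letters of
  \<open>A\<close> lie in \<open>U\<close>.\<close>

lemma filter_shift_from:
  assumes "sorted_wrt (\<lambda>y z. y \<in> A \<inter> U \<and> z \<in> A \<longrightarrow> z \<in> U) (x # v)" "x \<in> A"
  shows "filter (\<lambda>z. z \<in> U) (shift_from A x v) = shift A (filter (\<lambda>z. z \<in> U) (x # v))"
  using assms
proof (induction v arbitrary: x)
  case Nil
  then show ?case by simp
next
  case (Cons y ys)
  show ?case
  proof (cases "x \<in> U")
    case True
    then have *: "z \<in> U" if "z \<in> set (y # ys)" "z \<in> A" for z using Cons.prems that by auto
    have "filter (\<lambda>z. z \<in> U) (shift_from A x' v) = shift_from A x' (filter (\<lambda>z. z \<in> U) v)"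
      if "\<forall>z\<in>set v. z \<in> A \<longrightarrow> z \<in> U" "x' \<in> U" for x' v
      using that by (induction v arbitrary: x') auto
    from this[of "y # ys" x] * True Cons.prems show ?thesis by auto
  next
    case False
    then show ?thesis using Cons.IH[of y] Cons.IH[of x] Cons.prems by auto
  qed
qed

lemma filter_shift:
  assumes "sorted_wrt (\<lambda>y z. y \<in> A \<inter> U \<and> z \<in> A \<longrightarrow> z \<in> U) w"
  shows "filter (\<lambda>z. z \<in> U) (shift A w) = shift A (filter (\<lambda>z. z \<in> U) w)"
  using assms
proof (induction w)
  case (Cons y ys)
  then show ?case using filter_shift_from[of A U y ys] by (cases "y \<in> A") auto
qed simp

lemma sorted_wrt_filter_partition:
  assumes "sorted_wrt (\<lambda>y z. \<not> (y \<in> U \<and> z \<notin> U)) w"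
  shows "w = filter (\<lambda>z. z \<notin> U) w @ filter (\<lambda>z. z \<in> U) w"
  using assms
proof (induction w)
  case (Cons y ys)
  show ?case
  proof (cases "y \<in> U")
    case True
    then have "filter (\<lambda>z. z \<notin> U) ys = []" using Cons.prems by (auto simp: filter_empty_conv)
    then show ?thesis using Cons True by auto
  next
    case False
    then show ?thesis using Cons by auto
  qed
qed simp

section \<open>Displacement of letters outside an upset\<close>

definition precedes :: "'a list \<Rightarrow> 'a \<Rightarrow> 'a \<Rightarrow> bool" where
  "precedes w x z \<longleftrightarrow> x \<in> set (takeWhile (\<lambda>y. y \<noteq> z) w)"

lemma precedes_Cons [simp]: "precedes (y # w) x z \<longleftrightarrow> y \<noteq> z \<and> (x = y \<or> precedes w x z)"
  by (auto simp: precedes_def)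

lemma precedes_Nil [simp]: "\<not> precedes [] x z"
  by (simp add: precedes_def)

definition position :: "'a list \<Rightarrow> 'a \<Rightarrow> nat" where
  "position w z = length (takeWhile (\<lambda>y. y \<noteq> z) w)"

lemma position_Cons [simp]: "position (y # w) z = (if y = z then 0 else Suc (position w z))"
  by (simp add: position_def)

lemma position_Nil [simp]: "position [] z = 0"
  by (simp add: position_def)

text \<open>Only letters of \<open>S\<close> are ever carried, and none of them is comparable to
  \<open>z\<close> in a way that would stop it. So the carried letter jumps over \<open>z\<close>,
  moving it one place to the left relative to \<open>x # v\<close>.\<close>

lemma position_push:
  assumes "S \<in> upsets r" "x \<in> S" "z \<notin> S" "z \<in> set v" "sorted_wrt (\<lambda>x y. (y, x) \<notin> r) (x # v)"
  shows "position (push r x v) z = position v z"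
  using assms(2-)
proof (induction v arbitrary: x)
  case (Cons y ys)
  have "y \<in> S" if "(x, y) \<in> r" using that assms(1) Cons.prems(1) by (auto simp: upsets_def)
  then show ?case using Cons by auto
qed simp

lemma position_promote_less:
  assumes "S \<in> upsets r" "x \<in> S" "z \<notin> S" "z \<in> set w" "sorted_wrt (\<lambda>x y. (y, x) \<notin> r) w"
    "precedes w x z"
  shows "position (promote r x w) z < position w z"
  using assms(4-)
proof (induction w)
  case (Cons y ys)
  then show ?case
    using position_push[OF assms(1,2,3)] by auto
qed simp

lemma promote_not_precedes:
  assumes "\<not> precedes w x z" "z \<in> set w" "x \<noteq> z"
  shows "takeWhile (\<lambda>y. y \<noteq> z) (promote r x w) = takeWhile (\<lambda>y. y \<noteq> z) w"
  using assms by (induction w) auto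

text \<open>The position of a letter \<open>z\<close> outside \<open>S\<close> is a potential: no
  promotion from \<open>S\<close> increases it, and one whose letter stands before \<open>z\<close>
  lowers it. Otherwise the prefix before \<open>z\<close> is untouched, so the question which
  letters precede \<open>z\<close> passes unchanged to the rest of \<open>v\<close>.\<close>

lemma position_fold_promote:
  assumes S: "S \<in> upsets r" and z: "z \<notin> S" "z \<in> set w"
    and w: "sorted_wrt (\<lambda>x y. (y, x) \<notin> r) w" and v: "set v \<subseteq> S"
  shows "position (fold (promote r) v w) z \<le> position w z \<and>
    (\<forall>x\<in>set v. precedes w x z \<longrightarrow> position (fold (promote r) v w) z < position w z)"
  using z(2) w v
proof (induction v arbitrary: w)
  case (Cons x v)
  let ?w = "promote r x w"
  have IH: "position (fold (promote r) v ?w) z \<le> position ?w z"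
    "\<And>y. \<lbrakk>y \<in> set v; precedes ?w y z\<rbrakk> \<Longrightarrow> position (fold (promote r) v ?w) z < position ?w z"
    using Cons.IH[of ?w] Cons.prems by (auto simp: sorted_wrt_promote)
  show ?case
  proof (cases "precedes w x z")
    case True
    then have "position ?w z < position w z"
      using position_promote_less[OF S _ z(1)] Cons.prems by auto
    then show ?thesis using IH(1) by auto
  next
    case False
    have "x \<noteq> z" using Cons.prems z by auto
    with False have "position ?w z = position w z" "precedes ?w y z = precedes w y z" for y
      using promote_not_precedes[OF False Cons.prems(1)] by (simp_all add: position_def precedes_def)
    then show ?thesis using IH False by auto
  qed
qed simp

lemma precedes_if_less:
  assumes "sorted_wrt (\<lambda>x y. (y, x) \<notin> r) w" "distinct w" "x \<in> set w" "(x, y) \<in> r" "precedes w y z"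
    "(x, x) \<in> r" "(x, z) \<notin> r \<or> x \<noteq> z"
  shows "precedes w x z"
  using assms by (induction w) (auto simp: precedes_def dest: set_takeWhileD)

lemma sorted_wrt_if_not_precedes:
  assumes "distinct w" "\<And>y z. \<lbrakk>y \<in> U; z \<in> set w - U\<rbrakk> \<Longrightarrow> \<not> precedes w y z"
  shows "sorted_wrt (\<lambda>y z. \<not> (y \<in> U \<and> z \<notin> U)) w"
  using assms
proof (induction w)
  case (Cons x w)
  have "sorted_wrt (\<lambda>y z. \<not> (y \<in> U \<and> z \<notin> U)) w"
  proof (rule Cons.IH)
    fix y z assume "y \<in> U" "z \<in> set w - U"
    then show "\<not> precedes w y z" using Cons.prems(1) Cons.prems(2)[of y z] by auto
  qed (use Cons.prems(1) in simp)
  then show ?case using Cons.prems(1) Cons.prems(2)[of x] by auto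
qed simp

lemma finite_minimal:
  assumes "trans r" "antisym r" "finite A" "A \<noteq> {}"
  shows "\<exists>m\<in>A. \<forall>z\<in>A. (z, m) \<in> r \<longrightarrow> z = m"
  using assms(3,4)
proof (induction rule: finite_ne_induct)
  case (insert a A)
  then obtain m where m: "m \<in> A" "\<And>z. \<lbrakk>z \<in> A; (z, m) \<in> r\<rbrakk> \<Longrightarrow> z = m" by blast
  show ?case
  proof (cases "(a, m) \<in> r")
    case True
    have "z = a" if "z \<in> insert a A" "(z, a) \<in> r" for z
    proof (cases "z = a")
      case False
      then have "z = m" using m(2) that transD[OF assms(1) that(2) True] by blast
      then show ?thesis using that(2) True antisymD[OF assms(2)] by blast
    qed
    then show ?thesis by blast
  next
    case False
    then show ?thesis using m by blast
  qed
qed simp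

locale fin_poset =
  fixes r :: "'a rel"
  assumes poset: "finite_poset r"
begin

lemma fin: "finite (Field r)"
  using poset by (simp add: finite_poset_def)

lemma refl_r: "x \<in> Field r \<Longrightarrow> (x, x) \<in> r"
  using poset by (simp add: finite_poset_def partial_order_on_def preorder_on_def refl_on_def)

lemma trans: "trans r" and antisym: "antisym r"
  using poset by (simp_all add: finite_poset_def partial_order_on_def preorder_on_def)

lemmas trans_r = transD[OF trans] and antisym_r = antisymD[OF antisym]

lemma minimal: "\<lbrakk>finite A; A \<noteq> {}\<rbrakk> \<Longrightarrow> \<exists>m\<in>A. \<forall>z\<in>A. (z, m) \<in> r \<longrightarrow> z = m"
  by (rule finite_minimal[OF trans antisym])

lemma maximal: "\<lbrakk>finite A; A \<noteq> {}\<rbrakk> \<Longrightarrow> \<exists>m\<in>A. \<forall>z\<in>A. (m, z) \<in> r \<longrightarrow> z = m"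
  using finite_minimal[of "r\<inverse>" A] trans antisym by simp

lemma lin_exts_on_nonempty:
  assumes "finite A" shows "lin_exts_on r A \<noteq> {}"
  using assms
proof (induction "card A" arbitrary: A)
  case 0
  then show ?case by (auto simp: lin_exts_on_def)
next
  case (Suc k)
  then have "A \<noteq> {}" by auto
  then obtain m where m: "m \<in> A" "\<forall>z\<in>A. (z, m) \<in> r \<longrightarrow> z = m"
    using minimal[OF Suc.prems] by blast
  have "k = card (A - {m})" using Suc.hyps(2) m(1) Suc.prems by simp
  then obtain w where "w \<in> lin_exts_on r (A - {m})" using Suc by blast
  then have "m # w \<in> lin_exts_on r A" using m by (auto simp: lin_exts_on_def)
  then show ?case by blast
qed

lemma upset_closure: "A \<subseteq> Field r \<Longrightarrow> r `` A \<in> upsets r"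
  unfolding upsets_def by (blast intro: trans_r FieldI2)

lemma lin_exts_on_append:
  assumes "S \<in> upsets r" "u \<in> lin_exts_on r (Field r - S)" "t \<in> lin_exts_on r S"
  shows "u @ t \<in> lin_exts_on r (Field r)"
  using assms by (auto simp: lin_exts_on_def sorted_wrt_append upsets_def)

end

text \<open>Promotion only uses that principal upsets are chains. That this describes rooted forests
  is shown by \<open>rooted_forest_imp_forest\<close> and, conversely,
  \<open>rooted_forest\<close>.\<close>

locale forest = fin_poset +
  assumes chain: "\<lbrakk>(x, y) \<in> r; (x, z) \<in> r\<rbrakk> \<Longrightarrow> (y, z) \<in> r \<or> (z, y) \<in> r"
begin

abbreviation L :: "'a list set" where "L \<equiv> lin_exts_on r (Field r)"

text \<open>For a carried \<open>x\<close> above \<open>a\<close>, a later letter is comparable to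
  \<open>x\<close> exactly if it is above \<open>a\<close>: both lie on the chain above
  \<open>a\<close>, and the order of the word excludes the wrong direction. The test thus no longer
  depends on the carried letter.\<close>

lemma push_eq_shift_from:
  assumes "sorted_wrt (\<lambda>x y. (y, x) \<notin> r) (x # v)" "(a, x) \<in> r"
  shows "push r x v = shift_from (r `` {a}) x v"
  using assms
proof (induction v arbitrary: x)
  case (Cons y ys)
  have yx: "(y, x) \<notin> r" and sorted: "sorted_wrt (\<lambda>x y. (y, x) \<notin> r) (x # ys)"
    "sorted_wrt (\<lambda>x y. (y, x) \<notin> r) (y # ys)"
    using Cons.prems(1) by auto
  have xy: "(x, y) \<in> r \<longleftrightarrow> (a, y) \<in> r"
    using trans_r[OF Cons.prems(2)] chain[OF Cons.prems(2)] yx by blast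
  show ?case
  proof (cases "(a, y) \<in> r")
    case True
    then show ?thesis using Cons.IH[OF sorted(2)] xy by simp
  next
    case False
    then show ?thesis using Cons.IH[OF sorted(1) Cons.prems(2)] xy yx by simp
  qed
qed simp

lemma promote_eq_shift:
  assumes "sorted_wrt (\<lambda>x y. (y, x) \<notin> r) w" "x \<in> set w" "(x, x) \<in> r"
  shows "promote r x w = shift (r `` {x}) w"
  using assms by (induction w) (auto intro: push_eq_shift_from)

lemma L_sorted: "w \<in> L \<Longrightarrow> sorted_wrt (\<lambda>x y. (y, x) \<notin> r) w" and L_distinct: "w \<in> L \<Longrightarrow> distinct w"
  and L_set: "w \<in> L \<Longrightarrow> set w = Field r"
  by (auto simp: lin_exts_on_def)

text \<open>This supplies the hypothesis of \<open>filter_shift\<close>: the chain above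
  \<open>x\<close> appears in increasing order, so it stays in an upset once it has entered
  it.\<close>

lemma L_sorted_upset:
  assumes "w \<in> L" "U \<in> upsets r"
  shows "sorted_wrt (\<lambda>y z. y \<in> r `` {x} \<inter> U \<and> z \<in> r `` {x} \<longrightarrow> z \<in> U) w"
proof (rule sorted_wrt_mono_rel[OF _ L_sorted[OF assms(1)]])
  fix y z assume "(z, y) \<notin> r"
  then show "y \<in> r `` {x} \<inter> U \<and> z \<in> r `` {x} \<longrightarrow> z \<in> U"
    using chain[of x y z] assms(2) by (auto simp: upsets_def)
qed

lemma filter_promote:
  assumes "w \<in> L" "x \<in> Field r" "U \<in> upsets r"
  shows "filter (\<lambda>z. z \<in> U) (promote r x w) = shift (r `` {x}) (filter (\<lambda>z. z \<in> U) w)"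
proof -
  have "promote r x w = shift (r `` {x}) w"
    using assms(2) by (intro promote_eq_shift L_sorted[OF assms(1)] refl_r) (simp_all add: L_set[OF assms(1)])
  then show ?thesis
    by (simp only: filter_shift[OF L_sorted_upset[OF assms(1,3)]])
qed

text \<open>The gain of information: promoting some \<open>x\<close> below \<open>y\<close> moves
  \<open>y\<close> to the place of the next element of the chain, which lies in \<open>U\<close>, or
  to the end. So the old place of \<open>y\<close> is forgotten, and the order of \<open>U\<close>
  before determines the order of \<open>insert y U\<close> after.\<close>

lemma filter_promote_insert:
  assumes w: "w \<in> L" and x: "(x, y) \<in> r" and y: "y \<notin> U"
    and U: "U \<in> upsets r" "insert y U \<in> upsets r"
  shows "filter (\<lambda>z. z \<in> insert y U) (promote r x w) = shift_from (r `` {x}) y (filter (\<lambda>z. z \<in> U) w)"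
proof -
  let ?A = "r `` {x}"
  have yr: "y \<in> Field r" "x \<in> Field r" using x by (auto intro: FieldI1 FieldI2)
  then obtain p q where pq: "w = p @ y # q" using w L_set split_list[of y w] by auto
  have d: "distinct w" and s: "sorted_wrt (\<lambda>x y. (y, x) \<notin> r) w"
    using w by (auto simp: lin_exts_on_def)
  have y_notin: "y \<notin> set p" "y \<notin> set q" using d pq by auto
  have fe: "filter (\<lambda>z. z \<in> insert y U) p = filter (\<lambda>z. z \<in> U) p"
    "filter (\<lambda>z. z \<in> insert y U) q = filter (\<lambda>z. z \<in> U) q"
    using y_notin by (auto intro: filter_cong)
  \<comment> \<open>An element of \<open>U\<close> above \<open>x\<close> standing before
    \<open>y\<close> would lie below \<open>y\<close>, and the upset \<open>U\<close> would contain
    \<open>y\<close>.\<close>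
  have dis: "set (filter (\<lambda>z. z \<in> U) p) \<inter> ?A = {}"
  proof (rule ccontr)
    assume "\<not> ?thesis"
    then obtain z where z: "z \<in> set p" "z \<in> U" "(x, z) \<in> r" by auto
    then have "(y, z) \<notin> r" using s pq by (auto simp: sorted_wrt_append)
    then have "(z, y) \<in> r" using chain[OF x z(3)] by auto
    then show False using z U y by (auto simp: upsets_def)
  qed
  have "filter (\<lambda>z. z \<in> insert y U) (promote r x w) = shift ?A (filter (\<lambda>z. z \<in> insert y U) w)"
    by (rule filter_promote[OF w yr(2) U(2)])
  also have "\<dots> = filter (\<lambda>z. z \<in> U) p @ shift_from ?A y (filter (\<lambda>z. z \<in> U) q)"
    using shift_append_Cons[OF dis, of y] x
    by (simp only: pq filter_append filter.simps fe insertI1 if_True Image_singleton_iff)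
  also have "\<dots> = shift_from ?A y (filter (\<lambda>z. z \<in> U) w)"
    using y by (simp add: pq shift_from_append_disjoint[OF dis])
  finally show ?thesis .
qed

lemma filter_fold_promote_cong:
  assumes "w \<in> L" "w' \<in> L" "set v \<subseteq> Field r" "U \<in> upsets r"
    "filter (\<lambda>z. z \<in> U) w = filter (\<lambda>z. z \<in> U) w'"
  shows "filter (\<lambda>z. z \<in> U) (fold (promote r) v w) = filter (\<lambda>z. z \<in> U) (fold (promote r) v w')"
  using assms
proof (induction v arbitrary: w w')
  case (Cons x v)
  show ?case
    using Cons.IH[of "promote r x w" "promote r x w'"] Cons.prems
    by (simp add: promote_lin_exts_on filter_promote)
qed simp

text \<open>The letters of \<open>v\<close> before \<open>x\<close> preserve agreement on
  \<open>U\<close>, the letter \<open>x\<close> extends it to \<open>y\<close>, and the letters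
  after \<open>x\<close> preserve the extended agreement.\<close>

lemma filter_fold_promote_insert:
  assumes w: "w \<in> L" "w' \<in> L" and v: "set v \<subseteq> Field r"
    and x: "x \<in> set v" "(x, y) \<in> r" and U: "U \<in> upsets r" "insert y U \<in> upsets r"
    and eq: "filter (\<lambda>z. z \<in> U) w = filter (\<lambda>z. z \<in> U) w'"
  shows "filter (\<lambda>z. z \<in> insert y U) (fold (promote r) v w)
    = filter (\<lambda>z. z \<in> insert y U) (fold (promote r) v w')"
proof (cases "y \<in> U")
  case True
  then show ?thesis using filter_fold_promote_cong[OF w v U(1) eq] by (simp add: insert_absorb)
next
  case False
  obtain v1 v2 where v12: "v = v1 @ x # v2" using x(1) by (meson split_list)
  let ?w = "fold (promote r) v1 w" and ?w' = "fold (promote r) v1 w'"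
  have L: "?w \<in> L" "?w' \<in> L" using w by (auto intro: fold_promote_lin_exts_on)
  have "filter (\<lambda>z. z \<in> U) ?w = filter (\<lambda>z. z \<in> U) ?w'"
    using v v12 by (intro filter_fold_promote_cong[OF w _ U(1) eq]) auto
  then have "filter (\<lambda>z. z \<in> insert y U) (promote r x ?w) = filter (\<lambda>z. z \<in> insert y U) (promote r x ?w')"
    by (simp only: filter_promote_insert[OF L(1) x(2) False U] filter_promote_insert[OF L(2) x(2) False U])
  then have "filter (\<lambda>z. z \<in> insert y U) (fold (promote r) v2 (promote r x ?w))
      = filter (\<lambda>z. z \<in> insert y U) (fold (promote r) v2 (promote r x ?w'))"
    using v v12 L by (intro filter_fold_promote_cong[OF _ _ _ U(2)]) (auto intro: promote_lin_exts_on)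
  then show ?thesis by (simp add: v12)
qed

text \<open>
  Iterating the word \<open>v\<close> forgets the initial order of the letters above \<open>v\<close>: each
  pass determines the position of one more of them, from the top down.
\<close>

lemma iterated_promotion_forgets:
  assumes v: "set v \<subseteq> Field r" and U: "U \<in> upsets r" "U \<subseteq> r `` set v"
  shows "\<exists>N. \<forall>w\<in>L. \<forall>w'\<in>L. filter (\<lambda>z. z \<in> U) ((fold (promote r) v ^^ N) w)
    = filter (\<lambda>z. z \<in> U) ((fold (promote r) v ^^ N) w')"
  using U
proof (induction "card U" arbitrary: U)
  case 0
  have "finite U" using 0 fin by (auto simp: upsets_def intro: finite_subset)
  then show ?case using 0 by simp
next
  case (Suc k)
  have U_sub: "U \<subseteq> Field r" using Suc by (auto simp: upsets_def)
  then have finU: "finite U" using fin finite_subset by blast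
  have U_ne: "U \<noteq> {}" using Suc(2) by auto
  obtain y where y: "y \<in> U" "\<forall>z\<in>U. (z, y) \<in> r \<longrightarrow> z = y"
    using minimal[OF finU U_ne] by blast
  define V where "V = U - {y}"
  have V: "V \<in> upsets r" "insert y V = U" "k = card V" "V \<subseteq> r `` set v"
  proof -
    show "V \<in> upsets r" using Suc.prems(1) y(2) by (auto simp: V_def upsets_def)
  qed (use y(1) Suc.hyps(2) Suc.prems(2) finU in \<open>auto simp: V_def\<close>)
  obtain N where N: "\<And>w w'. \<lbrakk>w \<in> L; w' \<in> L\<rbrakk> \<Longrightarrow> filter (\<lambda>z. z \<in> V) ((fold (promote r) v ^^ N) w)
    = filter (\<lambda>z. z \<in> V) ((fold (promote r) v ^^ N) w')"
    using Suc.hyps(1)[OF V(3,1,4)] by blast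
  obtain x where x: "x \<in> set v" "(x, y) \<in> r" using y(1) Suc.prems by auto
  have L: "(fold (promote r) v ^^ N) w \<in> L" if "w \<in> L" for w
    using that by (induction N) (auto intro: fold_promote_lin_exts_on)
  have "filter (\<lambda>z. z \<in> U) ((fold (promote r) v ^^ Suc N) w)
      = filter (\<lambda>z. z \<in> U) ((fold (promote r) v ^^ Suc N) w')" if "w \<in> L" "w' \<in> L" for w w'
    using filter_fold_promote_insert[OF L[OF that(1)] L[OF that(2)] v x V(1) _ N[OF that]] Suc.prems(1)
    by (simp only: V(2) funpow.simps comp_def)
  then show ?case by blast
qed

lemma promote_append_upset:
  assumes "x \<notin> set u" shows "promote r x (u @ v) = u @ promote r x v"
  using assms by (induction u) auto

lemma fold_promote_append:
  assumes "set v \<inter> set u = {}" shows "fold (promote r) v (u @ w) = u @ fold (promote r) v w"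
  using assms by (induction v arbitrary: w) (auto simp: promote_append_upset)

text \<open>If a letter of the upset stood before some \<open>z\<close> outside it, then so would a
  letter of \<open>v\<close> below it, and one pass of \<open>v\<close> would move \<open>z\<close>
  strictly to the left.\<close>

lemma fixed_point_upset_last:
  assumes v: "set v \<subseteq> Field r" and w: "w \<in> fixed_points r v"
  shows "w = filter (\<lambda>z. z \<notin> r `` set v) w @ filter (\<lambda>z. z \<in> r `` set v) w"
proof (rule sorted_wrt_filter_partition, rule sorted_wrt_if_not_precedes)
  let ?S = "r `` set v"
  have wL: "w \<in> L" and fx: "fold (promote r) v w = w" using w by (auto simp: fixed_points_def)
  have S: "?S \<in> upsets r" by (rule upset_closure[OF v])
  have vS: "set v \<subseteq> ?S" using v refl_r by blast
  show "distinct w" by (rule L_distinct[OF wL])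
  fix y z assume y: "y \<in> ?S" and z: "z \<in> set w - ?S"
  show "\<not> precedes w y z"
  proof
    assume yz: "precedes w y z"
    obtain x where x: "x \<in> set v" "(x, y) \<in> r" using y by auto
    have "x \<in> Field r" "x \<noteq> z" using x v vS z by auto
    then have "precedes w x z"
      using precedes_if_less[OF L_sorted[OF wL] L_distinct[OF wL] _ x(2) yz] refl_r wL L_set by blast
    then show False
      using position_fold_promote[OF S _ _ L_sorted[OF wL] vS] z x fx by (metis DiffE less_irrefl)
  qed
qed

lemma filter_lin_exts_on: "w \<in> lin_exts_on r A \<Longrightarrow> filter P w \<in> lin_exts_on r {x \<in> A. P x}"
  by (auto simp: lin_exts_on_def sorted_wrt_filter)

text \<open>Deleting the upset generated by \<open>v\<close> is the bijection. It is injective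
  because a fixed point equals its own \<open>N\<close>-th iterate, whose order on the upset is the
  same for all words. It is surjective because iterating from any word with the given prefix ends in
  a fixed point.\<close>

theorem card_fixed_points:
  assumes v: "set v \<subseteq> Field r"
  shows "card (fixed_points r v) = card (lin_exts_on r (Field r - r `` set v))"
proof (rule bij_betw_same_card, rule bij_betw_imageI)
  let ?S = "r `` set v" and ?G = "fold (promote r) v"
  have S: "?S \<in> upsets r" by (rule upset_closure[OF v])
  have vS: "set v \<subseteq> ?S" using v refl_r by blast
  obtain N where N: "\<And>w w'. \<lbrakk>w \<in> L; w' \<in> L\<rbrakk> \<Longrightarrow> filter (\<lambda>z. z \<in> ?S) ((?G ^^ N) w)
    = filter (\<lambda>z. z \<in> ?S) ((?G ^^ N) w')"
    using iterated_promotion_forgets[OF v S order_refl] by blast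
  have fixN: "(?G ^^ N) w = w" if "w \<in> fixed_points r v" for w
    using that by (induction N) (auto simp: fixed_points_def)
  have GL: "(?G ^^ m) w \<in> L" if "w \<in> L" for w m
    using that by (induction m) (auto intro: fold_promote_lin_exts_on)
  show "inj_on (filter (\<lambda>z. z \<notin> ?S)) (fixed_points r v)"
  proof (rule inj_onI)
    fix w w' assume w: "w \<in> fixed_points r v" "w' \<in> fixed_points r v"
      and eq: "filter (\<lambda>z. z \<notin> ?S) w = filter (\<lambda>z. z \<notin> ?S) w'"
    have "filter (\<lambda>z. z \<in> ?S) w = filter (\<lambda>z. z \<in> ?S) w'"
      using N[of w w'] w fixN by (auto simp: fixed_points_def)
    then show "w = w'"
      using eq fixed_point_upset_last[OF v w(1)] fixed_point_upset_last[OF v w(2)] by simp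
  qed
  show "filter (\<lambda>z. z \<notin> ?S) ` fixed_points r v = lin_exts_on r (Field r - ?S)"
  proof (intro equalityI subsetI)
    fix u assume "u \<in> filter (\<lambda>z. z \<notin> ?S) ` fixed_points r v"
    then show "u \<in> lin_exts_on r (Field r - ?S)"
      using filter_lin_exts_on[of _ "Field r" "\<lambda>z. z \<notin> ?S"]
      by (auto simp: fixed_points_def set_diff_eq)
  next
    fix u assume u: "u \<in> lin_exts_on r (Field r - ?S)"
    show "u \<in> filter (\<lambda>z. z \<notin> ?S) ` fixed_points r v"
    proof -
      obtain t where "t \<in> lin_exts_on r ?S"
        using lin_exts_on_nonempty[of ?S] finite_subset[OF _ fin, of ?S] S by (auto simp: upsets_def)
      then have L0: "u @ t \<in> L" by (rule lin_exts_on_append[OF S u])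
      \<comment> \<open>Starting from an arbitrary \<open>t\<close>, \<open>N\<close> passes
        suffice: a further pass amounts to \<open>N\<close> passes from another start, and these end
        in the same order.\<close>
      define t' where "t' = (?G ^^ N) t"
      have vu: "set v \<inter> set u = {}" using u vS by (auto simp: lin_exts_on_def)
      have "(?G ^^ m) (u @ t) = u @ (?G ^^ m) t" for m
        by (induction m) (auto simp: fold_promote_append[OF vu])
      then have w: "u @ t' = (?G ^^ N) (u @ t)" by (simp add: t'_def)
      then have L1: "u @ t' \<in> L" using GL[OF L0] by simp
      have Gw: "?G (u @ t') = (?G ^^ N) (?G (u @ t))" unfolding w by (simp add: funpow_swap1)
      have eq: "filter (\<lambda>z. z \<in> ?S) (u @ ?G t') = filter (\<lambda>z. z \<in> ?S) (u @ t')"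
        using N[OF fold_promote_lin_exts_on[OF L0, of v] L0]
        unfolding Gw[symmetric] unfolding w[symmetric] fold_promote_append[OF vu] .
      have Lt: "u @ ?G t' \<in> L" using fold_promote_lin_exts_on[OF L1] fold_promote_append[OF vu] by metis
      have all_S: "filter (\<lambda>z. z \<in> ?S) (u @ s) = s \<and> filter (\<lambda>z. z \<notin> ?S) (u @ s) = u"
        if "u @ s \<in> L" for s
      proof -
        have "set u = Field r - ?S" "set s \<subseteq> ?S" using that u by (auto simp: lin_exts_on_def)
        then show ?thesis by (auto simp: filter_id_conv filter_empty_conv)
      qed
      have u_eq: "u = filter (\<lambda>z. z \<notin> ?S) (u @ t')" using all_S[OF L1] by simp
      have "?G t' = t'" using eq all_S[OF L1] all_S[OF Lt] by simp
      then have "u @ t' \<in> fixed_points r v"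
        using L1 by (simp add: fixed_points_def fold_promote_append[OF vu])
      with u_eq show ?thesis by (rule image_eqI)
    qed
  qed
qed

end

section \<open>Derangement numbers of the lattice of upsets\<close>

definition nested :: "'b set \<Rightarrow> 'b set \<Rightarrow> bool" where
  "nested X Y \<longleftrightarrow> X \<subseteq> Y \<or> Y \<subseteq> X"

lemma nested_refl: "nested X X" and nested_sym: "nested X Y \<longleftrightarrow> nested Y X"
  by (auto simp: nested_def)

context fin_poset
begin

definition addable :: "'a set \<Rightarrow> 'a set" where
  "addable T = {y \<in> Field r - T. insert y T \<in> upsets r}"

text \<open>This is the factor f([T, top]) in the derangement number: a linear extension of the
  complement, read from its end, adds one element after the other to \<open>T\<close> and traces a
  maximal chain of upsets.\<close>

definition num_below :: "'a set \<Rightarrow> int" where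
  "num_below T = int (card (lin_exts_on r (Field r - T)))"

lemma finite_upsets: "finite (upsets r)"
  by (rule finite_subset[of _ "Pow (Field r)"]) (auto simp: upsets_def fin)

lemma finite_addable: "finite (addable T)"
  by (rule finite_subset[OF _ fin]) (auto simp: addable_def)

lemma Field_upset: "Field r \<in> upsets r"
  by (auto simp: upsets_def intro: FieldI2)

lemma upset_subset_Field: "T \<in> upsets r \<Longrightarrow> T \<subseteq> Field r"
  by (simp add: upsets_def)

lemma addable_between:
  assumes "T \<in> upsets r" "S \<in> upsets r" "T \<subset> S"
  obtains y where "y \<in> addable T" "y \<in> S"
proof -
  have "finite (S - T)" using finite_subset[OF upset_subset_Field[OF assms(2)] fin] by simp
  moreover have "S - T \<noteq> {}" using assms(3) by blast
  ultimately obtain y where y: "y \<in> S - T" "\<forall>z\<in>S - T. (y, z) \<in> r \<longrightarrow> z = y"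
    using maximal by blast
  have "y \<in> addable T"
    using y assms by (auto simp: addable_def upsets_def)
  with y(1) show thesis by (intro that) auto
qed

lemma lin_exts_on_below:
  assumes T: "T \<in> upsets r" "T \<noteq> Field r"
  shows "lin_exts_on r (Field r - T)
    = (\<Union>y\<in>addable T. (\<lambda>u. u @ [y]) ` lin_exts_on r (Field r - insert y T))"
proof (intro equalityI subsetI)
  fix w assume w: "w \<in> lin_exts_on r (Field r - T)"
  then have "w \<noteq> []" using T by (auto simp: lin_exts_on_def upsets_def)
  then obtain u y where uy: "w = u @ [y]" by (metis rev_exhaust)
  have y: "y \<in> Field r - T" "y \<notin> set u" and u: "insert y (set u) = Field r - T"
    and s: "\<forall>x\<in>set u. (y, x) \<notin> r"
    using w by (auto simp: lin_exts_on_def uy sorted_wrt_append)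
  have "z \<in> insert y T" if "(y, z) \<in> r" for z
    using that u s FieldI2[OF that] by blast
  then have "y \<in> addable T" using T(1) y by (auto simp: addable_def upsets_def)
  moreover have "u \<in> lin_exts_on r (Field r - insert y T)"
    using w u y by (auto simp: lin_exts_on_def uy sorted_wrt_append)
  ultimately show "w \<in> (\<Union>y\<in>addable T. (\<lambda>u. u @ [y]) ` lin_exts_on r (Field r - insert y T))"
    unfolding uy by blast
next
  fix w assume "w \<in> (\<Union>y\<in>addable T. (\<lambda>u. u @ [y]) ` lin_exts_on r (Field r - insert y T))"
  then obtain y u where y: "y \<in> addable T" and u: "u \<in> lin_exts_on r (Field r - insert y T)"
    and w: "w = u @ [y]" by blast
  have "(y, x) \<notin> r" if "x \<in> set u" for x
    using that y u by (auto simp: addable_def upsets_def lin_exts_on_def)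
  then show "w \<in> lin_exts_on r (Field r - T)"
    using y u by (auto simp: w lin_exts_on_def sorted_wrt_append addable_def)
qed

lemma num_below_rec:
  assumes T: "T \<in> upsets r" "T \<noteq> Field r"
  shows "num_below T = (\<Sum>y\<in>addable T. num_below (insert y T))"
proof -
  have "card (lin_exts_on r (Field r - T))
      = (\<Sum>y\<in>addable T. card ((\<lambda>u. u @ [y]) ` lin_exts_on r (Field r - insert y T)))"
    unfolding lin_exts_on_below[OF T]
    by (rule card_UN_disjoint) (auto simp: finite_addable fin)
  also have "\<dots> = (\<Sum>y\<in>addable T. card (lin_exts_on r (Field r - insert y T)))"
    by (intro sum.cong card_image) (auto simp: inj_on_def)
  finally show ?thesis by (simp add: num_below_def)
qed

lemma num_below_Field: "num_below (Field r) = 1"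
proof -
  have "lin_exts_on r {} = {[]}" by (auto simp: lin_exts_on_def)
  then show ?thesis by (simp add: num_below_def)
qed

section \<open>The lattice of upsets and its maximal chains\<close>

lemma upset_lattice_iff: "(S, T) \<in> upset_lattice r \<longleftrightarrow> S \<in> upsets r \<and> T \<in> upsets r \<and> S \<subseteq> T"
  by (simp add: upset_lattice_def)

lemma Field_upset_lattice: "Field (upset_lattice r) = upsets r"
  by (auto simp: Field_def upset_lattice_def)

lemma finite_poset_upset_lattice: "finite_poset (upset_lattice r)"
proof -
  have "Partial_order (upset_lattice r)"
    unfolding partial_order_on_def preorder_on_def Field_upset_lattice
    by (auto simp: refl_on_def trans_def antisym_def upset_lattice_def)
  then show ?thesis by (simp add: finite_poset_def Field_upset_lattice finite_upsets)
qed

lemma poset_top_upset_lattice: "poset_top (upset_lattice r) = Field r"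
  unfolding poset_top_def Field_upset_lattice upset_lattice_iff
  using Field_upset upset_subset_Field by (intro the_equality) blast+

text \<open>The maximal chains from \<open>T\<close> to the top, expressed by inclusion alone;
  \<open>maxchain_iff_saturated\<close> is the bridge to \<open>pred_on.maxchain\<close>.\<close>

definition saturated :: "'a set \<Rightarrow> 'a set set \<Rightarrow> bool" where
  "saturated T C \<longleftrightarrow> (\<forall>X\<in>C. X \<in> upsets r \<and> T \<subseteq> X) \<and> (\<forall>X\<in>C. \<forall>Y\<in>C. nested X Y) \<and>
    (\<forall>X. X \<in> upsets r \<longrightarrow> T \<subseteq> X \<longrightarrow> (\<forall>Y\<in>C. nested X Y) \<longrightarrow> X \<in> C)"

lemma saturatedI:
  assumes "\<And>X. X \<in> C \<Longrightarrow> X \<in> upsets r \<and> T \<subseteq> X" "\<And>X Y. \<lbrakk>X \<in> C; Y \<in> C\<rbrakk> \<Longrightarrow> nested X Y"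
    "\<And>X. \<lbrakk>X \<in> upsets r; T \<subseteq> X; \<forall>Y\<in>C. nested X Y\<rbrakk> \<Longrightarrow> X \<in> C"
  shows "saturated T C"
  using assms by (simp add: saturated_def)

lemma saturatedD:
  assumes "saturated T C"
  shows "X \<in> C \<Longrightarrow> X \<in> upsets r" "X \<in> C \<Longrightarrow> T \<subseteq> X" "\<lbrakk>X \<in> C; Y \<in> C\<rbrakk> \<Longrightarrow> nested X Y"
    "\<lbrakk>X \<in> upsets r; T \<subseteq> X; \<forall>Y\<in>C. nested X Y\<rbrakk> \<Longrightarrow> X \<in> C"
  using assms by (simp_all add: saturated_def)

lemma maxchain_iff_saturated:
  assumes T: "T \<in> upsets r"
  shows "pred_on.maxchain {U. (T, U) \<in> upset_lattice r \<and> (U, Field r) \<in> upset_lattice r}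
    (\<lambda>u v. (u, v) \<in> upset_lattice r) C \<longleftrightarrow> saturated T C"
proof -
  let ?I = "{U. (T, U) \<in> upset_lattice r \<and> (U, Field r) \<in> upset_lattice r}"
  let ?le = "\<lambda>u v. (u, v) \<in> upset_lattice r"
  have cmp: "(?le\<^sup>=\<^sup>= X Y \<or> ?le\<^sup>=\<^sup>= Y X) = nested X Y" if "X \<in> upsets r" "Y \<in> upsets r" for X Y
    using that by (auto simp: upset_lattice_iff nested_def)
  have I: "U \<in> ?I \<longleftrightarrow> U \<in> upsets r \<and> T \<subseteq> U" for U
    using T by (auto simp: upset_lattice_iff Field_upset dest: upset_subset_Field)
  have chain_iff: "pred_on.chain ?I ?le C \<longleftrightarrow>
      (\<forall>X\<in>C. X \<in> upsets r \<and> T \<subseteq> X) \<and> (\<forall>X\<in>C. \<forall>Y\<in>C. nested X Y)" for C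
    unfolding pred_on.chain_def subset_eq[of C] I
    by (intro conj_cong refl ball_cong cmp) simp_all
  show ?thesis
  proof
    assume "pred_on.maxchain ?I ?le C"
    then have c: "pred_on.chain ?I ?le C" and c_max: "\<not> (\<exists>S. pred_on.chain ?I ?le S \<and> C \<subset> S)"
      unfolding pred_on.maxchain_def by (rule conjunct1, rule conjunct2)
    show "saturated T C"
    proof (rule saturatedI)
      fix X assume X: "X \<in> upsets r" "T \<subseteq> X" "\<forall>Y\<in>C. nested X Y"
      have "pred_on.chain ?I ?le (insert X C)"
        using c X unfolding chain_iff by (simp add: nested_refl nested_sym)
      then have "\<not> C \<subset> insert X C" using c_max by blast
      then show "X \<in> C" by blast
    qed (use c in \<open>simp_all add: chain_iff\<close>)
  next
    assume s: "saturated T C"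
    have "\<not> (pred_on.chain ?I ?le D \<and> C \<subset> D)" for D
    proof
      assume D: "pred_on.chain ?I ?le D \<and> C \<subset> D"
      then obtain X where X: "X \<in> D" "X \<notin> C" by blast
      have "X \<in> upsets r" "T \<subseteq> X" "\<forall>Y\<in>D. nested X Y"
        using D X(1) unfolding chain_iff by simp_all
      then show False using saturatedD(4)[OF s] X(2) D by blast
    qed
    moreover have "pred_on.chain ?I ?le C"
      using saturatedD[OF s] unfolding chain_iff by simp
    ultimately show "pred_on.maxchain ?I ?le C"
      unfolding pred_on.maxchain_def by simp
  qed
qed

lemma num_maximal_chains_eq:
  "T \<in> upsets r \<Longrightarrow> num_maximal_chains (upset_lattice r) T (Field r) = card {C. saturated T C}"
  by (simp add: num_maximal_chains_def maxchain_iff_saturated)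

lemma finite_saturated: "finite {C. saturated T C}"
  by (rule finite_subset[of _ "Pow (upsets r)"]) (auto simp: finite_upsets dest: saturatedD(1))

lemma saturated_bot: "\<lbrakk>saturated T C; T \<in> upsets r\<rbrakk> \<Longrightarrow> T \<in> C"
  using saturatedD(2)[of T C] saturatedD(4)[of T C T] unfolding nested_def by blast

lemma saturated_Field: "{C. saturated (Field r) C} = {{Field r}}"
proof -
  have top: "X = Field r" if "X \<in> upsets r" "Field r \<subseteq> X" for X
    using that upset_subset_Field by blast
  have "saturated (Field r) {Field r}"
    by (rule saturatedI) (simp_all add: Field_upset nested_refl top)
  moreover have "C = {Field r}" if C: "saturated (Field r) C" for C
  proof -
    have "X = Field r" if "X \<in> C" for X using top saturatedD(1,2)[OF C that] by simp
    then show ?thesis using saturated_bot[OF C Field_upset] by blast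
  qed
  ultimately show ?thesis by blast
qed

lemma saturated_insert:
  assumes T: "T \<in> upsets r" and y: "y \<in> addable T" and C: "saturated (insert y T) C"
  shows "saturated T (insert T C)"
proof (rule saturatedI)
  have yT: "insert y T \<in> C" by (rule saturated_bot[OF C]) (use y in \<open>simp add: addable_def\<close>)
  have CT: "T \<subseteq> X" if "X \<in> C" for X using saturatedD(2)[OF C that] by blast
  show "X \<in> upsets r \<and> T \<subseteq> X" if "X \<in> insert T C" for X
    using that T saturatedD(1)[OF C] CT by blast
  show "nested X Y" if "X \<in> insert T C" "Y \<in> insert T C" for X Y
  proof (cases "X = T \<or> Y = T")
    case True
    then show ?thesis using that CT unfolding nested_def by blast
  next
    case False
    then show ?thesis using that saturatedD(3)[OF C] by simp
  qed
  show "X \<in> insert T C" if X: "X \<in> upsets r" "T \<subseteq> X" "\<forall>Y\<in>insert T C. nested X Y" for X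
  proof (cases "X = T")
    case False
    have "nested X (insert y T)" using X(3) yT by blast
    then have "insert y T \<subseteq> X" using X(2) False by (auto simp: nested_def)
    then show ?thesis using saturatedD(4)[OF C X(1)] X(3) by simp
  qed simp
qed

text \<open>The least member \<open>M\<close> other than \<open>T\<close> contains some
  \<open>y\<close> addable to \<open>T\<close>, so every other member contains
  \<open>insert y T\<close>. Maximality is inherited since \<open>T\<close> is nested with all
  upsets above it; it then forces \<open>insert y T\<close> itself into the chain.\<close>

lemma saturated_remove:
  assumes T: "T \<in> upsets r" "T \<noteq> Field r" and C: "saturated T C"
  shows "\<exists>y\<in>addable T. saturated (insert y T) (C - {T})"
proof -
  have TC: "T \<in> C" by (rule saturated_bot[OF C T(1)])
  have "nested (Field r) Y" if "Y \<in> C" for Y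
    using upset_subset_Field[OF saturatedD(1)[OF C that]] by (simp add: nested_def)
  then have "Field r \<in> C"
    using saturatedD(4)[OF C Field_upset] upset_subset_Field[OF T(1)] by blast
  then have ne: "C - {T} \<noteq> {}" using T(2) by blast
  have "finite C"
    by (rule finite_subset[OF _ finite_upsets]) (use saturatedD(1)[OF C] in blast)
  then obtain M where M: "M \<in> C - {T}" "\<forall>X\<in>C - {T}. X \<subseteq> M \<longrightarrow> M = X"
    using finite_has_minimal[OF _ ne] by blast
  have min: "M \<subseteq> X" if X: "X \<in> C - {T}" for X
  proof -
    have "nested M X" using saturatedD(3)[OF C, of M X] X M(1) by simp
    then show ?thesis using M(2)[rule_format, OF X] unfolding nested_def by blast
  qed
  have MC: "M \<in> C" "M \<noteq> T" using M(1) by blast+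
  have "T \<subset> M" using saturatedD(2)[OF C MC(1)] MC(2) by blast
  then obtain y where y: "y \<in> addable T" "y \<in> M"
    by (rule addable_between[OF T(1) saturatedD(1)[OF C MC(1)]])
  have yM: "insert y T \<subseteq> M" using y(2) \<open>T \<subset> M\<close> by blast
  have "saturated (insert y T) (C - {T})"
  proof (rule saturatedI)
    show "X \<in> upsets r \<and> insert y T \<subseteq> X" if "X \<in> C - {T}" for X
      using saturatedD(1)[OF C] min[OF that] yM that by blast
    show "nested X Y" if "X \<in> C - {T}" "Y \<in> C - {T}" for X Y
      using saturatedD(3)[OF C] that by simp
    show "X \<in> C - {T}" if X: "X \<in> upsets r" "insert y T \<subseteq> X" "\<forall>Y\<in>C - {T}. nested X Y" for X
    proof -
      have "T \<subseteq> X" "X \<noteq> T" using X(2) y(1) by (auto simp: addable_def)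
      moreover have "nested X Y" if "Y \<in> C" for Y
        using X(3) that \<open>T \<subseteq> X\<close> by (cases "Y = T") (simp_all add: nested_def)
      ultimately show ?thesis using saturatedD(4)[OF C X(1)] by simp
    qed
  qed
  with y(1) show ?thesis by blast
qed

lemma saturated_rec:
  assumes T: "T \<in> upsets r" "T \<noteq> Field r"
  shows "{C. saturated T C} = (\<Union>y\<in>addable T. insert T ` {C. saturated (insert y T) C})"
proof (intro equalityI subsetI)
  fix C assume "C \<in> {C. saturated T C}"
  then have C: "saturated T C" by simp
  obtain y where y: "y \<in> addable T" "saturated (insert y T) (C - {T})"
    using saturated_remove[OF T C] by blast
  have "C = insert T (C - {T})" using saturated_bot[OF C T(1)] by blast
  with y show "C \<in> (\<Union>y\<in>addable T. insert T ` {C. saturated (insert y T) C})" by blast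
next
  fix C assume "C \<in> (\<Union>y\<in>addable T. insert T ` {C. saturated (insert y T) C})"
  then show "C \<in> {C. saturated T C}" using saturated_insert[OF T(1)] by blast
qed

lemma num_below_eq_maximal_chains:
  assumes "T \<in> upsets r"
  shows "num_below T = int (num_maximal_chains (upset_lattice r) T (Field r))"
  using assms
proof (induction "card (Field r - T)" arbitrary: T rule: less_induct)
  case less
  show ?case
  proof (cases "T = Field r")
    case True
    then show ?thesis using less.prems by (simp add: num_maximal_chains_eq saturated_Field num_below_Field)
  next
    case False
    have ins: "insert y T \<in> upsets r" "y \<notin> T" "y \<in> Field r" if "y \<in> addable T" for y
      using that by (simp_all add: addable_def)
    have notin: "T \<notin> C" if "saturated (insert y T) C" "y \<in> addable T" for y C
      using saturatedD(2)[OF that(1), of T] ins(2)[OF that(2)] by blast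
    \<comment> \<open>The added element can be read off the chain: \<open>insert y T\<close> and
      \<open>insert z T\<close> are not nested for distinct \<open>y\<close> and
      \<open>z\<close>.\<close>
    have disj: "insert T ` {C. saturated (insert y T) C} \<inter> insert T ` {C. saturated (insert z T) C} = {}"
      if yz: "y \<in> addable T" "z \<in> addable T" "y \<noteq> z" for y z
    proof (rule ccontr)
      assume "\<not> ?thesis"
      then obtain E where E: "E \<in> insert T ` {C. saturated (insert y T) C}"
          "E \<in> insert T ` {C. saturated (insert z T) C}"
        by (meson disjoint_iff)
      obtain C where C: "saturated (insert y T) C" "E = insert T C" using E(1) by auto
      obtain D where D: "saturated (insert z T) D" "E = insert T D" using E(2) by auto
      have "C = D"
        using C(2) D(2) insert_ident[OF notin[OF C(1) yz(1)] notin[OF D(1) yz(2)]] by simp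
      then have "insert y T \<in> C" "insert z T \<in> C"
        using saturated_bot[OF C(1) ins(1)[OF yz(1)]] saturated_bot[OF D(1) ins(1)[OF yz(2)]] by simp_all
      then have "nested (insert y T) (insert z T)"
        by (rule saturatedD(3)[OF C(1)])
      then have "insert y T \<subseteq> insert z T \<or> insert z T \<subseteq> insert y T"
        by (simp only: nested_def)
      then show False using yz(3) ins(2)[OF yz(1)] ins(2)[OF yz(2)] by blast
    qed
    have "card {C. saturated T C} = (\<Sum>y\<in>addable T. card (insert T ` {C. saturated (insert y T) C}))"
      unfolding saturated_rec[OF less.prems False]
      by (rule card_UN_disjoint) (simp_all add: finite_addable finite_saturated disj)
    also have "\<dots> = (\<Sum>y\<in>addable T. card {C. saturated (insert y T) C})"
    proof (intro sum.cong refl card_image inj_onI)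
      fix y C D assume "y \<in> addable T" "C \<in> {C. saturated (insert y T) C}"
        "D \<in> {C. saturated (insert y T) C}" "insert T C = insert T D"
      then show "C = D" using notin[of y C] notin[of y D] by (simp add: insert_ident)
    qed
    finally have "int (num_maximal_chains (upset_lattice r) T (Field r))
        = (\<Sum>y\<in>addable T. int (num_maximal_chains (upset_lattice r) (insert y T) (Field r)))"
      using less.prems ins by (simp add: num_maximal_chains_eq)
    also have "\<dots> = (\<Sum>y\<in>addable T. num_below (insert y T))"
    proof (rule sum.cong)
      fix y assume y: "y \<in> addable T"
      have "Field r - insert y T \<subset> Field r - T" using ins[OF y] by blast
      then have "card (Field r - insert y T) < card (Field r - T)"
        by (intro psubset_card_mono) (simp_all add: fin)
      then show "int (num_maximal_chains (upset_lattice r) (insert y T) (Field r)) = num_below (insert y T)"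
        using less.hyps ins[OF y] by simp
    qed simp
    also have "\<dots> = num_below T" by (rule num_below_rec[OF less.prems False, symmetric])
    finally show ?thesis by simp
  qed
qed

end

section \<open>Alternating sums and Moebius inversion\<close>

lemma sum_Pow_insert:
  fixes f :: "'a set \<Rightarrow> 'b::comm_monoid_add"
  assumes "finite A" "m \<notin> A"
  shows "(\<Sum>U\<in>Pow (insert m A). f U) = (\<Sum>U\<in>Pow A. f U) + (\<Sum>U\<in>Pow A. f (insert m U))"
proof -
  have "(\<Sum>U\<in>Pow (insert m A). f U) = (\<Sum>U\<in>Pow A. f U) + (\<Sum>U\<in>insert m ` Pow A. f U)"
    unfolding Pow_insert using assms by (intro sum.union_disjoint) auto
  also have "(\<Sum>U\<in>insert m ` Pow A. f U) = (\<Sum>U\<in>Pow A. f (insert m U))"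
    using assms(2) by (subst sum.reindex) (auto simp: inj_on_def insert_ident subset_iff)
  finally show ?thesis .
qed

lemma sum_Pow_alternating:
  assumes "finite A"
  shows "(\<Sum>U\<in>Pow A. (-1) ^ card U) = (if A = {} then 1 else 0 :: int)"
proof (cases "A = {}")
  case False
  then obtain m B where A: "A = insert m B" "m \<notin> B" by (meson Set.set_insert all_not_in_conv)
  then have fB: "finite B" using assms by simp
  have "card (insert m U) = Suc (card U)" if "U \<in> Pow B" for U
    using that A fB by (metis PowD card_insert_disjoint finite_subset in_mono)
  then have "(\<Sum>U\<in>Pow B. (-1) ^ card (insert m U)) = (\<Sum>U\<in>Pow B. - ((-1) ^ card U :: int))"
    by (intro sum.cong) simp_all
  then show ?thesis
    unfolding A(1) sum_Pow_insert[OF fB A(2)] by (simp add: sum_negf)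
qed simp

context fin_poset
begin

text \<open>
  The Moebius sum defining a derangement number is supported on the sets of addable elements. Its
  nonnegativity is proved by induction on partial sums, over the subsets of an arbitrary \<open>A\<close>.
\<close>

definition alternating :: "'a set \<Rightarrow> 'a set \<Rightarrow> int" where
  "alternating T A = (\<Sum>U\<in>Pow A. (-1) ^ card U * num_below (T \<union> U))"

lemma addable_insert:
  assumes "y \<in> addable T" "m \<in> addable T" "y \<noteq> m"
  shows "y \<in> addable (insert m T)"
  using assms by (auto simp: addable_def upsets_def)

lemma alternating_insert:
  assumes "finite A" "m \<notin> A"
  shows "alternating T (insert m A) = alternating T A - alternating (insert m T) A"
proof -
  have "(-1) ^ card (insert m U) * num_below (T \<union> insert m U)
      = - ((-1) ^ card U * num_below (insert m T \<union> U))" if "U \<in> Pow A" for U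
  proof -
    have "finite U" "m \<notin> U" using that assms finite_subset by auto
    then show ?thesis by simp
  qed
  then have "(\<Sum>U\<in>Pow A. (-1) ^ card (insert m U) * num_below (T \<union> insert m U))
      = (\<Sum>U\<in>Pow A. - ((-1) ^ card U * num_below (insert m T \<union> U)))"
    by (rule sum.cong[OF refl])
  then show ?thesis
    by (simp add: alternating_def sum_Pow_insert[OF assms] sum_negf)
qed

text \<open>Inserting \<open>m\<close> into \<open>B\<close> subtracts
  \<open>alternating (insert m T) B\<close>, which by the outer induction lies between 0 and
  \<open>num_below (insert m T)\<close>. Over all of \<open>A\<close> these losses add up to at most
  \<open>num_below T\<close> by \<open>num_below_rec\<close>. The upper bound and the freedom of
  \<open>A\<close> are what close the induction.\<close>

lemma alternating_bounds:
  assumes "T \<in> upsets r" "A \<subseteq> addable T"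
  shows "0 \<le> alternating T A \<and> alternating T A \<le> num_below T"
  using assms
proof (induction "card (Field r - T)" arbitrary: T A rule: less_induct)
  case less
  have finA: "finite A" using less.prems(2) finite_addable finite_subset by blast
  have below: "0 \<le> alternating (insert m T) B \<and> alternating (insert m T) B \<le> num_below (insert m T)"
    if "m \<in> addable T" "B \<subseteq> addable T" "m \<notin> B" for m B
  proof (rule less.hyps)
    have m: "m \<in> Field r" "m \<notin> T" "insert m T \<in> upsets r" using that(1) by (simp_all add: addable_def)
    then show "card (Field r - insert m T) < card (Field r - T)"
      by (intro psubset_card_mono) (auto simp: fin)
    show "insert m T \<in> upsets r" by (rule m(3))
    show "B \<subseteq> addable (insert m T)" using that addable_insert by blast
  qed
  have "num_below T - (\<Sum>m\<in>B. num_below (insert m T)) \<le> alternating T B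
      \<and> alternating T B \<le> num_below T" if "B \<subseteq> A" for B
    using finite_subset[OF that finA] that
  proof (induction B rule: finite_induct)
    case empty
    then show ?case by (simp add: alternating_def)
  next
    case (insert m B)
    have "m \<in> addable T" "B \<subseteq> addable T" using insert.prems less.prems(2) by blast+
    from below[OF this insert.hyps(2)] insert.IH insert.prems show ?case
      by (simp add: alternating_insert[OF insert.hyps] insert.hyps)
  qed
  from this[OF order_refl]
  have *: "num_below T - (\<Sum>m\<in>A. num_below (insert m T)) \<le> alternating T A" "alternating T A \<le> num_below T"
    by simp_all
  show ?case
  proof (cases "T = Field r")
    case True
    then have "A = {}" using less.prems(2) by (auto simp: addable_def)
    then show ?thesis using True by (simp add: alternating_def num_below_Field)
  next
    case False
    have "(\<Sum>m\<in>A. num_below (insert m T)) \<le> (\<Sum>m\<in>addable T. num_below (insert m T))"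
      using less.prems(2) finite_addable by (intro sum_mono2) (simp_all add: num_below_def)
    then show ?thesis using * num_below_rec[OF less.prems(1) False] by simp
  qed
qed

definition removable :: "'a set \<Rightarrow> 'a set" where
  "removable T = {y \<in> T. T - {y} \<in> upsets r}"

lemma upsetI:
  assumes "S \<subseteq> Field r" "\<And>x y. \<lbrakk>x \<in> S; (x, y) \<in> r\<rbrakk> \<Longrightarrow> y \<in> S"
  shows "S \<in> upsets r"
  using assms by (simp add: upsets_def)

lemma upsetD: "\<lbrakk>S \<in> upsets r; x \<in> S; (x, y) \<in> r\<rbrakk> \<Longrightarrow> y \<in> S"
  by (simp add: upsets_def)

lemma addableD:
  assumes "y \<in> addable T"
  shows "y \<in> Field r" "y \<notin> T" "(y, z) \<in> r \<Longrightarrow> z = y \<or> z \<in> T"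
  using assms upsetD[of "insert y T" y z] by (simp_all add: addable_def)

lemma removableD:
  assumes "y \<in> removable T"
  shows "y \<in> T" "\<lbrakk>x \<in> T; (x, y) \<in> r\<rbrakk> \<Longrightarrow> x = y"
  using assms upsetD[of "T - {y}" x y] by (auto simp: removable_def)

text \<open>The change of variables for \<open>sum_derangements\<close>. Distinct addable elements
  are incomparable, as are distinct removable ones, so any set of them can be added or removed at
  once.\<close>

lemma upset_addable_iff_removable:
  "(S' \<in> upsets r \<and> S \<subseteq> S' \<and> U \<subseteq> addable S' \<and> T = S' \<union> U)
    \<longleftrightarrow> (T \<in> upsets r \<and> S \<subseteq> T \<and> U \<subseteq> removable T - S \<and> S' = T - U)"
proof
  assume L: "S' \<in> upsets r \<and> S \<subseteq> S' \<and> U \<subseteq> addable S' \<and> T = S' \<union> U"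
  have S': "S' \<in> upsets r" "S \<subseteq> S'" and U: "\<And>y. y \<in> U \<Longrightarrow> y \<in> addable S'" and T_eq: "T = S' \<union> U"
    using L by blast+
  have T_closed: "z \<in> S' \<or> z = y" if "y \<in> T" "(y, z) \<in> r" for y z
    using that upsetD[OF S'(1)] addableD(3)[OF U] unfolding T_eq by blast
  have T_sub: "T \<subseteq> Field r"
    using upset_subset_Field[OF S'(1)] addableD(1)[OF U] unfolding T_eq by blast
  have T: "T \<in> upsets r"
  proof (rule upsetI[OF T_sub])
    fix y z assume "y \<in> T" "(y, z) \<in> r"
    then show "z \<in> T" using T_closed[of y z] unfolding T_eq by blast
  qed
  have "y \<in> removable T" if y: "y \<in> U" for y
  proof -
    have "T - {y} \<in> upsets r"
    proof (rule upsetI)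
      fix x z assume "x \<in> T - {y}" "(x, z) \<in> r"
      then show "z \<in> T - {y}" using T_closed[of x z] addableD(2)[OF U[OF y]] unfolding T_eq by blast
    qed (use T_sub in blast)
    then show ?thesis using y by (simp add: removable_def T_eq)
  qed
  moreover have "y \<notin> S'" if "y \<in> U" for y using addableD(2)[OF U[OF that]] .
  ultimately show "T \<in> upsets r \<and> S \<subseteq> T \<and> U \<subseteq> removable T - S \<and> S' = T - U"
    using T S'(2) unfolding T_eq by blast
next
  assume R: "T \<in> upsets r \<and> S \<subseteq> T \<and> U \<subseteq> removable T - S \<and> S' = T - U"
  have T: "T \<in> upsets r" "S \<subseteq> T" and U: "\<And>y. y \<in> U \<Longrightarrow> y \<in> removable T" "\<And>y. y \<in> U \<Longrightarrow> y \<notin> S"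
    and S'_eq: "S' = T - U"
    using R by blast+
  have T_sub: "T \<subseteq> Field r" by (rule upset_subset_Field[OF T(1)])
  have closed: "z \<in> T \<and> (z \<in> U \<longrightarrow> y = z)" if "y \<in> T" "(y, z) \<in> r" for y z
    using upsetD[OF T(1) that] removableD(2)[OF U(1) that] by blast
  have S': "S' \<in> upsets r"
  proof (rule upsetI)
    fix y z assume "y \<in> S'" "(y, z) \<in> r"
    then show "z \<in> S'" using closed[of y z] unfolding S'_eq by blast
  qed (use T_sub S'_eq in blast)
  have "y \<in> addable S'" if y: "y \<in> U" for y
  proof -
    have yT: "y \<in> T" by (rule removableD(1)[OF U(1)[OF y]])
    have "insert y S' \<in> upsets r"
    proof (rule upsetI)
      fix x z assume "x \<in> insert y S'" "(x, z) \<in> r"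
      then show "z \<in> insert y S'" using closed[of x z] yT unfolding S'_eq by blast
    qed (use T_sub S'_eq yT in blast)
    then show ?thesis using y yT T_sub by (auto simp: addable_def S'_eq)
  qed
  moreover have "U \<subseteq> T" using removableD(1)[OF U(1)] by blast
  ultimately show "S' \<in> upsets r \<and> S \<subseteq> S' \<and> U \<subseteq> addable S' \<and> T = S' \<union> U"
    using S' T(2) U(2) unfolding S'_eq by blast
qed

lemma removable_empty_iff:
  assumes T: "T \<in> upsets r" and S: "S \<in> upsets r" "S \<subseteq> T"
  shows "removable T - S = {} \<longleftrightarrow> T = S"
proof
  assume e: "removable T - S = {}"
  show "T = S"
  proof (rule ccontr)
    assume "T \<noteq> S"
    then have "T - S \<noteq> {}" "finite (T - S)"
      using S finite_subset[OF upset_subset_Field[OF T] fin] by auto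
    then obtain m where m: "m \<in> T - S" "\<forall>z\<in>T - S. (z, m) \<in> r \<longrightarrow> z = m"
      using minimal by blast
    have "T - {m} \<in> upsets r"
    proof (rule upsetI)
      fix x z assume x: "x \<in> T - {m}" "(x, z) \<in> r"
      then have "z \<in> T" using upsetD[OF T] by blast
      moreover have "z \<noteq> m" using x m upsetD[OF S(1), of x z] by blast
      ultimately show "z \<in> T - {m}" by blast
    qed (use upset_subset_Field[OF T] in blast)
    then show False using m(1) e unfolding removable_def by blast
  qed
qed (auto simp: removable_def)

definition derangements :: "'a set \<Rightarrow> int" where
  "derangements T = alternating T (addable T)"

lemma derangements_nonneg: "T \<in> upsets r \<Longrightarrow> 0 \<le> derangements T"
  using alternating_bounds[of T "addable T"] by (simp add: derangements_def)

text \<open>After regrouping by the union \<open>T\<close>, the coefficient of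
  \<open>num_below T\<close> is an alternating sum over all subsets of
  \<open>removable T - S\<close>. It vanishes unless this set is empty, that is, unless
  \<open>T = S\<close>.\<close>

lemma sum_derangements:
  assumes S: "S \<in> upsets r"
  shows "(\<Sum>S' | S' \<in> upsets r \<and> S \<subseteq> S'. derangements S') = num_below S"
proof -
  let ?up = "{S'. S' \<in> upsets r \<and> S \<subseteq> S'}"
  have fin_up: "finite ?up" using finite_upsets by simp
  have fin_rem: "finite (removable T - S)" if "T \<in> upsets r" for T
    using finite_subset[OF upset_subset_Field[OF that] fin] by (auto simp: removable_def)
  have "(\<Sum>S'\<in>?up. derangements S')
      = (\<Sum>(S', U)\<in>Sigma ?up (\<lambda>S'. Pow (addable S')). (-1) ^ card U * num_below (S' \<union> U))"
    unfolding derangements_def alternating_def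
    by (rule sum.Sigma) (simp_all add: fin_up finite_addable)
  also have "\<dots> = (\<Sum>(T, U)\<in>Sigma ?up (\<lambda>T. Pow (removable T - S)). (-1) ^ card U * num_below T)"
  proof (rule sum.reindex_bij_witness[of _ "\<lambda>(T, U). (T - U, U)" "\<lambda>(S', U). (S' \<union> U, U)"])
    fix p assume "p \<in> Sigma ?up (\<lambda>S'. Pow (addable S'))"
    then obtain S' U where p: "p = (S', U)" "S' \<in> upsets r \<and> S \<subseteq> S' \<and> U \<subseteq> addable S' \<and> S' \<union> U = S' \<union> U"
      by auto
    note * = p(2)[unfolded upset_addable_iff_removable]
    show "(case case p of (S', U) \<Rightarrow> (S' \<union> U, U) of (T, U) \<Rightarrow> (T - U, U)) = p"
      using * by (simp add: p(1))
    show "(case p of (S', U) \<Rightarrow> (S' \<union> U, U)) \<in> Sigma ?up (\<lambda>T. Pow (removable T - S))"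
      using * by (simp add: p(1))
    show "(case case p of (S', U) \<Rightarrow> (S' \<union> U, U) of (T, U) \<Rightarrow> (-1) ^ card U * num_below T)
        = (case p of (S', U) \<Rightarrow> (-1) ^ card U * num_below (S' \<union> U))"
      by (simp add: p(1))
  next
    fix p assume "p \<in> Sigma ?up (\<lambda>T. Pow (removable T - S))"
    then obtain T U where p: "p = (T, U)" "T \<in> upsets r \<and> S \<subseteq> T \<and> U \<subseteq> removable T - S \<and> T - U = T - U"
      by auto
    note * = p(2)[folded upset_addable_iff_removable]
    show "(case case p of (T, U) \<Rightarrow> (T - U, U) of (S', U) \<Rightarrow> (S' \<union> U, U)) = p"
      using * by (simp add: p(1))
    show "(case p of (T, U) \<Rightarrow> (T - U, U)) \<in> Sigma ?up (\<lambda>S'. Pow (addable S'))"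
      using * by (simp add: p(1))
  qed
  also have "\<dots> = (\<Sum>T\<in>?up. \<Sum>U\<in>Pow (removable T - S). (-1) ^ card U * num_below T)"
    by (rule sum.Sigma[symmetric]) (simp_all add: fin_up fin_rem)
  also have "\<dots> = (\<Sum>T\<in>?up. if T = S then num_below T else 0)"
  proof (rule sum.cong)
    fix T assume T: "T \<in> ?up"
    have "(\<Sum>U\<in>Pow (removable T - S). (-1) ^ card U * num_below T)
        = (\<Sum>U\<in>Pow (removable T - S). (-1) ^ card U) * num_below T"
      by (rule sum_distrib_right[symmetric])
    also have "\<dots> = (if removable T - S = {} then 1 else 0) * num_below T"
      using T by (simp only: sum_Pow_alternating[OF fin_rem] mem_Collect_eq)
    also have "\<dots> = (if T = S then num_below T else 0)"
      using T removable_empty_iff[OF _ S] by (simp del: Diff_eq_empty_iff)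
    finally show "(\<Sum>U\<in>Pow (removable T - S). (-1) ^ card U * num_below T)
      = (if T = S then num_below T else 0)" .
  qed simp
  also have "\<dots> = num_below S"
    using S fin_up by simp
  finally show ?thesis .
qed

lemma sum_moebius_interval:
  assumes r: "finite_poset q" and xy: "(x, y) \<in> q"
  shows "(\<Sum>z | (x, z) \<in> q \<and> (z, y) \<in> q. moebius q x z) = (if x = y then 1 else 0)"
proof -
  have q: "finite (Field q)" "trans q" "antisym q" "refl_on (Field q) q"
    using r by (simp_all add: finite_poset_def partial_order_on_def preorder_on_def)
  have yy: "(y, y) \<in> q" using q(4) xy by (auto simp: refl_on_def intro: FieldI2)
  let ?Z = "{z. (x, z) \<in> q \<and> (z, y) \<in> q}"
  show ?thesis
  proof (cases "x = y")
    case True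
    then have "?Z = {x}" using yy antisymD[OF q(3)] by blast
    then show ?thesis using True by (simp add: moebius.simps)
  next
    case False
    have "finite ?Z" by (rule finite_subset[OF _ q(1)]) (auto intro: FieldI2)
    moreover have "y \<in> ?Z" using xy yy by simp
    ultimately have "(\<Sum>z\<in>?Z. moebius q x z) = moebius q x y + (\<Sum>z\<in>?Z - {y}. moebius q x z)"
      by (rule sum.remove)
    moreover have "?Z - {y} = {z. (x, z) \<in> q \<and> (z, y) \<in> q \<and> z \<noteq> y}" by blast
    moreover have "moebius q x y = - (\<Sum>z | (x, z) \<in> q \<and> (z, y) \<in> q \<and> z \<noteq> y. moebius q x z)"
      using False r xy by (subst moebius.simps) simp
    ultimately show ?thesis using False by simp
  qed
qed

text \<open>The Moebius function is never computed: each \<open>num_below T\<close> is replaced by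
  the sum of \<open>derangements\<close> above \<open>T\<close>, and after exchanging the sums the
  Moebius values add up to zero over every nontrivial interval.\<close>

theorem derangement_number_eq:
  assumes S: "S \<in> upsets r"
  shows "derangement_number (upset_lattice r) S = derangements S"
proof -
  let ?q = "upset_lattice r"
  let ?up = "\<lambda>T. {S'. S' \<in> upsets r \<and> T \<subseteq> S'}"
  have up: "{T. (S, T) \<in> ?q} = ?up S" using S by (simp add: upset_lattice_iff)
  have fin_up: "finite (?up T)" for T using finite_upsets by simp
  have "derangement_number ?q S = (\<Sum>T\<in>?up S. moebius ?q S T * num_below T)"
    unfolding derangement_number_def poset_top_upset_lattice up
    by (intro sum.cong refl) (simp add: num_below_eq_maximal_chains)
  also have "\<dots> = (\<Sum>T\<in>?up S. \<Sum>S'\<in>?up T. moebius ?q S T * derangements S')"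
    by (intro sum.cong refl) (simp add: sum_derangements[symmetric] sum_distrib_left)
  also have "\<dots> = (\<Sum>T\<in>?up S. \<Sum>S' | S' \<in> ?up S \<and> T \<subseteq> S'. moebius ?q S T * derangements S')"
    by (intro sum.cong refl) auto
  also have "\<dots> = (\<Sum>S'\<in>?up S. \<Sum>T | T \<in> ?up S \<and> T \<subseteq> S'. moebius ?q S T * derangements S')"
    by (rule sum.swap_restrict) (rule fin_up)+
  also have "\<dots> = (\<Sum>S'\<in>?up S. if S = S' then derangements S' else 0)"
  proof (rule sum.cong)
    fix S' assume S': "S' \<in> ?up S"
    have I: "{T. T \<in> ?up S \<and> T \<subseteq> S'} = {T. (S, T) \<in> ?q \<and> (T, S') \<in> ?q}"
      using S S' by (auto simp: upset_lattice_iff)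
    have "(\<Sum>T | T \<in> ?up S \<and> T \<subseteq> S'. moebius ?q S T * derangements S')
        = (\<Sum>T | (S, T) \<in> ?q \<and> (T, S') \<in> ?q. moebius ?q S T) * derangements S'"
      unfolding I by (rule sum_distrib_right[symmetric])
    also have "\<dots> = (if S = S' then 1 else 0) * derangements S'"
      using S S' by (subst sum_moebius_interval[OF finite_poset_upset_lattice]) (simp_all add: upset_lattice_iff)
    finally show "(\<Sum>T | T \<in> ?up S \<and> T \<subseteq> S'. moebius ?q S T * derangements S')
        = (if S = S' then derangements S' else 0)" by simp
  qed simp
  also have "\<dots> = derangements S"
    using S fin_up by simp
  finally show ?thesis .
qed

end

section \<open>Splitting a level\<close>

lemma sorted_wrt_conj:
  "\<lbrakk>sorted_wrt P w; sorted_wrt Q w\<rbrakk> \<Longrightarrow> sorted_wrt (\<lambda>x y. P x y \<and> Q x y) w"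
  by (induction w) auto

text \<open>
  \<open>a\<close> and \<open>b\<close> are the two levels to be merged: they become twins once the relation between them
  is dropped, and every element above some element below \<open>a\<close> is comparable to \<open>a\<close>.
\<close>

locale twin_levels = fin_poset +
  fixes a b :: 'a
  assumes ab: "(a, b) \<in> r" "a \<noteq> b"
    and below_twins: "k \<noteq> a \<Longrightarrow> k \<noteq> b \<Longrightarrow> (k, a) \<in> r \<longleftrightarrow> (k, b) \<in> r"
    and above_twins: "k \<noteq> a \<Longrightarrow> k \<noteq> b \<Longrightarrow> (a, k) \<in> r \<longleftrightarrow> (b, k) \<in> r"
    and through: "(z, a) \<in> r \<Longrightarrow> z \<noteq> a \<Longrightarrow> (z, y) \<in> r \<Longrightarrow> (y, a) \<in> r \<or> (a, y) \<in> r"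
begin

abbreviation r' :: "'a rel" where "r' \<equiv> r - {(a, b)}"

definition swap :: "'a \<Rightarrow> 'a" where "swap x = (if x = a then b else if x = b then a else x)"

lemma swap_swap [simp]: "swap (swap x) = x" and swap_a [simp]: "swap a = b" and swap_b [simp]: "swap b = a"
  and swap_other: "\<lbrakk>x \<noteq> a; x \<noteq> b\<rbrakk> \<Longrightarrow> swap x = x"
  using ab by (auto simp: swap_def)

lemma swap_eq_iff [simp]: "swap x = swap y \<longleftrightarrow> x = y"
  by (metis swap_swap)

lemma swap_comp_swap [simp]: "swap \<circ> swap = id"
  by (simp add: fun_eq_iff)

lemma map_swap_swap: "map swap (map swap w) = w"
  by simp

lemma map_swap_other: "\<lbrakk>a \<notin> set w; b \<notin> set w\<rbrakk> \<Longrightarrow> map swap w = w"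
  by (rule map_idI) (metis swap_other)

lemma Field_r: "a \<in> Field r" "b \<in> Field r"
  using ab by (auto intro: FieldI1 FieldI2)

lemma not_ba: "(b, a) \<notin> r"
  using ab antisym_r by blast

text \<open>The source of the symmetry of the construction: without the relation between them the
  twins are exchanged by an automorphism, so \<open>swap\<close> commutes with promotion in
  \<open>r'\<close>.\<close>

lemma swap_r': "(swap x, swap y) \<in> r' \<longleftrightarrow> (x, y) \<in> r'"
proof -
  have aa: "(a, a) \<in> r" "(b, b) \<in> r" using Field_r refl_r by blast+
  consider "x \<in> {a, b}" "y \<in> {a, b}" | "x \<in> {a, b}" "y \<notin> {a, b}" | "x \<notin> {a, b}" "y \<in> {a, b}"
    | "x \<notin> {a, b}" "y \<notin> {a, b}" by blast
  then show ?thesis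
  proof cases
    case 1
    then show ?thesis using aa ab not_ba by (auto simp: swap_def)
  next
    case 2
    then show ?thesis using above_twins[of y] by (auto simp: swap_def)
  next
    case 3
    then show ?thesis using below_twins[of x] by (auto simp: swap_def)
  next
    case 4
    then show ?thesis by (auto simp: swap_def)
  qed
qed

lemma push_map_swap: "push r' (swap x) (map swap w) = map swap (push r' x w)"
proof (induction w arbitrary: x)
  case (Cons y w)
  have *: "((swap x, swap y) \<in> r' \<or> (swap y, swap x) \<in> r') = ((x, y) \<in> r' \<or> (y, x) \<in> r')"
    by (simp only: swap_r')
  show ?case
    unfolding list.map push.simps * by (simp only: if_distrib[of "map swap"] list.map Cons.IH)
qed simp

lemma promote_map_swap: "promote r' (swap x) (map swap w) = map swap (promote r' x w)"
  by (induction w) (simp_all add: push_map_swap)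

lemma Field_r': "Field r' = Field r"
proof (intro equalityI subsetI)
  fix x assume "x \<in> Field r"
  then have "(x, x) \<in> r'" using refl_r ab by auto
  then show "x \<in> Field r'" by (rule FieldI1)
qed (auto simp: Field_def)

abbreviation "sorted_r \<equiv> sorted_wrt (\<lambda>x y. (y, x) \<notin> r)"

text \<open>The two relations differ only when a carried \<open>a\<close> meets \<open>b\<close>.
  The condition on \<open>x\<close> passes to every letter carried later, and it keeps
  \<open>a\<close> from ever being carried.\<close>

lemma push_eq:
  assumes "sorted_r (x # w)" "x = b \<or> (x, b) \<notin> r"
  shows "push r' x w = push r x w"
  using assms
proof (induction w arbitrary: x)
  case (Cons y w)
  have yx: "(y, x) \<notin> r" and sorted: "sorted_r (y # w)" "sorted_r (x # w)" using Cons.prems(1) by auto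
  have x_ne: "(x, y) \<noteq> (a, b)" using Cons.prems(2) ab by blast
  show ?case
  proof (cases "(x, y) \<in> r")
    case True
    have "y = b \<or> (y, b) \<notin> r"
    proof (cases "x = b")
      case False
      then show ?thesis using Cons.prems(2) True trans_r by blast
    next
      case b: True
      then show ?thesis using True antisym_r by blast
    qed
    then show ?thesis using True x_ne Cons.IH[OF sorted(1)] by simp
  next
    case False
    then show ?thesis using yx Cons.IH[OF sorted(2) Cons.prems(2)] by simp
  qed
qed simp

text \<open>In \<open>r\<close> the letter \<open>b\<close> takes over from \<open>a\<close> when
  they meet; in \<open>r'\<close> the letter \<open>a\<close> passes over \<open>b\<close> and goes
  on. What follows cannot distinguish the twins, so the results differ by exchanging them. Nothing
  earlier stops \<open>a\<close>, for it would lie above \<open>b\<close> and yet stand before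
  it.\<close>

lemma push_a:
  assumes "sorted_r (a # w)" "distinct (a # w)" "b \<in> set w"
  shows "push r' a w = map swap (push r a w)"
proof -
  obtain u v where w: "w = u @ b # v" using assms(3) by (meson split_list)
  have u_b: "(b, y) \<notin> r" "y \<noteq> a" "y \<noteq> b" if "y \<in> set u" for y
    using that assms(1,2) by (auto simp: w sorted_wrt_append)
  have inc: "(a, y) \<notin> r \<and> (y, a) \<notin> r" if "y \<in> set u" for y
    using u_b[OF that] above_twins[of y] that assms(1) by (auto simp: w sorted_wrt_append)
  have skip: "push q a (u @ v') = u @ push q a v'"
    if "\<And>y. y \<in> set u \<Longrightarrow> (a, y) \<notin> q \<and> (y, a) \<notin> q" for q v'
    using that by (induction u) auto
  have av: "a \<notin> set u" "a \<notin> set v" "b \<notin> set u" "b \<notin> set v" using assms(2) by (auto simp: w)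
  have "push r' a w = u @ push r' a (b # v)"
    unfolding w by (rule skip) (use inc in blast)
  also have "push r' a (b # v) = b # push r' a v" using not_ba by simp
  also have "push r' a v = map swap (push r' b v)"
    using push_map_swap[of b v] map_swap_other[of v] av by simp
  also have "push r' b v = push r b v"
    using assms(1) by (intro push_eq) (simp_all add: w sorted_wrt_append)
  also have "u @ b # map swap (push r b v) = map swap (u @ a # push r b v)"
    using map_swap_other[of u] av by simp
  also have "u @ a # push r b v = u @ push r a (b # v)" using ab by simp
  also have "\<dots> = push r a w" unfolding w by (rule skip[symmetric]) (use inc in blast)
  finally show ?thesis .
qed

text \<open>By \<open>through\<close>, whatever stops the carried letter is comparable to
  \<open>a\<close>, and it cannot be above \<open>a\<close>, which is still to come. So the carried
  letters climb below \<open>a\<close> until \<open>a\<close> itself is carried, where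
  \<open>push_a\<close> applies.\<close>

lemma push_below:
  assumes "sorted_r (x # w)" "distinct (x # w)" "(x, a) \<in> r" "x \<noteq> a" "a \<in> set w" "b \<in> set w"
  shows "push r' x w = map swap (push r x w)"
  using assms
proof (induction w arbitrary: x)
  case (Cons y w)
  have yx: "(y, x) \<notin> r" and sorted: "sorted_r (y # w)" "sorted_r (x # w)" using Cons.prems(1) by auto
  have x_ne: "x \<noteq> a" "x \<noteq> b" using Cons.prems(4) Cons.prems(3) not_ba by blast+
  have y_ne: "y \<noteq> b" using Cons.prems(5) sorted(1) Cons.prems(2) ab by auto
  have dist: "distinct (y # w)" "distinct (x # w)" using Cons.prems(2) by auto
  have bw: "b \<in> set w" using Cons.prems(6) y_ne by simp
  show ?case
  proof (cases "y = a")
    case True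
    have "push r' x (y # w) = x # push r' a w" using Cons.prems(3,4) True ab x_ne by auto
    also have "push r' a w = map swap (push r a w)"
      using sorted(1) dist(1) bw True by (intro push_a) simp_all
    finally show ?thesis using Cons.prems(3) True swap_other x_ne by simp
  next
    case False
    then have aw: "a \<in> set w" using Cons.prems(5) by simp
    show ?thesis
    proof (cases "(x, y) \<in> r")
      case True
      have "(a, y) \<notin> r" using aw sorted(1) by simp
      then have "(y, a) \<in> r" using through[OF Cons.prems(3,4) True] by blast
      then have "push r' y w = map swap (push r y w)"
        by (rule Cons.IH[OF sorted(1) dist(1) _ False aw bw])
      then show ?thesis using True x_ne swap_other by simp
    next
      case xy: False
      then show ?thesis
        using yx Cons.IH[OF sorted(2) dist(2) Cons.prems(3,4) aw bw] swap_other[OF False y_ne] by simp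
    qed
  qed
qed simp

section \<open>The two-state machine\<close>

abbreviation "L \<equiv> lin_exts_on r (Field r)"

text \<open>
  The two-state machine: \<open>act e w\<close> is a linear extension of \<open>r'\<close> whose state \<open>e\<close> tells whether \<open>a\<close> and
  \<open>b\<close> are exchanged; promoting \<open>x\<close> in it promotes \<open>letter e x\<close> in \<open>w\<close> and may flip the state.
\<close>

definition flips :: "'a \<Rightarrow> bool" where "flips x \<longleftrightarrow> (x, a) \<in> r"

definition act :: "bool \<Rightarrow> 'a list \<Rightarrow> 'a list" where "act e w = (if e then map swap w else w)"

definition letter :: "bool \<Rightarrow> 'a \<Rightarrow> 'a" where "letter e x = (if e then swap x else x)"

lemma b_after_a:
  assumes "sorted_r (u @ a # v)" "b \<in> set (u @ a # v)"
  shows "b \<in> set v" "b \<notin> set u"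
  using assms ab by (auto simp: sorted_wrt_append)

text \<open>If \<open>x\<close> is at most \<open>a\<close>, neither twin stands before
  \<open>x\<close>, so the prefix is unaffected by the exchange that the push lemmas produce. In all
  other cases \<open>a\<close> is never carried.\<close>

lemma promote_eq:
  assumes w: "w \<in> L" and x: "x \<in> Field r"
  shows "promote r' x w = act (flips x) (promote r x w)"
proof -
  have d: "distinct w" and set_w: "set w = Field r" and srt: "sorted_r w"
    using w by (auto simp: lin_exts_on_def)
  obtain u v where uv: "w = u @ x # v" using x set_w by (metis split_list)
  have xu: "x \<notin> set u" using d uv by simp
  have p: "promote q x w = u @ push q x v" for q
    unfolding uv by (rule promote_append_Cons[OF xu])
  have srt_v: "sorted_r (x # v)" "distinct (x # v)" using srt d by (auto simp: uv sorted_wrt_append)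
  show ?thesis
  proof (cases "flips x")
    case False
    then have "x = b \<or> (x, b) \<notin> r"
      using below_twins[of x] refl_r Field_r by (auto simp: flips_def)
    then show ?thesis using False push_eq[OF srt_v(1)] by (simp add: p act_def)
  next
    case True
    then have xa: "(x, a) \<in> r" by (simp add: flips_def)
    have "a \<notin> set u" using xa srt d by (auto simp: uv sorted_wrt_append)
    moreover have "b \<notin> set u"
    proof
      assume "b \<in> set u"
      then have "(x, b) \<notin> r" using srt by (auto simp: uv sorted_wrt_append)
      then show False using trans_r[OF xa ab(1)] by blast
    qed
    ultimately have u: "map swap u = u" by (rule map_swap_other)
    have "push r' x v = map swap (push r x v)"
    proof (cases "x = a")
      case x_a: True
      have "sorted_r (u @ a # v)" "b \<in> set (u @ a # v)"
        using srt Field_r(2) unfolding set_w[symmetric] uv x_a by blast+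
      then have "b \<in> set v" by (rule b_after_a(1))
      then show ?thesis using push_a srt_v x_a by simp
    next
      case False
      have "x \<noteq> b" using xa not_ba by blast
      then have "a \<in> set v" "b \<in> set v"
        using Field_r set_w \<open>a \<notin> set u\<close> \<open>b \<notin> set u\<close> False by (auto simp: uv)
      then show ?thesis by (rule push_below[OF srt_v xa False])
    qed
    then show ?thesis using True u by (simp add: p act_def)
  qed
qed

lemma letter_Field: "x \<in> Field r \<Longrightarrow> letter e x \<in> Field r"
  using Field_r by (auto simp: letter_def swap_def)

lemma promote_act:
  assumes w: "w \<in> L" and x: "x \<in> Field r"
  shows "promote r' x (act e w) = act (e \<noteq> flips (letter e x)) (promote r (letter e x) w)"
proof (cases e)
  case True
  have "promote r' x (map swap w) = map swap (promote r' (swap x) w)"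
    using promote_map_swap[of "swap x" w] by (simp only: swap_swap)
  then show ?thesis
    using promote_eq[OF w letter_Field[OF x, of True]] True by (auto simp: act_def letter_def)
next
  case False
  then show ?thesis using promote_eq[OF w x] by (simp add: act_def letter_def)
qed

fun transduce :: "bool \<Rightarrow> 'a list \<Rightarrow> 'a list" where
  "transduce e [] = []"
| "transduce e (x # v) = letter e x # transduce (e \<noteq> flips (letter e x)) v"

fun end_state :: "bool \<Rightarrow> 'a list \<Rightarrow> bool" where
  "end_state e [] = e"
| "end_state e (x # v) = end_state (e \<noteq> flips (letter e x)) v"

lemma fold_promote_act:
  assumes "w \<in> L" "set v \<subseteq> Field r"
  shows "fold (promote r') v (act e w) = act (end_state e v) (fold (promote r) (transduce e v) w)"
  using assms
proof (induction v arbitrary: e w)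
  case (Cons x v)
  then show ?case
    using Cons.IH[OF promote_lin_exts_on[OF Cons.prems(1)]] by (simp add: promote_act)
qed simp

lemma set_transduce: "set v \<subseteq> Field r \<Longrightarrow> set (transduce e v) \<subseteq> Field r"
  by (induction v arbitrary: e) (auto simp: letter_Field)

lemma sorted_map_swap: "sorted_wrt (\<lambda>x y. (y, x) \<notin> r') (map swap w) \<longleftrightarrow> sorted_wrt (\<lambda>x y. (y, x) \<notin> r') w"
  unfolding sorted_wrt_map by (simp only: swap_r')

lemma swap_image_Field: "swap ` Field r = Field r"
proof -
  have "swap ` Field r \<subseteq> Field r" using Field_r by (auto simp: swap_def)
  then have "swap ` swap ` Field r \<subseteq> swap ` Field r" by (rule image_mono)
  then show ?thesis using \<open>swap ` Field r \<subseteq> Field r\<close> by (simp add: image_comp comp_def)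
qed

lemma sorted_r'_cases:
  assumes "sorted_wrt (\<lambda>x y. (y, x) \<notin> r') w" "distinct w"
  shows "sorted_r w \<or> sorted_r (map swap w)"
proof (cases "sorted_wrt (\<lambda>x y. (y, x) \<noteq> (a, b)) w")
  case True
  have "sorted_wrt (\<lambda>x y. (y, x) \<notin> r' \<and> (y, x) \<noteq> (a, b)) w"
    using assms(1) True by (rule sorted_wrt_conj)
  then have "sorted_r w" by (rule sorted_wrt_mono_rel[rotated]) blast
  then show ?thesis ..
next
  case False
  then have ba: "\<exists>u v z. w = u @ b # v @ a # z"
    by (induction w) (auto, metis append_Cons append_Nil split_list, metis append_Cons)
  have no_b: "sorted_wrt (\<lambda>x y. y = b \<longrightarrow> x \<noteq> a) l" if "b \<notin> set l" for l
    using that by (induction l) auto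
  from ba have "sorted_wrt (\<lambda>x y. y = b \<longrightarrow> x \<noteq> a) w"
    using assms(2) ab by (auto simp: sorted_wrt_append no_b)
  then have "sorted_wrt (\<lambda>x y. (swap y, swap x) \<noteq> (a, b)) w"
    by (rule sorted_wrt_mono_rel[rotated]) (auto simp: swap_def split: if_splits)
  then have "sorted_wrt (\<lambda>x y. (y, x) \<noteq> (a, b)) (map swap w)" by (simp add: sorted_wrt_map)
  moreover have "sorted_wrt (\<lambda>x y. (y, x) \<notin> r') (map swap w)" using assms(1) by (simp only: sorted_map_swap)
  ultimately have "sorted_wrt (\<lambda>x y. (y, x) \<notin> r' \<and> (y, x) \<noteq> (a, b)) (map swap w)"
    using sorted_wrt_conj by fast
  then have "sorted_r (map swap w)" by (rule sorted_wrt_mono_rel[rotated]) blast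
  then show ?thesis ..
qed

lemma L'_eq: "lin_exts_on r' (Field r') = act False ` L \<union> act True ` L"
proof (intro equalityI subsetI)
  fix w assume "w \<in> lin_exts_on r' (Field r')"
  then have w: "distinct w" "set w = Field r" "sorted_wrt (\<lambda>x y. (y, x) \<notin> r') w"
    unfolding Field_r' by (auto simp: lin_exts_on_def)
  have ms: "distinct (map swap w)" "set (map swap w) = Field r"
    using w(1,2) swap_image_Field by (auto simp: distinct_map inj_on_def)
  from sorted_r'_cases[OF w(3,1)] have "w \<in> L \<or> map swap w \<in> L"
    using w(1,2) ms by (simp add: lin_exts_on_def)
  moreover have "w = act False w" "w = act True (map swap w)" by (simp_all add: act_def)
  ultimately show "w \<in> act False ` L \<union> act True ` L" by blast
next
  have sub: "sorted_wrt (\<lambda>x y. (y, x) \<notin> r') w" if "sorted_r w" for w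
    using that by (rule sorted_wrt_mono_rel[rotated]) blast
  fix w assume "w \<in> act False ` L \<union> act True ` L"
  then obtain w' where w': "w' \<in> L" "w = w' \<or> w = map swap w'" by (auto simp: act_def)
  then have "distinct w" "set w = Field r" "sorted_wrt (\<lambda>x y. (y, x) \<notin> r') w"
    using sub[of w'] sorted_map_swap[of w'] swap_image_Field
    by (auto simp: lin_exts_on_def distinct_map inj_on_def)
  then show "w \<in> lin_exts_on r' (Field r')"
    unfolding Field_r' by (simp add: lin_exts_on_def)
qed

text \<open>Exchanging the twins puts \<open>b\<close> before \<open>a\<close>, which
  \<open>r\<close> forbids; the two copies of \<open>L\<close> are therefore disjoint.\<close>

lemma act_inj:
  assumes "w \<in> L" "w' \<in> L"
  shows "act e w = act e' w' \<longleftrightarrow> e = e' \<and> w = w'"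
proof -
  have ne: "map swap x \<noteq> y" if x: "x \<in> L" and y: "y \<in> L" for x y
  proof
    assume xy: "map swap x = y"
    have sx: "sorted_r x" "distinct x" and "a \<in> set x" "b \<in> set x"
      using x Field_r by (auto simp: lin_exts_on_def)
    then obtain u v where uv: "x = u @ a # v" by (meson split_list)
    have "b \<in> set v" using sx(1) \<open>b \<in> set x\<close> unfolding uv by (rule b_after_a(1))
    then have "a \<in> swap ` set v" by (metis image_eqI swap_b)
    moreover have "sorted_r (map swap x)" using y xy by (simp add: lin_exts_on_def)
    then have "\<forall>z\<in>set (map swap v). (z, swap a) \<notin> r"
      unfolding uv map_append list.map sorted_wrt_append sorted_wrt.simps by blast
    ultimately show False using ab by auto
  qed
  have "map swap w = map swap w' \<longleftrightarrow> w = w'" by (metis map_swap_swap)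
  then show ?thesis using ne[OF assms] ne[OF assms(2,1)] by (auto simp: act_def)
qed

text \<open>A fixed word must return to its state as well as to its underlying linear extension of
  \<open>r\<close>; the two conditions separate by \<open>act_inj\<close>.\<close>

lemma card_fixed_points_r':
  assumes v: "set v \<subseteq> Field r"
  shows "card (fixed_points r' v) = (\<Sum>e\<in>UNIV. if end_state e v = e then card (fixed_points r (transduce e v)) else 0)"
proof -
  have fin_fp: "finite (fixed_points r u)" for u by (simp add: fixed_points_def fin)
  define A where "A e = (if end_state e v = e then act e ` fixed_points r (transduce e v) else {})" for e
  have fix_iff: "fold (promote r') v (act e w) = act e w \<longleftrightarrow>
      end_state e v = e \<and> fold (promote r) (transduce e v) w = w" if "w \<in> L" for e w
    unfolding fold_promote_act[OF that v]
    by (rule act_inj[OF fold_promote_lin_exts_on[OF that] that])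
  have "fixed_points r' v = A False \<union> A True"
  proof (intro equalityI subsetI)
    fix w assume "w \<in> fixed_points r' v"
    then obtain e w' where w': "w' \<in> L" "w = act e w'" "fold (promote r') v w = w"
      unfolding fixed_points_def L'_eq by blast
    then have "w \<in> A e" using fix_iff[OF w'(1)] by (auto simp: A_def fixed_points_def)
    then show "w \<in> A False \<union> A True" by (cases e) simp_all
  next
    fix w assume "w \<in> A False \<union> A True"
    then obtain e where "w \<in> A e" by blast
    then obtain w' where w': "end_state e v = e" "w' \<in> fixed_points r (transduce e v)" "w = act e w'"
      by (auto simp: A_def split: if_splits)
    then have "w' \<in> L" "fold (promote r') v w = w"
      using fix_iff by (auto simp: fixed_points_def)
    moreover have "w \<in> act False ` L \<union> act True ` L" using \<open>w' \<in> L\<close> w'(3) by (cases e) auto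
    ultimately show "w \<in> fixed_points r' v" unfolding fixed_points_def L'_eq by simp
  qed
  moreover have "A False \<inter> A True = {}"
    using act_inj by (auto simp: A_def fixed_points_def)
  moreover have "finite (A e)" for e using fin_fp by (simp add: A_def)
  ultimately have "card (fixed_points r' v) = card (A False) + card (A True)"
    by (simp add: card_Un_disjoint)
  moreover have "card (A e) = (if end_state e v = e then card (fixed_points r (transduce e v)) else 0)" for e
  proof -
    have "inj_on (act e) (fixed_points r (transduce e v))"
      using act_inj by (auto simp: inj_on_def fixed_points_def)
    then show ?thesis by (simp add: A_def card_image)
  qed
  ultimately show ?thesis by (simp add: UNIV_bool)
qed

text \<open>If \<open>c a = c b\<close>, products along emitted words do not depend on the state,
  and only the number of returning states matters. In the other case \<open>c\<close> vanishes on
  every letter that flips, so only runs of constant state contribute.\<close>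

definition compatible :: "('a \<Rightarrow> int) \<Rightarrow> bool" where
  "compatible c \<longleftrightarrow> c a = c b \<or> c a = 0 \<and> (\<forall>k. (k, a) \<in> r \<longrightarrow> c k = 0)"

abbreviation sgn_state :: "bool \<Rightarrow> int" where "sgn_state e \<equiv> (if e then -1 else 1)"

text \<open>\<open>c\<close> times a sign: a letter below \<open>a\<close> exchanges the two states
  (-1), the letters \<open>a\<close> and \<open>b\<close> each send both states to one (0), and the
  remaining letters keep them (1).\<close>

definition reflected :: "('a \<Rightarrow> int) \<Rightarrow> 'a \<Rightarrow> int" where
  "reflected c k = (if (k, b) \<notin> r then c k else 0) - (if (k, a) \<in> r \<and> k \<noteq> a then c k else 0)"

lemma prod_transduce_eq:
  assumes "c a = c b"
  shows "prod_list (map c (transduce e v)) = prod_list (map c v)"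
proof -
  have "c (letter e x) = c x" for e x using assms by (simp add: letter_def swap_def)
  then show ?thesis by (induction v arbitrary: e) simp_all
qed

text \<open>For a map of two states let e be 1, -1 or 0 according as it is the identity, the
  exchange or constant. Then e is multiplicative, and the difference of the signs of the two images
  is 2 e; the lemma evaluates e on the word \<open>v\<close>.\<close>

lemma sgn_state_sum:
  "prod_list (map c v) * (sgn_state (end_state False v) - sgn_state (end_state True v))
    = 2 * prod_list (map (reflected c) v)"
proof (induction v)
  case (Cons x v)
  have aa: "(a, a) \<in> r" "(b, b) \<in> r" using Field_r refl_r by blast+
  consider "x = a" | "x = b" | "x \<noteq> a" "x \<noteq> b" "(x, a) \<in> r" | "x \<noteq> a" "x \<noteq> b" "(x, a) \<notin> r" by blast
  then show ?case
  proof cases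
    case 1
    then show ?thesis using aa ab not_ba by (simp add: letter_def flips_def reflected_def)
  next
    case 2
    then show ?thesis using aa ab not_ba by (simp add: letter_def flips_def reflected_def)
  next
    case 3
    have "reflected c x = - c x" "(x, b) \<in> r" using 3 below_twins[of x] by (simp_all add: reflected_def)
    then show ?thesis using 3 Cons.IH by (simp add: letter_def flips_def swap_other algebra_simps)
  next
    case 4
    have "reflected c x = c x" using 4 below_twins[of x] by (simp add: reflected_def)
    then show ?thesis using 4 Cons.IH by (simp add: letter_def flips_def swap_other algebra_simps)
  qed
qed simp

text \<open>A run that changes its state emits a letter up to \<open>a\<close>, where
  \<open>c\<close> vanishes. Otherwise the state is constant, so the run returns and every letter is
  translated by the same \<open>letter e\<close>.\<close>

lemma prod_transduce_zero:
  fixes c :: "'a \<Rightarrow> int"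
  assumes "c a = 0" "\<forall>k. (k, a) \<in> r \<longrightarrow> c k = 0"
  shows "(if end_state e v = e then prod_list (map c (transduce e v)) else 0)
    = prod_list (map (\<lambda>x. c (letter e x)) v)"
proof (induction v)
  case (Cons x v)
  show ?case
  proof (cases "flips (letter e x)")
    case True
    then have "c (letter e x) = 0" using assms(2) by (simp add: flips_def)
    then show ?thesis by simp
  next
    case False
    then have "(e \<noteq> flips (letter e x)) = e" by simp
    then show ?thesis using Cons.IH by auto
  qed
qed simp

lemma sum_transduce:
  fixes c :: "'a \<Rightarrow> int"
  assumes "compatible c"
  shows "(\<Sum>e\<in>UNIV. if end_state e v = e then prod_list (map c (transduce e v)) else 0) =
    (if c a = c b then prod_list (map c v) + prod_list (map (reflected c) v)
     else prod_list (map c v) + prod_list (map (\<lambda>x. c (swap x)) v))"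
proof (cases "c a = c b")
  case True
  \<comment> \<open>Twice the number of returning states is 2 plus the sign of the image of
    \<open>False\<close> minus that of the image of \<open>True\<close>.\<close>
  have "2 * (\<Sum>e\<in>UNIV. if end_state e v = e then prod_list (map c v) else 0)
      = 2 * prod_list (map c v)
        + prod_list (map c v) * (sgn_state (end_state False v) - sgn_state (end_state True v))"
    by (simp add: UNIV_bool algebra_simps)
  then show ?thesis using True sgn_state_sum[of c v] by (simp add: prod_transduce_eq[OF True] cong: if_cong)
next
  case False
  then have "c a = 0" "\<forall>k. (k, a) \<in> r \<longrightarrow> c k = 0" using assms by (auto simp: compatible_def)
  from prod_transduce_zero[OF this] show ?thesis
    using False by (simp add: UNIV_bool letter_def)
qed

end

lemma character_sum_replace_form:
  fixes r :: "nat rel"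
  assumes "twin_levels r a b" "twin_levels.compatible r a b c"
  shows "character_sum (replace_form r a b c) v
    = (\<Sum>e\<in>UNIV. if twin_levels.end_state r a b e v = e
        then prod_list (map c (twin_levels.transduce r a b e v)) else 0)"
proof -
  interpret twin_levels r a b by fact
  have refl_eq: "reflected c = (\<lambda>k. (if (k, b) \<notin> r then c k else 0) - (if (k, a) \<in> r \<and> k \<noteq> a then c k else 0))"
    by (simp add: reflected_def fun_eq_iff)
  show ?thesis
  proof (cases "c a = c b")
    case True
    then have "replace_form r a b c = {#c, reflected c#}"
      unfolding replace_form_def refl_eq by auto
    then show ?thesis using True assms(2) by (simp add: sum_transduce character_sum_def)
  next
    case False
    then have "c a = 0" "c b \<noteq> 0" using assms(2) by (auto simp: compatible_def)
    moreover from this have "(\<lambda>k. c k - (if k = b then c b else 0) + (if k = a then c b else 0)) = (\<lambda>k. c (swap k))"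
      using ab by (auto simp: swap_def fun_eq_iff)
    ultimately have "replace_form r a b c = {#c, \<lambda>k. c (swap k)#}"
      by (simp add: replace_form_def)
    then show ?thesis using False assms(2) by (simp add: sum_transduce character_sum_def)
  qed
qed

text \<open>Here the hypothesis is needed for all words: it is evaluated at the two words emitted
  for \<open>v\<close>. The rest is linearity in \<open>E\<close>.\<close>

theorem fixed_points_split_level:
  fixes r :: "nat rel"
  assumes tw: "twin_levels r a b" and E: "\<And>c. c \<in># E \<Longrightarrow> twin_levels.compatible r a b c"
    and fp: "\<And>v. set v \<subseteq> Field r \<Longrightarrow> int (card (fixed_points r v)) = character_sum E v"
    and v: "set v \<subseteq> Field r"
  shows "int (card (fixed_points (r - {(a, b)}) v)) = character_sum (\<Sum>c\<in>#E. replace_form r a b c) v"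
proof -
  interpret twin_levels r a b by fact
  have sum_E: "character_sum (\<Sum>c\<in>#D. replace_form r a b c) v
      = (\<Sum>e\<in>UNIV. if end_state e v = e then character_sum D (transduce e v) else 0)"
    if "\<And>c. c \<in># D \<Longrightarrow> compatible c" for D
    using that
  proof (induction D)
    case empty
    then show ?case by (simp add: character_sum_def cong: if_cong)
  next
    case (add c D)
    have "character_sum (\<Sum>c\<in>#add_mset c D. replace_form r a b c) v
        = character_sum (replace_form r a b c) v + character_sum (\<Sum>c\<in>#D. replace_form r a b c) v"
      by (simp add: character_sum_def)
    also have "\<dots> = (\<Sum>e\<in>UNIV. if end_state e v = e then prod_list (map c (transduce e v)) else 0)
        + (\<Sum>e\<in>UNIV. if end_state e v = e then character_sum D (transduce e v) else 0)"
      using add by (simp add: character_sum_replace_form[OF tw])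
    also have "\<dots> = (\<Sum>e\<in>UNIV. if end_state e v = e then character_sum (add_mset c D) (transduce e v) else 0)"
      by (simp add: character_sum_def UNIV_bool)
    finally show ?case .
  qed
  have "int (card (fixed_points r' v)) =
      (\<Sum>e\<in>UNIV. if end_state e v = e then int (card (fixed_points r (transduce e v))) else 0)"
    unfolding card_fixed_points_r'[OF v] by (simp add: UNIV_bool)
  also have "\<dots> = (\<Sum>e\<in>UNIV. if end_state e v = e then character_sum E (transduce e v) else 0)"
    by (simp only: fp[OF set_transduce[OF v]])
  also have "\<dots> = character_sum (\<Sum>c\<in>#E. replace_form r a b c) v"
    by (rule sum_E[OF E, symmetric])
  finally show ?thesis .
qed

section \<open>Rooted forests and ladders\<close>

lemma finite_poset_iff:
  "finite_poset r \<longleftrightarrow> finite (Field r) \<and> (\<forall>x\<in>Field r. (x, x) \<in> r) \<and> trans r \<and> antisym r"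
  by (auto simp: finite_poset_def partial_order_on_def preorder_on_def refl_on_def intro: FieldI1 FieldI2)

lemma Field_UN: "Field (\<Union>i\<in>I. R i) = (\<Union>i\<in>I. Field (R i))"
  by (auto simp: Field_def)

lemma disjoint_Fields_eq:
  assumes "disjoint_family_on (\<lambda>i. Field (R i)) I" "i \<in> I" "j \<in> I" "x \<in> Field (R i)" "x \<in> Field (R j)"
  shows "i = j"
  using assms by (auto simp: disjoint_family_on_def)

lemma finite_poset_disjoint_union:
  assumes I: "finite I" and R: "\<And>i. i \<in> I \<Longrightarrow> finite_poset (R i)"
    and disj: "disjoint_family_on (\<lambda>i. Field (R i)) I"
  shows "finite_poset (\<Union>i\<in>I. R i)"
proof -
  note R' = R[unfolded finite_poset_iff]
  note eq = disjoint_Fields_eq[OF disj]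
  have "trans (\<Union>i\<in>I. R i)"
  proof (rule transI)
    fix x y z assume "(x, y) \<in> (\<Union>i\<in>I. R i)" "(y, z) \<in> (\<Union>i\<in>I. R i)"
    then obtain i j where ij: "i \<in> I" "j \<in> I" "(x, y) \<in> R i" "(y, z) \<in> R j" by blast
    then have "i = j" by (intro eq[of i j y]) (auto intro: FieldI1 FieldI2)
    then have "(x, z) \<in> R i" using ij R'[of i] by (auto dest: transD)
    then show "(x, z) \<in> (\<Union>i\<in>I. R i)" using ij by blast
  qed
  moreover have "antisym (\<Union>i\<in>I. R i)"
  proof (rule antisymI)
    fix x y assume "(x, y) \<in> (\<Union>i\<in>I. R i)" "(y, x) \<in> (\<Union>i\<in>I. R i)"
    then obtain i j where ij: "i \<in> I" "j \<in> I" "(x, y) \<in> R i" "(y, x) \<in> R j" by blast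
    then have "i = j" by (intro eq[of i j y]) (auto intro: FieldI1 FieldI2)
    then show "x = y" using ij R'[of i] by (auto dest: antisymD)
  qed
  moreover have "\<forall>x\<in>Field (\<Union>i\<in>I. R i). (x, x) \<in> (\<Union>i\<in>I. R i)"
    using R' unfolding Field_UN by fast
  ultimately show ?thesis
    unfolding finite_poset_iff using I R' by (simp add: Field_UN)
qed

text \<open>Induction upwards: the unique cover of \<open>x\<close> lies below both \<open>y\<close>
  and \<open>z\<close>, unless one of them is \<open>x\<close>, and it has fewer elements above
  it.\<close>

lemma rooted_tree_chain:
  assumes t: "rooted_tree t" and "(x, y) \<in> t" "(x, z) \<in> t"
  shows "(y, z) \<in> t \<or> (z, y) \<in> t"
proof -
  interpret fin_poset t using t by (simp add: fin_poset_def rooted_tree_def)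
  have cover: "\<exists>c. covered_by t x c \<and> (c, y) \<in> t" if xy: "(x, y) \<in> t" "x \<noteq> y" for x y
  proof -
    let ?A = "{w. (x, w) \<in> t \<and> w \<noteq> x \<and> (w, y) \<in> t}"
    have "finite ?A" by (rule finite_subset[OF _ fin]) (auto intro: FieldI2)
    moreover have "y \<in> ?A" using xy refl_r[OF FieldI2[OF xy(1)]] by simp
    ultimately obtain c where c: "c \<in> ?A" "\<forall>w\<in>?A. (w, c) \<in> t \<longrightarrow> w = c"
      using minimal[of ?A] by blast
    have "z = x \<or> z = c" if "(x, z) \<in> t" "(z, c) \<in> t" for z
      using c that trans_r[of z c y] by blast
    then have "covered_by t x c" using c(1) by (auto simp: covered_by_def)
    then show ?thesis using c(1) by blast
  qed
  show ?thesis
    using assms(2,3)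
  proof (induction "card {w. (x, w) \<in> t}" arbitrary: x rule: less_induct)
    case less
    show ?case
    proof (cases "x = y \<or> x = z")
      case True
      then show ?thesis using less.prems by blast
    next
      case False
      obtain c where c: "covered_by t x c" "(c, y) \<in> t" using cover[OF less.prems(1)] False by blast
      obtain d where d: "covered_by t x d" "(d, z) \<in> t" using cover[OF less.prems(2)] False by blast
      have "c = d" using t c(1) d(1) unfolding rooted_tree_def by blast
      have xc: "(x, c) \<in> t" "x \<noteq> c" using c(1) by (auto simp: covered_by_def)
      have xx: "(x, x) \<in> t" using refl_r FieldI1 xc(1) by fast
      have "{w. (c, w) \<in> t} \<subseteq> {w. (x, w) \<in> t}" using trans_r[OF xc(1)] by blast
      moreover have "x \<notin> {w. (c, w) \<in> t}" using antisym_r[OF xc(1)] xc(2) by blast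
      ultimately have "{w. (c, w) \<in> t} \<subset> {w. (x, w) \<in> t}" using xx by blast
      moreover have "finite {w. (x, w) \<in> t}" by (rule finite_subset[OF _ fin]) (auto intro: FieldI2)
      ultimately have "card {w. (c, w) \<in> t} < card {w. (x, w) \<in> t}" by (rule psubset_card_mono[rotated])
      then show ?thesis using less.hyps c(2) d(2) \<open>c = d\<close> by blast
    qed
  qed
qed

lemma rooted_forest_imp_forest:
  assumes "rooted_forest F" shows "forest F"
proof -
  obtain T where T: "finite T" "\<And>t. t \<in> T \<Longrightarrow> rooted_tree t" "disjoint_family_on Field T"
    and F: "F = (\<Union>t\<in>T. t)"
    using assms by (auto simp: rooted_forest_def)
  have "finite_poset F"
    unfolding F using T by (intro finite_poset_disjoint_union) (simp_all add: rooted_tree_def)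
  moreover have "(y, z) \<in> F \<or> (z, y) \<in> F" if xyz: "(x, y) \<in> F" "(x, z) \<in> F" for x y z
  proof -
    obtain t u where tu: "t \<in> T" "u \<in> T" "(x, y) \<in> t" "(x, z) \<in> u" using xyz unfolding F by blast
    then have "t = u" by (intro disjoint_Fields_eq[OF T(3), of t u x]) (auto intro: FieldI1)
    then show ?thesis using rooted_tree_chain[OF T(2)[OF tu(1)]] tu unfolding F by blast
  qed
  ultimately show ?thesis by (simp add: forest_def fin_poset_def forest_axioms_def)
qed

context forest
begin

definition tree_below :: "'a \<Rightarrow> 'a rel" where "tree_below m = {(u, v) \<in> r. (u, m) \<in> r}"

definition roots :: "'a set" where "roots = {m \<in> Field r. \<forall>z. (m, z) \<in> r \<longrightarrow> z = m}"

lemma tree_below_iff: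
  assumes "m \<in> roots" shows "(u, v) \<in> tree_below m \<longleftrightarrow> (u, v) \<in> r \<and> (u, m) \<in> r \<and> (v, m) \<in> r"
proof -
  have "(v, m) \<in> r" if "(u, v) \<in> r" "(u, m) \<in> r"
    using chain[OF that] assms by (auto simp: roots_def)
  then show ?thesis by (auto simp: tree_below_def)
qed

lemma Field_tree_below:
  assumes "m \<in> roots" shows "Field (tree_below m) = {u. (u, m) \<in> r}"
proof (intro equalityI subsetI)
  fix u assume "u \<in> {u. (u, m) \<in> r}"
  then have "(u, u) \<in> tree_below m" using refl_r FieldI1 by (fastforce simp: tree_below_iff[OF assms])
  then show "u \<in> Field (tree_below m)" by (rule FieldI1)
qed (auto simp: Field_def tree_below_iff[OF assms])

lemma rooted_tree_below:
  assumes m: "m \<in> roots" shows "rooted_tree (tree_below m)"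
proof -
  note [simp] = tree_below_iff[OF m]
  have F: "Field (tree_below m) = {u. (u, m) \<in> r}" by (rule Field_tree_below[OF m])
  have refl: "(u, u) \<in> r" if "(u, m) \<in> r" for u using that refl_r FieldI1 by fast
  have mm: "(m, m) \<in> r" using m refl_r by (simp add: roots_def)
  have "finite_poset (tree_below m)"
    unfolding finite_poset_iff F
  proof (intro conjI)
    show "finite {u. (u, m) \<in> r}" by (rule finite_subset[OF _ fin]) (auto intro: FieldI1)
    show "trans (tree_below m)" by (rule transI) (auto intro: trans_r)
    show "antisym (tree_below m)" by (rule antisymI) (auto intro: antisym_r)
  qed (simp add: refl)
  moreover have "(x, y) \<in> (tree_below m \<union> (tree_below m)\<inverse>)\<^sup>*" if "(x, m) \<in> r" "(y, m) \<in> r" for x y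
  proof -
    have "(x, m) \<in> tree_below m" "(m, y) \<in> (tree_below m)\<inverse>" using that mm by simp_all
    then show ?thesis by (meson UnI1 UnI2 r_into_rtrancl rtrancl_trans)
  qed
  then have "connected_poset (tree_below m)"
    unfolding connected_poset_def F using mm by auto
  moreover have "y = z" if "covered_by (tree_below m) x y" "covered_by (tree_below m) x z" for x y z
  proof -
    have "(x, y) \<in> r" "(x, z) \<in> r" using that by (simp_all add: covered_by_def)
    from chain[OF this] show ?thesis using that unfolding covered_by_def by fastforce
  qed
  ultimately show ?thesis unfolding rooted_tree_def by blast
qed

text \<open>The components are the principal downsets of the maximal elements, each connected
  through its root. An element common to two of them would make the roots comparable.\<close>

lemma rooted_forest: "rooted_forest r"
  unfolding rooted_forest_def
proof (intro exI conjI ballI)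
  show "finite (tree_below ` roots)"
    using fin by (simp add: roots_def)
  show "rooted_tree t" if "t \<in> tree_below ` roots" for t
    using that rooted_tree_below by blast
  show "disjoint_family_on Field (tree_below ` roots)"
    unfolding disjoint_family_on_def
  proof (intro ballI impI)
    fix t u assume "t \<in> tree_below ` roots" "u \<in> tree_below ` roots" "t \<noteq> u"
    then obtain m p where mp: "m \<in> roots" "p \<in> roots" "t = tree_below m" "u = tree_below p" "m \<noteq> p" by blast
    have "False" if "(x, m) \<in> r" "(x, p) \<in> r" for x
      using chain[OF that] mp(1,2,5) unfolding roots_def by blast
    then show "Field t \<inter> Field u = {}"
      unfolding mp(3,4) Field_tree_below[OF mp(1)] Field_tree_below[OF mp(2)] by blast
  qed
  show "r = \<Union> (tree_below ` roots)"
  proof (intro equalityI subrelI)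
    fix x y assume xy: "(x, y) \<in> r"
    let ?A = "{z. (x, z) \<in> r}"
    have "finite ?A" by (rule finite_subset[OF _ fin]) (auto intro: FieldI2)
    then obtain m where m: "m \<in> ?A" "\<forall>z\<in>?A. (m, z) \<in> r \<longrightarrow> z = m"
      using maximal[of ?A] xy by blast
    have "z = m" if "(m, z) \<in> r" for z using m that trans_r[of x m z] by blast
    then have "m \<in> roots" using m(1) FieldI2[of x m r] by (auto simp: roots_def)
    moreover have "(x, y) \<in> tree_below m" using xy m(1) by (simp add: tree_below_def)
    ultimately show "(x, y) \<in> \<Union> (tree_below ` roots)" by blast
  qed (auto simp: tree_below_def)
qed

end

section \<open>Ladders, by induction on the levels from the bottom\<close>

lemma ladder_Nil [simp]: "ladder [] = {}"
  by (simp add: ladder_def)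

lemma Field_ordinal_sum: "Field (p \<oplus>\<^sub>o q) = Field p \<union> Field q"
  by (auto simp: ordinal_sum_def Field_def)

lemma ladder_Cons: "ladder (Q # Qs) = Id_on Q \<oplus>\<^sub>o ladder Qs"
  by (simp add: ladder_def)

lemma Field_ladder: "Field (ladder Qs) = \<Union> (set Qs)"
  by (induction Qs) (auto simp: ladder_Cons Field_ordinal_sum, auto simp: Field_def)

lemma ladder_levels_Cons:
  assumes "ladder_levels (Q # Qs)"
  shows "card Q = 1 \<or> card Q = 2" "ladder_levels Qs" "Q \<inter> \<Union> (set Qs) = {}"
proof -
  have disj: "\<And>i j. \<lbrakk>i < length (Q # Qs); j < length (Q # Qs); i \<noteq> j\<rbrakk> \<Longrightarrow> (Q # Qs) ! i \<inter> (Q # Qs) ! j = {}"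
    using assms unfolding ladder_levels_def disjoint_family_on_def by blast
  show "card Q = 1 \<or> card Q = 2" using assms by (simp add: ladder_levels_def)
  have "Qs ! i \<inter> Qs ! j = {}" if "i < length Qs" "j < length Qs" "i \<noteq> j" for i j
    using disj[of "Suc i" "Suc j"] that by simp
  then show "ladder_levels Qs"
    using assms unfolding ladder_levels_def disjoint_family_on_def by simp
  have "x \<notin> Qs ! j" if "j < length Qs" "x \<in> Q" for x j
    using disj[of 0 "Suc j"] that by auto
  then show "Q \<inter> \<Union> (set Qs) = {}" by (auto simp: in_set_conv_nth)
qed

lemma ordinal_sum_iff: "(x, y) \<in> p \<oplus>\<^sub>o q \<longleftrightarrow> (x, y) \<in> p \<or> (x, y) \<in> q \<or> x \<in> Field p \<and> y \<in> Field q"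
  by (auto simp: ordinal_sum_def)

lemma finite_poset_ordinal_sum:
  assumes p: "finite_poset p" and q: "finite_poset q" and disj: "Field p \<inter> Field q = {}"
  shows "finite_poset (p \<oplus>\<^sub>o q)"
proof -
  note p' = p[unfolded finite_poset_iff] and q' = q[unfolded finite_poset_iff]
  have pf: "(x, y) \<in> p \<Longrightarrow> x \<in> Field p \<and> y \<in> Field p" and qf: "(x, y) \<in> q \<Longrightarrow> x \<in> Field q \<and> y \<in> Field q" for x y
    by (auto intro: FieldI1 FieldI2)
  have pt: "\<lbrakk>(x, y) \<in> p; (y, z) \<in> p\<rbrakk> \<Longrightarrow> (x, z) \<in> p" and qt: "\<lbrakk>(x, y) \<in> q; (y, z) \<in> q\<rbrakk> \<Longrightarrow> (x, z) \<in> q" for x y z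
    using p' q' by (auto dest: transD)
  have pa: "\<lbrakk>(x, y) \<in> p; (y, x) \<in> p\<rbrakk> \<Longrightarrow> x = y" and qa: "\<lbrakk>(x, y) \<in> q; (y, x) \<in> q\<rbrakk> \<Longrightarrow> x = y" for x y
    using p' q' by (auto dest: antisymD)
  have "trans (p \<oplus>\<^sub>o q)"
  proof (rule transI, unfold ordinal_sum_iff)
    fix x y z
    assume "(x, y) \<in> p \<or> (x, y) \<in> q \<or> x \<in> Field p \<and> y \<in> Field q"
      "(y, z) \<in> p \<or> (y, z) \<in> q \<or> y \<in> Field p \<and> z \<in> Field q"
    then show "(x, z) \<in> p \<or> (x, z) \<in> q \<or> x \<in> Field p \<and> z \<in> Field q"
      using pf[of x y] pf[of y z] qf[of x y] qf[of y z] pt[of x y z] qt[of x y z] disj by blast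
  qed
  moreover have "antisym (p \<oplus>\<^sub>o q)"
  proof (rule antisymI, unfold ordinal_sum_iff)
    fix x y
    assume "(x, y) \<in> p \<or> (x, y) \<in> q \<or> x \<in> Field p \<and> y \<in> Field q"
      "(y, x) \<in> p \<or> (y, x) \<in> q \<or> y \<in> Field p \<and> x \<in> Field q"
    then show "x = y"
      using pf[of x y] pf[of y x] qf[of x y] qf[of y x] pa[of x y] qa[of x y] disj by blast
  qed
  ultimately show ?thesis
    using p' q' by (auto simp: finite_poset_iff Field_ordinal_sum ordinal_sum_iff)
qed

lemma Field_Id_on: "Field (Id_on Q) = Q"
  by (auto simp: Field_def)

lemma finite_poset_Id_on: "finite Q \<Longrightarrow> finite_poset (Id_on Q)"
  by (auto simp: finite_poset_iff Field_Id_on trans_def antisym_def)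

lemma ladder_Cons_iff:
  "(x, y) \<in> ladder (R # Qs) \<longleftrightarrow> x = y \<and> x \<in> R \<or> (x, y) \<in> ladder Qs \<or> x \<in> R \<and> y \<in> \<Union> (set Qs)"
  unfolding ladder_Cons ordinal_sum_iff Field_Id_on Field_ladder by auto

lemma ladder_in_Field:
  assumes "(x, y) \<in> ladder Qs" shows "x \<in> \<Union> (set Qs)" "y \<in> \<Union> (set Qs)"
  using FieldI1[OF assms] FieldI2[OF assms] by (simp_all add: Field_ladder)

lemma finite_poset_ladder: "ladder_levels Qs \<Longrightarrow> finite_poset (ladder Qs)"
proof (induction Qs)
  case Nil
  then show ?case by (simp add: finite_poset_iff)
next
  case (Cons R Qs)
  note lv = ladder_levels_Cons[OF Cons.prems]
  have "finite R" using lv(1) by (auto intro: card_ge_0_finite)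
  then show ?case
    unfolding ladder_Cons using Cons.IH[OF lv(2)] lv(3)
    by (intro finite_poset_ordinal_sum finite_poset_Id_on) (simp_all add: Field_Id_on Field_ladder)
qed

lemma ladder_total:
  "\<lbrakk>ladder_levels Qs; x \<in> \<Union> (set Qs); y \<in> \<Union> (set Qs)\<rbrakk>
    \<Longrightarrow> (x, y) \<in> ladder Qs \<or> (y, x) \<in> ladder Qs \<or> x \<noteq> y \<and> {x, y} \<in> set Qs"
proof (induction Qs)
  case (Cons R Qs)
  note lv = ladder_levels_Cons[OF Cons.prems(1)]
  consider "x \<in> R" "y \<in> R" | "x \<in> R" "y \<in> \<Union> (set Qs)" | "x \<in> \<Union> (set Qs)" "y \<in> R"
    | "x \<in> \<Union> (set Qs)" "y \<in> \<Union> (set Qs)" using Cons.prems(2,3) by auto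
  then show ?case
  proof cases
    case 1
    have "R = {x, y}" if "x \<noteq> y"
      using lv(1) 1 that by (auto simp: card_1_singleton_iff card_2_iff)
    then show ?thesis using 1 by (auto simp: ladder_Cons_iff)
  next
    case 4
    then show ?thesis using Cons.IH[OF lv(2) 4] by (auto simp: ladder_Cons_iff)
  qed (auto simp: ladder_Cons_iff)
qed simp

lemma ladder_level_cases:
  assumes "ladder_levels (R # Qs)" "{a, b} \<in> set (R # Qs)"
  shows "a \<in> R \<and> b \<in> R \<and> a \<notin> \<Union> (set Qs) \<and> b \<notin> \<Union> (set Qs) \<or>
    {a, b} \<in> set Qs \<and> a \<notin> R \<and> b \<notin> R \<and> a \<in> \<Union> (set Qs) \<and> b \<in> \<Union> (set Qs)"
proof (cases "{a, b} = R")
  case True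
  then show ?thesis using ladder_levels_Cons(3)[OF assms(1)] by blast
next
  case False
  then have "{a, b} \<in> set Qs" using assms(2) by auto
  moreover from this have "a \<in> \<Union> (set Qs)" "b \<in> \<Union> (set Qs)" by blast+
  ultimately show ?thesis using ladder_levels_Cons(3)[OF assms(1)] by blast
qed

lemma ladder_incomparable:
  "\<lbrakk>ladder_levels Qs; {a, b} \<in> set Qs; a \<noteq> b\<rbrakk> \<Longrightarrow> (a, b) \<notin> ladder Qs"
proof (induction Qs)
  case (Cons R Qs)
  from ladder_level_cases[OF Cons.prems(1,2)] show ?case
  proof (elim disjE conjE)
    assume "b \<notin> \<Union> (set Qs)"
    then show ?thesis using Cons.prems(3) ladder_in_Field(2)[of a b Qs] by (simp only: ladder_Cons_iff) blast
  next
    assume "{a, b} \<in> set Qs" "a \<notin> R"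
    then show ?thesis using Cons.IH[OF ladder_levels_Cons(2)[OF Cons.prems(1)]] Cons.prems(3)
      by (simp add: ladder_Cons_iff)
  qed
qed simp

lemma ladder_below_twins:
  "\<lbrakk>ladder_levels Qs; {a, b} \<in> set Qs; k \<noteq> a; k \<noteq> b\<rbrakk> \<Longrightarrow> (k, a) \<in> ladder Qs \<longleftrightarrow> (k, b) \<in> ladder Qs"
proof (induction Qs)
  case (Cons R Qs)
  from ladder_level_cases[OF Cons.prems(1,2)] show ?case
  proof (elim disjE conjE)
    assume "a \<notin> \<Union> (set Qs)" "b \<notin> \<Union> (set Qs)"
    then show ?thesis
      using Cons.prems(3,4) ladder_in_Field(2)[of k a Qs] ladder_in_Field(2)[of k b Qs]
      by (simp only: ladder_Cons_iff) blast
  next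
    assume "{a, b} \<in> set Qs" "a \<in> \<Union> (set Qs)" "b \<in> \<Union> (set Qs)"
    then show ?thesis
      using Cons.IH[OF ladder_levels_Cons(2)[OF Cons.prems(1)]] Cons.prems(3,4)
      by (simp only: ladder_Cons_iff) simp
  qed
qed simp

lemma ladder_above_twins:
  "\<lbrakk>ladder_levels Qs; {a, b} \<in> set Qs; k \<noteq> a; k \<noteq> b\<rbrakk> \<Longrightarrow> (a, k) \<in> ladder Qs \<longleftrightarrow> (b, k) \<in> ladder Qs"
proof (induction Qs)
  case (Cons R Qs)
  from ladder_level_cases[OF Cons.prems(1,2)] show ?case
  proof (elim disjE conjE)
    assume "a \<notin> \<Union> (set Qs)" "b \<notin> \<Union> (set Qs)" "a \<in> R" "b \<in> R"
    then show ?thesis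
      using Cons.prems(3,4) ladder_in_Field(1)[of a k Qs] ladder_in_Field(1)[of b k Qs]
      by (simp only: ladder_Cons_iff) blast
  next
    assume "{a, b} \<in> set Qs" "a \<notin> R" "b \<notin> R"
    then show ?thesis
      using Cons.IH[OF ladder_levels_Cons(2)[OF Cons.prems(1)]] Cons.prems(3,4)
      by (simp only: ladder_Cons_iff) simp
  qed
qed simp

lemma ladder_levels_disjoint:
  assumes "ladder_levels Qs" "Q \<in> set Qs" "Q' \<in> set Qs" "x \<in> Q" "x \<in> Q'"
  shows "Q = Q'"
proof -
  obtain i j where ij: "i < length Qs" "Q = Qs ! i" "j < length Qs" "Q' = Qs ! j"
    using assms(2,3) by (auto simp: in_set_conv_nth)
  have "disjoint_family_on ((!) Qs) {..<length Qs}"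
    using assms(1) by (simp add: ladder_levels_def)
  then have "i \<noteq> j \<longrightarrow> Qs ! i \<inter> Qs ! j = {}"
    using ij by (simp add: disjoint_family_on_def)
  then show ?thesis using assms(4,5) ij by blast
qed

section \<open>Posets with two-element levels of twins\<close>

lemma card_2_doubleton: "card {a, b} = 2 \<longleftrightarrow> a \<noteq> b"
  by (auto simp: card_insert_if)

text \<open>All that the induction needs from the shape of \<open>P\<close>. The condition
  \<open>almost_chain\<close> weakens that of \<open>forest\<close>: principal upsets are chains
  except inside a level.\<close>

locale levelled_poset = fin_poset P for P :: "nat rel" +
  fixes \<Q> :: "nat set set"
  assumes level: "Q \<in> \<Q> \<Longrightarrow> card Q = 2 \<and> Q \<subseteq> Field P"
    and disjoint: "\<lbrakk>Q \<in> \<Q>; Q' \<in> \<Q>; x \<in> Q; x \<in> Q'\<rbrakk> \<Longrightarrow> Q = Q'"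
    and incomparable: "{a, b} \<in> \<Q> \<Longrightarrow> (a, b) \<notin> P"
    and below: "\<lbrakk>{a, b} \<in> \<Q>; k \<noteq> a; k \<noteq> b\<rbrakk> \<Longrightarrow> (k, a) \<in> P \<longleftrightarrow> (k, b) \<in> P"
    and above: "\<lbrakk>{a, b} \<in> \<Q>; k \<noteq> a; k \<noteq> b\<rbrakk> \<Longrightarrow> (a, k) \<in> P \<longleftrightarrow> (b, k) \<in> P"
    and almost_chain: "\<lbrakk>(z, x) \<in> P; (z, y) \<in> P\<rbrakk> \<Longrightarrow> (x, y) \<in> P \<or> (y, x) \<in> P \<or> {x, y} \<in> \<Q>"

locale levelled_poset_list = levelled_poset +
  fixes ab :: "(nat \<times> nat) list"
  assumes distinct_ab: "distinct (map (\<lambda>(a, b). {a, b}) ab)"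
    and set_ab: "set (map (\<lambda>(a, b). {a, b}) ab) = \<Q>"
begin

lemma pair_level: "(a, b) \<in> set ab \<Longrightarrow> {a, b} \<in> \<Q>"
  using set_ab by force

lemma level_pair: "{a, b} \<in> \<Q> \<Longrightarrow> (a, b) \<in> set ab \<or> (b, a) \<in> set ab"
  unfolding set_ab[symmetric] by (auto simp: doubleton_eq_iff)

lemma pair_eq:
  assumes "(a, b) \<in> set ab" "(c, d) \<in> set ab" "{a, b} = {c, d}"
  shows "(a, b) = (c, d)"
proof (rule inj_onD[of "\<lambda>(a, b). {a, b}" "set ab"])
  show "inj_on (\<lambda>(a, b). {a, b}) (set ab)" using distinct_ab by (simp add: distinct_map)
  show "(case (a, b) of (a, b) \<Rightarrow> {a, b}) = (case (c, d) of (a, b) \<Rightarrow> {a, b})"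
    unfolding prod.case by (rule assms(3))
qed (rule assms(1,2))+

lemma pair_ne: assumes "(a, b) \<in> set ab" shows "a \<noteq> b"
proof -
  have "card {a, b} = 2" using level[OF pair_level[OF assms]] by (rule conjunct1)
  then show ?thesis by (simp only: card_2_doubleton not_False_eq_True)
qed

lemma pair_antisym: assumes "(a, b) \<in> set ab" shows "(b, a) \<notin> set ab"
proof
  assume "(b, a) \<in> set ab"
  from pair_eq[OF assms this insert_commute] pair_ne[OF assms] show False by simp
qed

lemma pair_meet:
  assumes "(a, b) \<in> set ab" "(c, d) \<in> set ab" "x \<in> {a, b}" "x \<in> {c, d}"
  shows "a = c" "b = d"
proof -
  have "{a, b} = {c, d}" by (rule disjoint[OF pair_level pair_level, OF assms])
  from pair_eq[OF assms(1,2) this] show "a = c" "b = d" by simp_all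
qed

text \<open>The intermediate posets, \<open>D\<close> being the pairs still related. Since the
  members of a level are twins, adding the pairs needs no transitive closure.\<close>

definition add_pairs :: "(nat \<times> nat) set \<Rightarrow> nat rel" where "add_pairs D = P \<union> D"

lemma add_pairs_iff: "p \<in> add_pairs D \<longleftrightarrow> p \<in> P \<or> p \<in> D"
  by (simp add: add_pairs_def)

lemma pair_Field: assumes "(a, b) \<in> set ab" shows "a \<in> Field P" "b \<in> Field P"
  using level[OF pair_level[OF assms]] by auto

lemma Field_add_pairs:
  assumes "D \<subseteq> set ab" shows "Field (add_pairs D) = Field P"
proof -
  have "Field D \<subseteq> Field P" using pair_Field assms unfolding Field_def by blast
  then show ?thesis by (auto simp: add_pairs_def)
qed

lemma add_pairs_below:
  assumes D: "D \<subseteq> set ab" and p: "(a, b) \<in> set ab" and k: "k \<noteq> a" "k \<noteq> b"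
  shows "(k, a) \<in> add_pairs D \<longleftrightarrow> (k, b) \<in> add_pairs D"
proof -
  have "(k, x) \<notin> D" if "x \<in> {a, b}" for x
    using pair_meet[OF p, of k x x] that D k by auto
  then show ?thesis using below[OF pair_level[OF p] k] by (simp add: add_pairs_iff)
qed

lemma add_pairs_above:
  assumes D: "D \<subseteq> set ab" and p: "(a, b) \<in> set ab" and k: "k \<noteq> a" "k \<noteq> b"
  shows "(a, k) \<in> add_pairs D \<longleftrightarrow> (b, k) \<in> add_pairs D"
proof -
  have "(x, k) \<notin> D" if "x \<in> {a, b}" for x
    using pair_meet[OF p, of x k x] that D k by auto
  then show ?thesis using above[OF pair_level[OF p] k] by (simp add: add_pairs_iff)
qed

text \<open>For transitivity, an added pair among two consecutive relations is bypassed by replacing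
  one twin with the other in the remaining relation.\<close>

lemma finite_poset_add_pairs:
  assumes D: "D \<subseteq> set ab"
  shows "finite_poset (add_pairs D)"
  unfolding finite_poset_iff Field_add_pairs[OF D]
proof (intro conjI ballI)
  show "finite (Field P)" by (rule fin)
  show "(x, x) \<in> add_pairs D" if "x \<in> Field P" for x
    using refl_r[OF that] by (simp add: add_pairs_iff)
  have inc: "(x, y) \<notin> P" "(y, x) \<notin> P" if "(x, y) \<in> D" for x y
    using incomparable[of x y] incomparable[of y x] pair_level[of x y] that D by (auto simp: insert_commute)
  show "trans (add_pairs D)"
  proof (rule transI)
    fix x y z assume xy: "(x, y) \<in> add_pairs D" and yz: "(y, z) \<in> add_pairs D"
    show "(x, z) \<in> add_pairs D"
    proof (cases "(y, z) \<in> D")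
      case True
      then have p: "(y, z) \<in> set ab" using D by blast
      have "x \<noteq> z"
      proof
        assume "x = z"
        then have "(z, y) \<in> D" using xy inc(2)[OF True] by (auto simp: add_pairs_iff)
        then show False using pair_antisym[OF p] D by blast
      qed
      then show ?thesis using add_pairs_below[OF D p, of x] xy yz by (cases "x = y") simp_all
    next
      case yz': False
      show ?thesis
      proof (cases "(x, y) \<in> D")
        case True
        then have p: "(x, y) \<in> set ab" using D by blast
        have "z \<noteq> x" using yz yz' inc(2)[OF True] by (auto simp: add_pairs_iff)
        then show ?thesis using add_pairs_above[OF D p, of z] xy yz by (cases "z = y") simp_all
      next
        case False
        then show ?thesis using xy yz yz' trans_r[of x y z] by (simp add: add_pairs_iff)
      qed
    qed
  qed
  show "antisym (add_pairs D)"
  proof (rule antisymI)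
    fix x y assume "(x, y) \<in> add_pairs D" "(y, x) \<in> add_pairs D"
    then show "x = y"
      using inc[of x y] inc[of y x] pair_antisym[of x y] D antisym_r[of x y] by (auto simp: add_pairs_iff)
  qed
qed

lemma add_pairs_chain:
  assumes D: "D \<subseteq> set ab" and zx: "(z, x) \<in> add_pairs D" and zy: "(z, y) \<in> add_pairs D"
  shows "(x, y) \<in> add_pairs D \<or> (y, x) \<in> add_pairs D \<or> {x, y} \<in> \<Q>"
proof -
  have refl: "(u, u) \<in> add_pairs D" if "u \<in> Field P" for u
    using refl_r[OF that] by (simp add: add_pairs_iff)
  have xF: "x \<in> Field P" using FieldI2[OF zx] by (simp add: Field_add_pairs[OF D])
  have one: "(v, u) \<in> add_pairs D" if "(z, v) \<in> D" "(z, u) \<in> add_pairs D" "u \<noteq> z" "u \<noteq> v" for u v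
    using add_pairs_above[OF D, of z v u] that D by blast
  consider "x = y" | "x = z" | "y = z" | "x \<noteq> y" "x \<noteq> z" "y \<noteq> z" "(z, x) \<in> D"
    | "x \<noteq> y" "x \<noteq> z" "y \<noteq> z" "(z, y) \<in> D" | "(z, x) \<in> P" "(z, y) \<in> P"
    using zx zy by (auto simp: add_pairs_iff)
  then show ?thesis
  proof cases
    case 1 then show ?thesis using refl[OF xF] by simp
  next
    case 2 then show ?thesis using zy by simp
  next
    case 3 then show ?thesis using zx by simp
  next
    case 4 then show ?thesis using one[of x y] zy by simp
  next
    case 5 then show ?thesis using one[of y x] zx by simp
  next
    case 6 then show ?thesis using almost_chain[OF 6] by (auto simp: add_pairs_iff)
  qed
qed

lemma forest_add_all: "forest (add_pairs (set ab))"
proof unfold_locales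
  show "finite_poset (add_pairs (set ab))" by (rule finite_poset_add_pairs) simp
  fix x y z assume "(x, y) \<in> add_pairs (set ab)" "(x, z) \<in> add_pairs (set ab)"
  from add_pairs_chain[OF order_refl this] show "(y, z) \<in> add_pairs (set ab) \<or> (z, y) \<in> add_pairs (set ab)"
    using level_pair[of y z] by (auto simp: add_pairs_iff)
qed

lemma twin_levels_add_pairs:
  assumes D: "D \<subseteq> set ab" and p: "(a, b) \<in> D"
  shows "twin_levels (add_pairs D) a b"
proof unfold_locales
  have p': "(a, b) \<in> set ab" using p D by blast
  show "finite_poset (add_pairs D)" by (rule finite_poset_add_pairs[OF D])
  show "(a, b) \<in> add_pairs D" using p by (simp add: add_pairs_iff)
  show "a \<noteq> b" by (rule pair_ne[OF p'])
  show "(k, a) \<in> add_pairs D \<longleftrightarrow> (k, b) \<in> add_pairs D" if "k \<noteq> a" "k \<noteq> b" for k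
    by (rule add_pairs_below[OF D p' that])
  show "(a, k) \<in> add_pairs D \<longleftrightarrow> (b, k) \<in> add_pairs D" if "k \<noteq> a" "k \<noteq> b" for k
    by (rule add_pairs_above[OF D p' that])
  fix z y assume "(z, a) \<in> add_pairs D" "z \<noteq> a" "(z, y) \<in> add_pairs D"
  from add_pairs_chain[OF D this(1,3)]
  show "(y, a) \<in> add_pairs D \<or> (a, y) \<in> add_pairs D"
  proof (elim disjE)
    assume ay: "{a, y} \<in> \<Q>"
    then have "{a, y} = {a, b}" by (rule disjoint[OF _ pair_level[OF p'], of _ a]) simp_all
    then have "y = b" using pair_ne[OF p'] by (auto simp: doubleton_eq_iff)
    then show ?thesis using p by (simp add: add_pairs_iff)
  qed simp_all
qed

text \<open>The elements below the first member of a pair are the same in all intermediate posets,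
  so the invariant can be stated in \<open>P\<close> once and for all.\<close>

lemma below_pair_add_pairs:
  assumes D: "D \<subseteq> set ab" and p: "(a, b) \<in> set ab"
  shows "(k, a) \<in> add_pairs D \<longleftrightarrow> (k, a) \<in> P"
proof -
  have "(k, a) \<notin> D"
  proof
    assume "(k, a) \<in> D"
    then have ka: "(k, a) \<in> set ab" using D by blast
    then have "a = b" using pair_meet(2)[OF ka p, of a] by simp
    then show False using pair_ne[OF p] by simp
  qed
  then show ?thesis by (simp add: add_pairs_iff)
qed

lemma distinct_ab': "distinct ab"
  using distinct_ab by (simp add: distinct_map)

text \<open>Each step removes exactly one added pair, because that pair neither is a relation of
  \<open>P\<close> nor occurs again later in the list.\<close>

lemma poset_seq_eq: "t \<le> length ab \<Longrightarrow> poset_seq P ab t = add_pairs (set (drop t ab))"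
proof (induction t)
  case 0
  have "trans (P \<union> set ab)"
    using finite_poset_add_pairs[of "set ab"] by (simp add: finite_poset_iff add_pairs_def)
  then show ?case by (simp add: add_pairs_def trancl_id)
next
  case (Suc t)
  then have t: "t < length ab" by simp
  have d: "drop t ab = ab ! t # drop (Suc t) ab" using t by (simp add: Cons_nth_drop_Suc)
  have "ab ! t \<notin> set (drop (Suc t) ab)"
    using distinct_ab' d distinct_drop[of ab t] by simp
  moreover have "ab ! t \<notin> P"
    using incomparable[OF pair_level, of "fst (ab ! t)" "snd (ab ! t)"] t by simp
  ultimately show ?case
    using Suc t by (auto simp: d add_pairs_def)
qed

definition consistent :: "linear_form \<Rightarrow> nat \<times> nat \<Rightarrow> bool" where
  "consistent c p \<longleftrightarrow> c (fst p) = c (snd p) \<or> c (fst p) = 0 \<and> (\<forall>k. (k, fst p) \<in> P \<longrightarrow> c k = 0)"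

text \<open>Twins \<open>a\<close> and \<open>b\<close> are related to \<open>a'\<close> and
  \<open>b'\<close> alike, so reflection multiplies both coefficients by the same sign and creates
  no new nonzero ones. The exchange touches only \<open>a'\<close> and \<open>b'\<close>; if one of
  them is below \<open>a\<close>, so is the other, and both coefficients were already zero.\<close>

lemma consistent_replace_form:
  assumes D: "D \<subseteq> set ab" and p: "(a, b) \<in> set ab" and q: "(a', b') \<in> set ab" and ne: "(a, b) \<noteq> (a', b')"
    and c: "consistent c (a, b)" and d: "d \<in># replace_form (add_pairs D) a' b' c"
  shows "consistent d (a, b)"
proof -
  let ?r = "add_pairs D"
  have dj: "a \<noteq> a'" "a \<noteq> b'" "b \<noteq> a'" "b \<noteq> b'"
    using pair_meet[OF p q] ne by auto
  have tw: "(a, b') \<in> ?r \<longleftrightarrow> (b, b') \<in> ?r" "(a, a') \<in> ?r \<longleftrightarrow> (b, a') \<in> ?r"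
    by (rule add_pairs_above[OF D p dj(2)[symmetric] dj(4)[symmetric]],
      rule add_pairs_above[OF D p dj(1)[symmetric] dj(3)[symmetric]])
  let ?refl = "\<lambda>k. (if (k, b') \<notin> ?r then c k else 0) - (if (k, a') \<in> ?r \<and> k \<noteq> a' then c k else 0)"
  let ?swap = "\<lambda>k. c k - (if k = b' then c b' else 0) + (if k = a' then c b' else 0)"
  consider "d = c" | "d = ?refl" | "c a' = 0" "d = ?swap"
    using d unfolding replace_form_def by (auto split: if_splits)
  then show ?thesis
  proof cases
    case 1
    then show ?thesis using c by simp
  next
    case 2
    have "d a = d b" if "c a = c b" using that tw dj unfolding 2 by simp
    moreover have "d k = 0" if "c k = 0" for k using that unfolding 2 by simp
    ultimately show ?thesis using c by (auto simp: consistent_def)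
  next
    case 3
    have eq: "d a = c a" "d b = c b" using dj unfolding 3(2) by simp_all
    have "d k = 0" if z: "\<forall>k. (k, a) \<in> P \<longrightarrow> c k = 0" and k: "(k, a) \<in> P" for k
    proof -
      have "(a', a) \<in> P \<longleftrightarrow> (b', a) \<in> P" by (rule above[OF pair_level[OF q] dj(1,2)])
      then show ?thesis using z k 3(1) unfolding 3(2) by auto
    qed
    then show ?thesis using c eq by (auto simp: consistent_def)
  qed
qed

text \<open>An upset containing \<open>a\<close> contains \<open>b\<close>; one that misses
  \<open>a\<close> misses everything below it.\<close>

lemma consistent_upset_form:
  assumes S: "S \<in> upsets (add_pairs (set ab))" and p: "(a, b) \<in> set ab"
  shows "consistent (upset_form S) (a, b)"
proof -
  have S_closed: "y \<in> S" if "x \<in> S" "(x, y) \<in> add_pairs (set ab)" for x y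
    using S that by (simp add: upsets_def)
  show ?thesis
  proof (cases "a \<in> S")
    case True
    then have "b \<in> S" using S_closed[of a b] p by (simp add: add_pairs_iff)
    then show ?thesis using True by (simp add: consistent_def upset_form_def)
  next
    case False
    have "k \<notin> S" if "(k, a) \<in> P" for k using S_closed[of k a] that False by (auto simp: add_pairs_iff)
    then show ?thesis using False by (simp add: consistent_def upset_form_def)
  qed
qed

lemma poset_seq_0: "poset_seq P ab 0 = add_pairs (set ab)"
  using poset_seq_eq[of 0] by (simp del: poset_seq.simps)

lemma sum_replicate_mset_iff:
  assumes "finite A"
  shows "c \<in># (\<Sum>S\<in>A. replicate_mset (m S) (f S)) \<longleftrightarrow> (\<exists>S\<in>A. m S > 0 \<and> c = f S)"
  using assms by (induction rule: finite_induct) auto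

lemma form_seq_consistent:
  assumes "t \<le> s" "s < length ab" "c \<in># form_seq P ab t"
  shows "consistent c (ab ! s)"
  using assms
proof (induction t arbitrary: c)
  case 0
  obtain a b where p: "ab ! s = (a, b)" by fastforce
  then have abm: "(a, b) \<in> set ab" using 0(2) nth_mem by metis
  interpret forest: forest "add_pairs (set ab)" by (rule forest_add_all)
  obtain S where "S \<in> upsets (add_pairs (set ab))" "c = upset_form S"
    using 0(3) unfolding form_seq.simps poset_seq_0 sum_replicate_mset_iff[OF forest.finite_upsets] by blast
  then show ?case using consistent_upset_form[OF _ abm] p by simp
next
  case (Suc t)
  obtain a b where p: "ab ! s = (a, b)" by fastforce
  obtain a' b' where q: "ab ! t = (a', b')" by fastforce
  have t: "t < length ab" "t \<noteq> s" using Suc.prems by simp_all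
  have mem: "(a, b) \<in> set ab" "(a', b') \<in> set ab" using Suc.prems(2) t(1) p q nth_mem by metis+
  have ne: "(a, b) \<noteq> (a', b')"
    using distinct_ab' Suc.prems(2) t p q by (metis nth_eq_iff_index_eq)
  obtain d where d: "d \<in># form_seq P ab t" "c \<in># replace_form (poset_seq P ab t) a' b' d"
    using Suc.prems(3) q by auto
  have D: "set (drop t ab) \<subseteq> set ab" by (rule set_drop_subset)
  have "consistent d (a, b)" using Suc.IH[OF _ Suc.prems(2) d(1)] Suc.prems(1) p by simp
  moreover have "c \<in># replace_form (add_pairs (set (drop t ab))) a' b' d"
    using d(2) poset_seq_eq[of t] t(1) by simp
  ultimately show ?case
    using consistent_replace_form[OF D mem ne] p by simp
qed

text \<open>The form of \<open>S\<close> takes the value 1 on \<open>v\<close> if \<open>S\<close>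
  contains the upset generated by \<open>v\<close>, and 0 otherwise. Summing derangement numbers
  over these \<open>S\<close> counts the linear extensions below the generated upset, which are the
  fixed points. Nonnegativity makes \<open>nat\<close> harmless.\<close>

lemma character_sum_form_seq_0:
  assumes v: "set v \<subseteq> Field P"
  shows "character_sum (form_seq P ab 0) v = int (card (fixed_points (add_pairs (set ab)) v))"
proof -
  let ?r = "add_pairs (set ab)"
  interpret forest: forest ?r by (rule forest_add_all)
  have F: "Field ?r = Field P" by (rule Field_add_pairs) simp
  let ?S = "?r `` set v"
  have up: "?S \<in> upsets ?r" using v F by (intro forest.upset_closure) simp
  have sub_iff: "set v \<subseteq> S \<longleftrightarrow> ?S \<subseteq> S" if "S \<in> upsets ?r" for S
  proof
    show "set v \<subseteq> S" if "?S \<subseteq> S" using that v forest.refl_r unfolding F by blast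
    show "?S \<subseteq> S" if "set v \<subseteq> S" using that \<open>S \<in> upsets ?r\<close> unfolding upsets_def by blast
  qed
  have prod_form: "prod_list (map (upset_form S) v) = (if set v \<subseteq> S then 1 else 0)" for S
    by (induction v) (auto simp: upset_form_def)
  have char_sum: "character_sum (\<Sum>S\<in>A. replicate_mset (m S) (f S)) v
      = (\<Sum>S\<in>A. int (m S) * prod_list (map (f S) v))"
    if "finite A" for A :: "nat set set" and m f
    using that
  proof (induction rule: finite_induct)
    case (insert S A)
    have "(\<Sum>c\<in>#replicate_mset k g. prod_list (map c v)) = int k * prod_list (map g v)" for k and g :: "nat \<Rightarrow> int"
      by (induction k) (simp_all add: algebra_simps)
    then show ?case using insert by (simp add: character_sum_def)
  qed (simp add: character_sum_def)
  have "character_sum (form_seq P ab 0) v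
      = (\<Sum>S\<in>upsets ?r. int (nat (derangement_number (upset_lattice ?r) S)) * prod_list (map (upset_form S) v))"
    unfolding form_seq.simps poset_seq_0 by (rule char_sum[OF forest.finite_upsets])
  also have "\<dots> = (\<Sum>S\<in>upsets ?r. if ?S \<subseteq> S then forest.derangements S else 0)"
    by (intro sum.cong refl) (simp add: forest.derangement_number_eq forest.derangements_nonneg prod_form sub_iff)
  also have "\<dots> = (\<Sum>S | S \<in> upsets ?r \<and> ?S \<subseteq> S. forest.derangements S)"
    by (simp add: sum.inter_filter[OF forest.finite_upsets])
  also have "\<dots> = forest.num_below ?S" by (rule forest.sum_derangements[OF up])
  also have "\<dots> = int (card (fixed_points ?r v))"
    using forest.card_fixed_points[of v] v F by (simp add: forest.num_below_def)
  finally show ?thesis .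
qed

lemma compatible_if_consistent:
  assumes D: "D \<subseteq> set ab" and p: "(a, b) \<in> D" and c: "consistent c (a, b)"
  shows "twin_levels.compatible (add_pairs D) a b c"
proof -
  interpret twin: twin_levels "add_pairs D" a b by (rule twin_levels_add_pairs[OF D p])
  have "(a, b) \<in> set ab" using D p by blast
  then show ?thesis
    using c below_pair_add_pairs[OF D] by (simp add: twin.compatible_def consistent_def)
qed

lemma character_sum_form_seq:
  assumes "t \<le> length ab" "set v \<subseteq> Field P"
  shows "int (card (fixed_points (add_pairs (set (drop t ab))) v)) = character_sum (form_seq P ab t) v"
  using assms
proof (induction t arbitrary: v)
  case 0
  then show ?case using character_sum_form_seq_0[of v] by (simp del: form_seq.simps)
next
  case (Suc t)
  let ?D = "set (drop t ab)"
  have t: "t < length ab" using Suc.prems by simp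
  obtain a b where p: "ab ! t = (a, b)" by fastforce
  have D: "?D \<subseteq> set ab" by (rule set_drop_subset)
  have d: "drop t ab = (a, b) # drop (Suc t) ab" using t p by (metis Cons_nth_drop_Suc)
  have abD: "(a, b) \<in> ?D" by (simp add: d)
  have seq: "poset_seq P ab t = add_pairs ?D" using poset_seq_eq t by simp
  have "add_pairs (set (drop (Suc t) ab)) = poset_seq P ab (Suc t)" using poset_seq_eq[of "Suc t"] t by simp
  then have minus: "add_pairs (set (drop (Suc t) ab)) = add_pairs ?D - {(a, b)}" by (simp add: seq p)
  have "int (card (fixed_points (add_pairs ?D - {(a, b)}) v))
      = character_sum (\<Sum>c\<in>#form_seq P ab t. replace_form (add_pairs ?D) a b c) v"
  proof (rule fixed_points_split_level[OF twin_levels_add_pairs[OF D abD]])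
    show "twin_levels.compatible (add_pairs ?D) a b c" if "c \<in># form_seq P ab t" for c
      using compatible_if_consistent[OF D abD] form_seq_consistent[OF order_refl t that] p by simp
    show "int (card (fixed_points (add_pairs ?D) u)) = character_sum (form_seq P ab t) u"
      if "set u \<subseteq> Field (add_pairs ?D)" for u
      using Suc.IH[of u] that t by (simp add: Field_add_pairs[OF D])
    show "set v \<subseteq> Field (add_pairs ?D)" using Suc.prems by (simp add: Field_add_pairs[OF D])
  qed
  then show ?case by (simp only: minus form_seq.simps seq p fst_conv snd_conv)
qed

lemma poset_seq_length: "poset_seq P ab (length ab) = P"
  using poset_seq_eq[OF order_refl] by (simp add: add_pairs_def)

theorem eigenvalue_forms_form_seq:
  assumes "Field P = {1..n}" "distinct ws" "set ws = linear_extensions P"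
  shows "eigenvalue_forms n (promotion_matrix P ws) (form_seq P ab (length ab))"
proof (rule eigenvalue_forms_if_fixed_points[OF assms])
  fix v :: "nat list" assume "set v \<subseteq> {1..n}"
  then show "int (card (fixed_points P v)) = character_sum (form_seq P ab (length ab)) v"
    using character_sum_form_seq[OF order_refl, of v] assms(1) by (simp add: add_pairs_def)
qed

lemma forest_facts:
  "rooted_forest (poset_seq P ab 0)"
  "S \<in> upsets (poset_seq P ab 0) \<Longrightarrow> 0 \<le> derangement_number (upset_lattice (poset_seq P ab 0)) S"
proof -
  interpret forest: forest "add_pairs (set ab)" by (rule forest_add_all)
  show "rooted_forest (poset_seq P ab 0)" unfolding poset_seq_0 by (rule forest.rooted_forest)
  show "0 \<le> derangement_number (upset_lattice (poset_seq P ab 0)) S" if "S \<in> upsets (poset_seq P ab 0)"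
    using that unfolding poset_seq_0 by (simp add: forest.derangement_number_eq forest.derangements_nonneg)
qed

lemma form_seq_cases:
  assumes "t < length ab" "c \<in># form_seq P ab t"
  shows "\<not> (c (fst (ab ! t)) \<noteq> 0 \<and> c (snd (ab ! t)) = 0)"
  using form_seq_consistent[OF order_refl assms] by (auto simp: consistent_def)

end

text \<open>The first claim of the theorem mentions no list of pairs; choosing one lets the explicit
  forms serve as its witness.\<close>

lemma (in levelled_poset) ex_level_list:
  obtains ab where "levelled_poset_list P \<Q> ab"
proof -
  have "\<Q> \<subseteq> Pow (Field P)" using level by blast
  then have "finite \<Q>" using fin by (meson finite_Pow_iff finite_subset)
  then obtain qs where qs: "distinct qs" "set qs = \<Q>" using finite_distinct_list by blast
  have "\<forall>Q\<in>\<Q>. \<exists>p. (case p of (a, b) \<Rightarrow> {a, b}) = Q"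
  proof
    fix Q assume "Q \<in> \<Q>"
    then have "card Q = 2" using level by blast
    then obtain a b where "Q = {a, b}" by (auto simp: card_2_iff)
    then show "\<exists>p. (case p of (a, b) \<Rightarrow> {a, b}) = Q" by (intro exI[of _ "(a, b)"]) simp
  qed
  then obtain f where f: "\<forall>Q\<in>\<Q>. (case f Q of (a, b) \<Rightarrow> {a, b}) = Q" by metis
  have map_f: "map (\<lambda>(a, b). {a, b}) (map f qs) = qs"
    unfolding map_map comp_def by (rule map_idI, rule bspec[OF f]) (simp only: qs(2))
  then have "levelled_poset_list P \<Q> (map f qs)"
    using qs by unfold_locales (simp_all only: map_f)
  then show thesis by (rule that)
qed

section \<open>One summand: a rooted forest below a ladder\<close>

locale forest_ladder =
  fixes F :: "'a rel" and Qs :: "'a set list"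
  assumes forest: "rooted_forest F" and levels: "ladder_levels Qs"
    and disjoint: "Field F \<inter> Field (ladder Qs) = {}"
begin

abbreviation R :: "'a rel" where "R \<equiv> F \<oplus>\<^sub>o ladder Qs"

lemma R_iff: "(x, y) \<in> R \<longleftrightarrow> (x, y) \<in> F \<or> (x, y) \<in> ladder Qs \<or> x \<in> Field F \<and> y \<in> \<Union> (set Qs)"
  by (simp add: ordinal_sum_iff Field_ladder)

lemma Field_R: "Field R = Field F \<union> \<Union> (set Qs)"
  by (simp add: Field_ordinal_sum Field_ladder)

lemma F_Field: "(x, y) \<in> F \<Longrightarrow> x \<in> Field F" "(x, y) \<in> F \<Longrightarrow> y \<in> Field F"
  by (auto intro: FieldI1 FieldI2)

lemma disj: "x \<in> Field F \<Longrightarrow> x \<notin> \<Union> (set Qs)"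
  using disjoint unfolding Field_ladder by blast

lemma finite_poset_R: "finite_poset R"
proof -
  interpret forest F by (rule rooted_forest_imp_forest[OF forest])
  show ?thesis by (rule finite_poset_ordinal_sum[OF poset finite_poset_ladder[OF levels] disjoint])
qed

lemma level_mem: "{a, b} \<in> set Qs \<Longrightarrow> a \<in> \<Union> (set Qs) \<and> b \<in> \<Union> (set Qs)"
  by blast

lemma R_incomparable: "\<lbrakk>{a, b} \<in> set Qs; a \<noteq> b\<rbrakk> \<Longrightarrow> (a, b) \<notin> R"
  using ladder_incomparable[OF levels] level_mem[of a b] disj[of a] F_Field[of a b] by (auto simp only: R_iff)

lemma R_below:
  assumes "{a, b} \<in> set Qs" "k \<noteq> a" "k \<noteq> b" shows "(k, a) \<in> R \<longleftrightarrow> (k, b) \<in> R"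
proof -
  have "(k, a) \<notin> F" "(k, b) \<notin> F" using level_mem[OF assms(1)] disj F_Field(2) by metis+
  then show ?thesis
    using ladder_below_twins[OF levels assms] level_mem[OF assms(1)] by (auto simp only: R_iff)
qed

lemma R_above:
  assumes "{a, b} \<in> set Qs" "k \<noteq> a" "k \<noteq> b" shows "(a, k) \<in> R \<longleftrightarrow> (b, k) \<in> R"
proof -
  have "a \<notin> Field F" "b \<notin> Field F" using level_mem[OF assms(1)] disj by metis+
  moreover from this have "(a, k) \<notin> F" "(b, k) \<notin> F" using F_Field(1) by metis+
  ultimately show ?thesis
    using ladder_above_twins[OF levels assms] by (auto simp only: R_iff)
qed

lemma R_almost_chain:
  assumes "(z, x) \<in> R" "(z, y) \<in> R"
  shows "(x, y) \<in> R \<or> (y, x) \<in> R \<or> x \<noteq> y \<and> {x, y} \<in> set Qs"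
proof -
  interpret forest F by (rule rooted_forest_imp_forest[OF forest])
  have mem: "x \<in> Field F \<or> x \<in> \<Union> (set Qs)" "y \<in> Field F \<or> y \<in> \<Union> (set Qs)"
    using FieldI2[OF assms(1)] FieldI2[OF assms(2)] by (simp_all add: Field_R)
  consider "x \<in> Field F" "y \<in> Field F" | "x \<in> \<Union> (set Qs)" "y \<in> \<Union> (set Qs)"
    | "x \<in> Field F" "y \<in> \<Union> (set Qs)" | "y \<in> Field F" "x \<in> \<Union> (set Qs)"
    using mem by blast
  then show ?thesis
  proof cases
    case 1
    have "(z, x) \<in> F" "(z, y) \<in> F"
      using assms disj[OF 1(1)] disj[OF 1(2)] ladder_in_Field(2) unfolding R_iff by metis+
    then show ?thesis using chain by (auto simp only: R_iff)
  next
    case 2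
    then show ?thesis using ladder_total[OF levels 2] by (auto simp only: R_iff)
  qed (simp_all add: R_iff)
qed

end

theorem theorem5:
  fixes n k :: nat
    and P :: "nat rel"
    and F :: "nat \<Rightarrow> nat rel"
    and L :: "nat \<Rightarrow> nat set list"
    and ws :: "nat list list"
  assumes forests: "\<And>i. i \<in> {1..k} \<Longrightarrow> rooted_forest (F i)"
    and ladders: "\<And>i. i \<in> {1..k} \<Longrightarrow> ladder_levels (L i)"
    and disjoint_FL: "\<And>i. i \<in> {1..k} \<Longrightarrow> Field (F i) \<inter> Field (ladder (L i)) = {}"
    and disjoint_summands: "disjoint_family_on (\<lambda>i. Field (F i \<oplus>\<^sub>o ladder (L i))) {1..k}"
    and P: "P = (\<Union>i\<in>{1..k}. F i \<oplus>\<^sub>o ladder (L i))"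
    and ground_set: "Field P = {1..n}"
    and enumeration: "distinct ws" "set ws = linear_extensions P"
  shows "(\<exists>E. eigenvalue_forms n (promotion_matrix P ws) E) \<and>
    (\<forall>ab. two_level_list k L ab \<longrightarrow>
       rooted_forest (poset_seq P ab 0) \<and>
       poset_seq P ab (length ab) = P \<and>
       (\<forall>S\<in>upsets (poset_seq P ab 0).
          derangement_number (upset_lattice (poset_seq P ab 0)) S \<ge> 0) \<and>
       (\<forall>t<length ab. \<forall>c\<in>#form_seq P ab t.
          \<not> (c (fst (ab ! t)) \<noteq> 0 \<and> c (snd (ab ! t)) = 0)) \<and>
       eigenvalue_forms n (promotion_matrix P ws) (form_seq P ab (length ab)))"
proof -
  define R where "R i = F i \<oplus>\<^sub>o ladder (L i)" for i
  define \<Q> where "\<Q> = {Q. card Q = 2 \<and> (\<exists>i\<in>{1..k}. Q \<in> set (L i))}"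
  have fl: "forest_ladder (F i) (L i)" if "i \<in> {1..k}" for i
    using forests ladders disjoint_FL that by (simp add: forest_ladder_def)
  note disj = disjoint_Fields_eq[OF disjoint_summands[folded R_def]]
  have P_iff: "(x, y) \<in> P \<longleftrightarrow> (\<exists>i\<in>{1..k}. (x, y) \<in> R i)" for x y
    by (simp add: P R_def)
  have level_Field: "Q \<subseteq> Field (R i)" if "i \<in> {1..k}" "Q \<in> set (L i)" for Q i
    using that by (auto simp: R_def Field_ordinal_sum Field_ladder)
  \<comment> \<open>A relation of \<open>P\<close> that touches the ground set of a summand belongs
    to this summand, which reduces the conditions on levels to a single forest with its
    ladder.\<close>
  have P_local: "(x, y) \<in> P \<longleftrightarrow> (x, y) \<in> R i"
    if i: "i \<in> {1..k}" and xy: "x \<in> Field (R i) \<or> y \<in> Field (R i)" for x y i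
  proof
    assume "(x, y) \<in> P"
    then obtain j where j: "j \<in> {1..k}" "(x, y) \<in> R j" by (auto simp: P_iff)
    have "i = j" using xy disj[OF i j(1)] FieldI1[OF j(2)] FieldI2[OF j(2)] by blast
    then show "(x, y) \<in> R i" using j(2) by simp
  qed (use i P_iff in blast)
  have level_index: "\<exists>i\<in>{1..k}. {a, b} \<in> set (L i) \<and> a \<noteq> b \<and> a \<in> Field (R i) \<and> b \<in> Field (R i)"
    if "{a, b} \<in> \<Q>" for a b
    using that level_Field by (fastforce simp: \<Q>_def card_2_doubleton)
  interpret levelled_poset P \<Q>
  proof unfold_locales
    show "finite_poset P"
      unfolding P using disjoint_summands forest_ladder.finite_poset_R[OF fl]
      by (intro finite_poset_disjoint_union) simp_all
    fix Q assume "Q \<in> \<Q>"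
    then obtain i where i: "card Q = 2" "i \<in> {1..k}" "Q \<in> set (L i)" by (auto simp: \<Q>_def)
    have "Field (R i) \<subseteq> Field P" using i(2) unfolding P R_def Field_UN by blast
    then show "card Q = 2 \<and> Q \<subseteq> Field P" using i level_Field by blast
  next
    fix Q Q' x assume "Q \<in> \<Q>" "Q' \<in> \<Q>" and x: "x \<in> Q" "x \<in> Q'"
    then obtain i j where i: "i \<in> {1..k}" "Q \<in> set (L i)" and j: "j \<in> {1..k}" "Q' \<in> set (L j)"
      by (auto simp: \<Q>_def)
    have "i = j" using disj[OF i(1) j(1)] level_Field[OF i] level_Field[OF j] x by blast
    then show "Q = Q'" using ladder_levels_disjoint[OF ladders[OF i(1)] i(2) _ x] j(2) by simp
  next
    fix a b assume "{a, b} \<in> \<Q>"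
    then obtain i where i: "i \<in> {1..k}" "{a, b} \<in> set (L i)" "a \<noteq> b" "a \<in> Field (R i)" "b \<in> Field (R i)"
      using level_index by blast
    show "(a, b) \<notin> P"
      using forest_ladder.R_incomparable[OF fl[OF i(1)] i(2,3)] P_local[OF i(1), of a b] i(4) by (simp add: R_def)
    fix k' assume k': "k' \<noteq> a" "k' \<noteq> b"
    show "(k', a) \<in> P \<longleftrightarrow> (k', b) \<in> P"
      using forest_ladder.R_below[OF fl[OF i(1)] i(2) k'] P_local[OF i(1), of k'] i(4,5) by (simp add: R_def)
    show "(a, k') \<in> P \<longleftrightarrow> (b, k') \<in> P"
      using forest_ladder.R_above[OF fl[OF i(1)] i(2) k'] P_local[OF i(1), of _ k'] i(4,5) by (simp add: R_def)
  next
    fix z x y assume z: "(z, x) \<in> P" "(z, y) \<in> P"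
    obtain i where i: "i \<in> {1..k}" "(z, x) \<in> R i" using z(1) by (auto simp: P_iff)
    have "(z, y) \<in> R i" using P_local[OF i(1), of z y] FieldI1[OF i(2)] z(2) by simp
    with forest_ladder.R_almost_chain[OF fl[OF i(1)]] i(2)
    have "(x, y) \<in> R i \<or> (y, x) \<in> R i \<or> x \<noteq> y \<and> {x, y} \<in> set (L i)"
      by (simp add: R_def)
    then show "(x, y) \<in> P \<or> (y, x) \<in> P \<or> {x, y} \<in> \<Q>"
      using i(1) by (auto simp: P_iff \<Q>_def card_2_doubleton)
  qed
  have list: "levelled_poset_list P \<Q> ab" if "two_level_list k L ab" for ab
    using that by unfold_locales (simp_all add: two_level_list_def \<Q>_def)
  show ?thesis
  proof (intro conjI allI impI)
    obtain ab where "levelled_poset_list P \<Q> ab" by (rule ex_level_list)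
    then show "\<exists>E. eigenvalue_forms n (promotion_matrix P ws) E"
      using levelled_poset_list.eigenvalue_forms_form_seq[OF _ ground_set enumeration] by blast
  next
    fix ab assume "two_level_list k L ab"
    then interpret levelled_poset_list P \<Q> ab by (rule list)
    show "rooted_forest (poset_seq P ab 0)" by (rule forest_facts(1))
    show "poset_seq P ab (length ab) = P" by (rule poset_seq_length)
    show "\<forall>S\<in>upsets (poset_seq P ab 0). derangement_number (upset_lattice (poset_seq P ab 0)) S \<ge> 0"
      using forest_facts(2) by blast
    show "\<forall>c\<in>#form_seq P ab t. \<not> (c (fst (ab ! t)) \<noteq> 0 \<and> c (snd (ab ! t)) = 0)" if "t < length ab" for t
      by (rule ballI) (rule form_seq_cases[OF that])
    show "eigenvalue_forms n (promotion_matrix P ws) (form_seq P ab (length ab))"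
      by (rule eigenvalue_forms_form_seq[OF ground_set enumeration])
  qed
qed

end
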